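(* Let $\mathcal{G}<\mathrm{SU}(3)$ be either $\Sigma(168)=\langle Y,Z\rangle$ or $\Sigma(72\times3)=\langle V,X\rangle$. Then $\mathcal{G}$ is an inaccessible symmetry for each of the $\mathrm{SU}(3)$ irreducible representations with Dynkin labels $(1,1)$, $(3,0)$, $(0,3)$ and $(2,2)$, i.e. none of them contains a nonzero $\mathcal{G}$-fixed vector. Consequently, for every $N\ge1$, $\mathcal{G}$ acting by global pulses on $N$ qutrits decouples arbitrary one-body terms and arbitrary anisotropic two-body interactions: $\Pi_{\mathcal{G}}\big(\sum_a n_a\lambda_a^{(i)}\big)=0$ for all $i$ and all $n\in\mathbb{R}^8$, and $\Pi_{\mathcal{G}}\big(\sum_{a,b}M_{ab}\lambda_a^{(i)}\lambda_b^{(j)}\big)=0$ for all $i\neq j$ and all real $8\times8$ matrices $M$ with $\mathrm{Tr}[M]=0$.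
   Context: Dynkin labels $(d_1,d_2)$ denote the irrep of $\mathrm{SU}(3)$ with highest weight $d_1\mu_1+d_2\mu_2$, with $\mu_1,\mu_2$ the fundamental weights; $(1,0)$ is the standard representation on $\mathbb{C}^3$, $(1,1)$ the adjoint. On $(\mathbb{C}^3)^{\otimes N}$, $\mathrm{SU}(3)$ acts by $\pi(g)=g^{\otimes N}$, and $\Pi_{\mathcal{G}}(S)=\frac{1}{|\mathcal{G}|}\sum_{g\in\mathcal{G}}\pi(g)^\dagger S\pi(g)$. $\lambda_1,\dots,\lambda_8$ are the Gell-Mann matrices (normalized by $\mathrm{Tr}[\lambda_a\lambda_b]=2\delta_{ab}$) and $\lambda_a^{(i)}$ acts as $\lambda_a$ on the $i$-th qutrit and as the identity elsewhere. With $\xi_n=e^{2\pi i/n}$: $$V=\tfrac{1}{\sqrt3\,i}\begin{pmatrix}1&1&1\\1&\xi_3&\xi_3^2\\1&\xi_3^2&\xi_3\end{pmatrix},\quad X=\tfrac{1}{\sqrt3\,i}\begin{pmatrix}1&1&\xi_3^2\\1&\xi_3&\xi_3\\\xi_3&1&\xi_3\end{pmatrix},\quad Y=\mathrm{diag}(\xi_7,\xi_7^2,\xi_7^4),$$ $$Z=\tfrac{i}{\sqrt7}\begin{pmatrix}\xi_7^4-\xi_7^3&\xi_7^2-\xi_7^5&\xi_7-\xi_7^6\\\xi_7^2-\xi_7^5&\xi_7-\xi_7^6&\xi_7^4-\xi_7^3\\\xi_7-\xi_7^6&\xi_7^4-\xi_7^3&\xi_7^2-\xi_7^5\end{pmatrix}.$$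 $\Sigma(168)$ has order 168; $\Sigma(72\times3)$ has order 216 and contains the center $\mathbb{Z}_3$ of $\mathrm{SU}(3)$. *)

theory Defs
  imports "HOL-Analysis.Analysis" "HOL-Algebra.Generated_Groups"
begin

section \<open>The group SU(3) and the two finite subgroups\<close>

definition dagger :: "complex^'m^'n \<Rightarrow> complex^'n^'m" where
  "dagger A = map_matrix cnj (transpose A)"

definition mat3 :: "complex list list \<Rightarrow> complex^3^3" where
  "mat3 xss = vector (map vector xss)"

definition SU3 :: "(complex^3^3) monoid" where
  "SU3 = \<lparr>carrier = {U. dagger U ** U = mat 1 \<and> det U = 1}, mult = (**), one = mat 1\<rparr>"

definition GL :: "(complex^'n^'n) monoid" where
  "GL = \<lparr>carrier = {A. invertible A}, mult = (**), one = mat 1\<rparr>"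

definition \<xi> :: "nat \<Rightarrow> complex" where
  "\<xi> n = exp (2 * of_real pi * \<i> / of_nat n)"

definition V_mat :: "complex^3^3" where
  "V_mat = map_matrix ((*) (1 / (of_real (sqrt 3) * \<i>)))
     (mat3 [[1, 1, 1],
            [1, \<xi> 3, \<xi> 3 ^ 2],
            [1, \<xi> 3 ^ 2, \<xi> 3]])"

definition X_mat :: "complex^3^3" where
  "X_mat = map_matrix ((*) (1 / (of_real (sqrt 3) * \<i>)))
     (mat3 [[1, 1, \<xi> 3 ^ 2],
            [1, \<xi> 3, \<xi> 3],
            [\<xi> 3, 1, \<xi> 3]])"

definition Y_mat :: "complex^3^3" where
  "Y_mat = mat3 [[\<xi> 7, 0, 0],
                 [0, \<xi> 7 ^ 2, 0],
                 [0, 0, \<xi> 7 ^ 4]]"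

definition Z_mat :: "complex^3^3" where
  "Z_mat = map_matrix ((*) (\<i> / of_real (sqrt 7)))
     (mat3 [[\<xi> 7 ^ 4 - \<xi> 7 ^ 3, \<xi> 7 ^ 2 - \<xi> 7 ^ 5, \<xi> 7 - \<xi> 7 ^ 6],
            [\<xi> 7 ^ 2 - \<xi> 7 ^ 5, \<xi> 7 - \<xi> 7 ^ 6, \<xi> 7 ^ 4 - \<xi> 7 ^ 3],
            [\<xi> 7 - \<xi> 7 ^ 6, \<xi> 7 ^ 4 - \<xi> 7 ^ 3, \<xi> 7 ^ 2 - \<xi> 7 ^ 5]])"

definition Sigma168 :: "(complex^3^3) set" where
  "Sigma168 = generate SU3 {Y_mat, Z_mat}"

definition Sigma72x3 :: "(complex^3^3) set" where
  "Sigma72x3 = generate SU3 {V_mat, X_mat}"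

section \<open>Irreducible representations of SU(3) and their Dynkin labels\<close>

definition SU3_rep :: "(complex^3^3 \<Rightarrow> complex^'n^'n) \<Rightarrow> bool" where
  "SU3_rep \<rho> \<longleftrightarrow> \<rho> \<in> hom SU3 GL \<and> continuous_on (carrier SU3) \<rho>"

text \<open>The space \<open>complex^'n\<close> is never zero, since index types are nonempty.\<close>

definition SU3_irreducible :: "(complex^3^3 \<Rightarrow> complex^'n^'n) \<Rightarrow> bool" where
  "SU3_irreducible \<rho> \<longleftrightarrow> SU3_rep \<rho> \<and>
     (\<forall>W. vec.subspace W \<longrightarrow> (\<forall>g\<in>carrier SU3. \<forall>w\<in>W. \<rho> g *v w \<in> W) \<longrightarrow> W = {0} \<or> W = UNIV)"

definition diag3 :: "complex^3 \<Rightarrow> complex^3^3" where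
  "diag3 t = (\<chi> i j. if i = j then t $ i else 0)"

text \<open>
  The maximal torus consists of the diagonal matrices in SU(3). The fundamental weights are the
  torus characters \<open>\<mu>\<^sub>1 : diag(t\<^sub>1, t\<^sub>2, t\<^sub>3) \<mapsto> t\<^sub>1\<close> and \<open>\<mu>\<^sub>2 : diag(t\<^sub>1, t\<^sub>2, t\<^sub>3) \<mapsto> t\<^sub>1 t\<^sub>2\<close>; the pair \<open>(a, b)\<close>
  stands for the weight \<open>a \<mu>\<^sub>1 + b \<mu>\<^sub>2\<close>.
\<close>

definition weight_char :: "int \<times> int \<Rightarrow> complex^3 \<Rightarrow> complex" where
  "weight_char w t = (t $ 1) powi (fst w) * (t $ 1 * t $ 2) powi (snd w)"

definition is_weight :: "(complex^3^3 \<Rightarrow> complex^'n^'n) \<Rightarrow> int \<times> int \<Rightarrow> bool" where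
  "is_weight \<rho> w \<longleftrightarrow>
     (\<exists>v. v \<noteq> 0 \<and> (\<forall>t. diag3 t \<in> carrier SU3 \<longrightarrow> \<rho> (diag3 t) *v v = weight_char w t *s v))"

text \<open>
  The simple roots are \<open>\<alpha>\<^sub>1 = 2 \<mu>\<^sub>1 - \<mu>\<^sub>2\<close> and \<open>\<alpha>\<^sub>2 = - \<mu>\<^sub>1 + 2 \<mu>\<^sub>2\<close>, and \<open>w \<le> w'\<close> means that \<open>w' - w\<close> is a
  combination of them with coefficients in \<open>\<nat>\<close>.
\<close>

definition weight_le :: "int \<times> int \<Rightarrow> int \<times> int \<Rightarrow> bool" where
  "weight_le w w' \<longleftrightarrow>
     (\<exists>k l :: nat. fst w' - fst w = 2 * int k - int l \<and> snd w' - snd w = - int k + 2 * int l)"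

definition has_highest_weight :: "(complex^3^3 \<Rightarrow> complex^'n^'n) \<Rightarrow> int \<times> int \<Rightarrow> bool" where
  "has_highest_weight \<rho> w \<longleftrightarrow> is_weight \<rho> w \<and> (\<forall>w'. is_weight \<rho> w' \<longrightarrow> weight_le w' w)"

definition irrep_with_dynkin_labels :: "nat \<times> nat \<Rightarrow> (complex^3^3 \<Rightarrow> complex^'n^'n) \<Rightarrow> bool" where
  "irrep_with_dynkin_labels d \<rho> \<longleftrightarrow>
     SU3_irreducible \<rho> \<and> has_highest_weight \<rho> (int (fst d), int (snd d))"

definition inaccessible_symmetry ::
    "(complex^3^3) set \<Rightarrow> (complex^3^3 \<Rightarrow> complex^'n^'n) \<Rightarrow> bool" where
  "inaccessible_symmetry G \<rho> \<longleftrightarrow> \<not> (\<exists>v. v \<noteq> 0 \<and> (\<forall>g\<in>G. \<rho> g *v v = v))"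

section \<open>Operators on N qutrits\<close>

text \<open>
  The qutrits are indexed by a finite type \<open>'q\<close>, with \<open>N = CARD('q)\<close>. The product basis of the
  \<open>N\<close>-fold tensor power of \<open>complex^3\<close> is indexed by the functions \<open>'q \<Rightarrow> 3\<close>, so operators on it are
  matrices over this index type.
\<close>

type_synonym 'q operator = "complex^('q \<Rightarrow> 3)^('q \<Rightarrow> 3)"

definition tensor_op :: "('q::finite \<Rightarrow> complex^3^3) \<Rightarrow> 'q operator" where
  "tensor_op A = (\<chi> s t. \<Prod>k\<in>UNIV. A k $ s k $ t k)"

definition global_pulse :: "complex^3^3 \<Rightarrow> ('q::finite) operator" where
  "global_pulse g = tensor_op (\<lambda>k. g)"

definition on_qutrit :: "'q::finite \<Rightarrow> complex^3^3 \<Rightarrow> 'q operator" where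
  "on_qutrit i A = tensor_op (\<lambda>k. if k = i then A else mat 1)"

definition twirl :: "(complex^3^3) set \<Rightarrow> ('q::finite) operator \<Rightarrow> 'q operator" where
  "twirl G S = (1 / real (card G)) *\<^sub>R
     (\<Sum>g\<in>G. dagger (global_pulse g) ** S ** global_pulse g)"

definition gell_mann :: "8 \<Rightarrow> complex^3^3" where
  "gell_mann a =
    (if a = 1 then mat3 [[0, 1, 0], [1, 0, 0], [0, 0, 0]]
     else if a = 2 then mat3 [[0, - \<i>, 0], [\<i>, 0, 0], [0, 0, 0]]
     else if a = 3 then mat3 [[1, 0, 0], [0, - 1, 0], [0, 0, 0]]
     else if a = 4 then mat3 [[0, 0, 1], [0, 0, 0], [1, 0, 0]]
     else if a = 5 then mat3 [[0, 0, - \<i>], [0, 0, 0], [\<i>, 0, 0]]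
     else if a = 6 then mat3 [[0, 0, 0], [0, 0, 1], [0, 1, 0]]
     else if a = 7 then mat3 [[0, 0, 0], [0, 0, - \<i>], [0, \<i>, 0]]
     else map_matrix ((*) (1 / of_real (sqrt 3))) (mat3 [[1, 0, 0], [0, 1, 0], [0, 0, - 2]]))"

end

theory Submission
  imports Defs "HOL-Computational_Algebra.Fundamental_Theorem_Algebra"
begin

text \<open>
  For both groups, the operators on \<open>complex^3 \<otimes> complex^3\<close> that commute with all \<open>g \<otimes> g\<close>, \<open>g \<in> \<G>\<close>, are
  spanned by the identity and the swap, and hence commute with all \<open>g \<otimes> g\<close>, \<open>g \<in> SU3\<close>. For the
  decoupling statement, the twirled interaction is a combination of the identity and the swap, and its
  traces against these two operators vanish.

  For the representations, Weyl symmetry expresses the character \<open>\<chi>\<close> of an irrep with one of the four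
  highest weights through \<open>|tr g|\<^sup>2\<close>, \<open>|tr g\<^sup>2|\<^sup>2\<close>, \<open>tr g\<^sup>2 (cnj (tr g))\<^sup>2\<close>, its conjugate and constants. These
  are linear in \<open>g \<otimes> g \<otimes> cnj g \<otimes> cnj g\<close> on \<open>SU3\<close>, so \<open>\<Sum>x\<in>\<G>. \<chi> (g x)\<close> does not depend on \<open>g \<in> SU3\<close>. Averaging this
  over \<open>SU3\<close> (through a fixed point of a compact group action, in place of a Haar measure) shows that
  the projection onto the \<open>\<G>\<close>-fixed vectors has trace \<open>0\<close>, as a nontrivial irrep has no \<open>SU3\<close>-fixed vector.
\<close>

section \<open>Matrices over the complex numbers and SU(3)\<close>

text \<open>The four irreps are the nontrivial constituents of the tensor product of two copies of
  C^3 and two of its dual. The \<G>-fixed vectors of that space are the operators commuting with all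
  g \<otimes> g, so a two-dimensional commutant leaves room only for the two trivial constituents.
  This cannot be applied to \<open>\<rho>\<close> directly: only its highest weight is known, and
  finding it inside that space would take uniqueness of the irrep with a given highest weight.
  Characters avoid this, as it is enough that every weight has a dominant Weyl image in a
  five-element set, whatever the multiplicities. The price is that weight vectors have to be
  produced from continuity alone, by Fourier analysis on the torus, and that every element of SU(3)
  has to be diagonalized. Finiteness of \<G> carries content as well: over an infinite set both
  \<open>card\<close> and the sum are 0, and \<open>twirl\<close> would vanish for no good reason.
  It comes from invariant lattices, without listing group elements.\<close>

lemma dagger_nth [simp]: "dagger A $ i $ j = cnj (A $ j $ i)"
  by (simp add: dagger_def transpose_def)

lemma dagger_mult: "dagger (A ** B) = dagger B ** dagger A"
  by (simp add: vec_eq_iff matrix_matrix_mult_def mult.commute)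

lemma dagger_dagger [simp]: "dagger (dagger A) = A"
  by (simp add: vec_eq_iff)

lemma dagger_mat_1 [simp]: "dagger (mat 1) = mat 1"
  by (auto simp: vec_eq_iff mat_def)

lemma det_dagger: "det (dagger (A :: complex^'n^'n)) = cnj (det A)"
proof -
  have "det (map_matrix cnj B) = cnj (det B)" for B :: "complex^'n^'n"
    by (simp add: det_def)
  then show ?thesis
    by (simp add: dagger_def det_transpose)
qed

lemma matrix_vector_mult_smult: "A *v (c *s x) = c *s (A *v x)" for A :: "'a::comm_semiring_1^'n^'m"
  by (simp add: vec_eq_iff matrix_vector_mult_def sum_distrib_left mult_ac)

lemma matrix_vector_mult_scaleR_left: "(c *\<^sub>R A) *v x = c *\<^sub>R (A *v x)"
  for A :: "'a::real_algebra_1^'n^'m"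
  by (simp add: vec_eq_iff matrix_vector_mult_def scaleR_sum_right)

lemma trace_scaleR: "trace (c *\<^sub>R A) = c *\<^sub>R trace A" for A :: "'a::real_algebra_1^'n^'n"
  by (simp add: trace_def scaleR_sum_right)

lemma trace_sum: "trace (sum f S) = (\<Sum>x\<in>S. trace (f x :: 'a::comm_semiring_1^'n^'n))"
  by (induction S rule: infinite_finite_induct) (auto simp: trace_add trace_0[simplified])

lemma matrix_mult_sum_right: "A ** sum f S = (\<Sum>x\<in>S. A ** f x)"
  by (induction S rule: infinite_finite_induct) (auto simp: matrix_add_ldistrib)

lemma matrix_mult_sum_left: "sum f S ** A = (\<Sum>x\<in>S. f x ** A)"
  for A :: "'a::semiring_1^'n^'m"
  by (simp add: vec_eq_iff matrix_matrix_mult_def sum_distrib_right sum.swap[of _ S])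

lemma matrix_vector_mult_sum_left: "sum f S *v x = (\<Sum>y\<in>S. f y *v x)"
  for x :: "'a::semiring_1^'n"
  by (simp add: vec_eq_iff matrix_vector_mult_def sum_distrib_right sum.swap[of _ S])

lemma matrix_mult_scaleR_left: "(c *\<^sub>R A) ** B = c *\<^sub>R (A ** B)"
  and matrix_mult_scaleR_right: "A ** (c *\<^sub>R B) = c *\<^sub>R (A ** B)"
  for A :: "'a::real_algebra_1^'n^'m"
  by (simp_all add: vec_eq_iff matrix_matrix_mult_def scaleR_sum_right)

lemma bounded_bilinear_matrix_matrix_mult:
  "bounded_bilinear ((**) :: complex^'n^'m \<Rightarrow> complex^'p^'n \<Rightarrow> complex^'p^'m)"
proof -
  have "bilinear ((**) :: complex^'n^'m \<Rightarrow> complex^'p^'n \<Rightarrow> complex^'p^'m)"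
    unfolding bilinear_def
    by (auto intro!: linearI simp: vec_eq_iff matrix_matrix_mult_def sum.distrib algebra_simps
        scaleR_sum_right)
  then show ?thesis
    by (simp add: bilinear_conv_bounded_bilinear)
qed

lemma bounded_bilinear_matrix_vector_mult:
  "bounded_bilinear ((*v) :: complex^'n^'m \<Rightarrow> complex^'n \<Rightarrow> complex^'m)"
proof -
  have "bilinear ((*v) :: complex^'n^'m \<Rightarrow> complex^'n \<Rightarrow> complex^'m)"
    unfolding bilinear_def
    by (auto intro!: linearI simp: vec_eq_iff matrix_vector_mult_def sum.distrib algebra_simps
        scaleR_sum_right)
  then show ?thesis
    by (simp add: bilinear_conv_bounded_bilinear)
qed

lemmas continuous_on_matrix_mult [continuous_intros] =
  bounded_bilinear.continuous_on [OF bounded_bilinear_matrix_matrix_mult]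

lemmas continuous_on_matrix_vector_mult [continuous_intros] =
  bounded_bilinear.continuous_on [OF bounded_bilinear_matrix_vector_mult]

lemma diag3_nth [simp]: "diag3 t $ i $ j = (if i = j then t $ i else 0)"
  by (simp add: diag3_def)

lemma SU3_simps [simp]:
  "g \<otimes>\<^bsub>SU3\<^esub> h = g ** h" "\<one>\<^bsub>SU3\<^esub> = mat 1"
  by (auto simp: SU3_def)

lemma SU3_iff: "g \<in> carrier SU3 \<longleftrightarrow> dagger g ** g = mat 1 \<and> det g = 1"
  by (simp add: SU3_def)

lemma SU3_dagger_mult: "g \<in> carrier SU3 \<Longrightarrow> dagger g ** g = mat 1"
  and SU3_det: "g \<in> carrier SU3 \<Longrightarrow> det g = 1"
  and SU3_mult_dagger: "g \<in> carrier SU3 \<Longrightarrow> g ** dagger g = mat 1"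
  by (auto simp: SU3_iff matrix_left_right_inverse)

lemma SU3_mult: "g \<in> carrier SU3 \<Longrightarrow> h \<in> carrier SU3 \<Longrightarrow> g ** h \<in> carrier SU3"
  using matrix_mul_assoc[of "dagger h" "dagger g" "g ** h"] matrix_mul_assoc[of "dagger g" g h]
  by (simp add: SU3_iff dagger_mult det_mul matrix_mul_assoc[symmetric])

lemma SU3_dagger: "g \<in> carrier SU3 \<Longrightarrow> dagger g \<in> carrier SU3"
  by (simp add: SU3_iff det_dagger matrix_left_right_inverse)

lemma SU3_one: "mat 1 \<in> carrier SU3"
  by (simp add: SU3_iff)

lemma group_SU3: "group SU3"
proof (rule groupI)
  fix g assume "g \<in> carrier SU3"
  then show "\<exists>h\<in>carrier SU3. h \<otimes>\<^bsub>SU3\<^esub> g = \<one>\<^bsub>SU3\<^esub>"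
    by (metis SU3_dagger SU3_dagger_mult SU3_simps)
qed (auto simp: SU3_mult SU3_one matrix_mul_assoc)

lemma SU3_inv: "g \<in> carrier SU3 \<Longrightarrow> inv\<^bsub>SU3\<^esub> g = dagger g"
  by (metis SU3_dagger SU3_dagger_mult SU3_simps group.inv_equality group_SU3)

section \<open>Compactness of SU(3) and fixed points of compact groups\<close>

lemma norm_unitary_le:
  fixes g :: "complex^'n^'n"
  assumes "dagger g ** g = mat 1"
  shows "norm (g $ i $ j) \<le> 1"
proof -
  have "(\<Sum>k\<in>UNIV. cnj (g $ k $ j) * g $ k $ j) = 1"
    using arg_cong[OF assms, of "\<lambda>A. A $ j $ j"] by (simp add: matrix_matrix_mult_def mat_def)
  then have "(\<Sum>k\<in>UNIV. complex_of_real ((norm (g $ k $ j))\<^sup>2)) = 1"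
    by (simp add: complex_norm_square mult.commute del: of_real_power)
  then have "(\<Sum>k\<in>UNIV. (norm (g $ k $ j))\<^sup>2) = 1"
    by (metis of_real_eq_1_iff of_real_sum)
  moreover have "(norm (g $ i $ j))\<^sup>2 \<le> (\<Sum>k\<in>UNIV. (norm (g $ k $ j))\<^sup>2)"
    by (rule member_le_sum) auto
  ultimately show ?thesis
    by (simp add: abs_square_le_1)
qed

lemma compact_SU3: "compact (carrier SU3)"
proof -
  have "norm g \<le> 9" if "g \<in> carrier SU3" for g
  proof -
    have "norm (g $ i) \<le> 3" for i
      using order.trans[OF L2_set_le_sum[of UNIV "\<lambda>j. norm (g $ i $ j)"]]
        sum_mono[of UNIV "\<lambda>j. norm (g $ i $ j)" "\<lambda>j. 1"] norm_unitary_le[OF SU3_dagger_mult[OF that]]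
      by (simp add: norm_vec_def)
    then show ?thesis
      using order.trans[OF L2_set_le_sum[of UNIV "\<lambda>j. norm (g $ j)"]]
        sum_mono[of UNIV "\<lambda>j. norm (g $ j)" "\<lambda>j. 3"]
      by (simp add: norm_vec_def)
  qed
  then have "bounded (carrier SU3)"
    by (auto simp: bounded_iff)
  moreover have "closed (carrier SU3)"
  proof -
    have "continuous_on UNIV (\<lambda>g :: complex^3^3. dagger g ** g)"
      unfolding dagger_def map_matrix_def transpose_def by (intro continuous_intros)
    moreover have "continuous_on UNIV (\<lambda>g :: complex^3^3. det g)"
      unfolding det_def by (intro continuous_intros)
    ultimately have "closed ({g. dagger g ** g = mat 1} \<inter> {g :: complex^3^3. det g = 1})"
      by (intro closed_Int closed_Collect_eq continuous_on_const) auto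
    then show ?thesis
      by (simp add: SU3_def Collect_conj_eq)
  qed
  ultimately show ?thesis
    by (simp add: compact_eq_bounded_closed)
qed

text \<open>A minimizer x over \<open>C\<close> of the largest norm on the orbit is fixed. If some h
  moved it, the midpoint of x and h x would lie in \<open>C\<close>, and by the parallelogram law
  all its translates would be shorter than the minimum allows; invertibility keeps a x and a h x
  apart.\<close>

lemma compact_group_fixed_point:
  fixes \<Gamma> :: "(complex^'n^'n) set" and C :: "(complex^'p^'n) set"
  assumes "compact \<Gamma>" "\<Gamma> \<noteq> {}" and mult: "\<And>a b. a \<in> \<Gamma> \<Longrightarrow> b \<in> \<Gamma> \<Longrightarrow> a ** b \<in> \<Gamma>"
    and inv: "\<And>a. a \<in> \<Gamma> \<Longrightarrow> invertible a"
    and C: "compact C" "convex C" "C \<noteq> {}" and stable: "\<And>a x. a \<in> \<Gamma> \<Longrightarrow> x \<in> C \<Longrightarrow> a ** x \<in> C"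
  obtains x where "x \<in> C" "\<And>a. a \<in> \<Gamma> \<Longrightarrow> a ** x = x"
proof -
  define N where "N x = (SUP a\<in>\<Gamma>. norm (a ** x))" for x :: "complex^'p^'n"
  obtain K where K: "\<And>(a :: complex^'n^'n) (b :: complex^'p^'n). norm (a ** b) \<le> norm a * norm b * K" "K > 0"
    using bounded_bilinear.pos_bounded[OF bounded_bilinear_matrix_matrix_mult] by blast
  have attain: "\<exists>a\<in>\<Gamma>. \<forall>b\<in>\<Gamma>. norm (b ** x) \<le> norm (a ** x)" for x :: "complex^'p^'n"
    by (rule continuous_attains_sup) (use assms in \<open>auto intro!: continuous_intros\<close>)
  have bdd: "bdd_above ((\<lambda>a. norm (a ** x)) ` \<Gamma>)" for x :: "complex^'p^'n"
    using attain[of x] by auto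
  have upper: "norm (a ** x) \<le> N x" if "a \<in> \<Gamma>" for a and x :: "complex^'p^'n"
    unfolding N_def using that bdd by (rule cSUP_upper)
  have N_attained: "\<exists>a\<in>\<Gamma>. N x = norm (a ** x)" for x
  proof -
    obtain a where a: "a \<in> \<Gamma>" "\<And>b. b \<in> \<Gamma> \<Longrightarrow> norm (b ** x) \<le> norm (a ** x)"
      using attain[of x] by blast
    have "N x \<le> norm (a ** x)"
      unfolding N_def using \<open>\<Gamma> \<noteq> {}\<close> a(2) by (rule cSUP_least)
    with upper[OF a(1), of x] a(1) show ?thesis
      by (meson antisym)
  qed
  obtain B where B: "\<And>a. a \<in> \<Gamma> \<Longrightarrow> norm a \<le> B"
    using compact_imp_bounded[OF \<open>compact \<Gamma>\<close>] unfolding bounded_iff by auto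
  have "B \<ge> 0"
    using \<open>\<Gamma> \<noteq> {}\<close> order_trans[OF norm_ge_zero B] by auto
  have lip: "N x - N y \<le> B * K * norm (x - y)" for x y
  proof -
    obtain a where a: "a \<in> \<Gamma>" "N x = norm (a ** x)"
      using N_attained by blast
    have "norm (a ** x) - norm (a ** y) \<le> norm (a ** (x - y))"
      using norm_triangle_ineq2[of "a ** x" "a ** y"]
      by (simp add: bounded_bilinear.diff_right[OF bounded_bilinear_matrix_matrix_mult])
    also have "\<dots> \<le> norm a * norm (x - y) * K"
      using K by blast
    also have "\<dots> \<le> B * norm (x - y) * K"
      using B[OF a(1)] K(2) by (intro mult_right_mono) auto
    finally show ?thesis
      using upper[OF a(1), of y] a(2) by (simp add: mult_ac)
  qed
  have "continuous_on C N"
  proof (rule continuous_onI)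
    fix x e assume "(0::real) < e"
    have pos: "B * K + 1 > 0"
      using \<open>B \<ge> 0\<close> \<open>K > 0\<close> by (simp add: add_nonneg_pos)
    show "\<exists>d>0. \<forall>x'\<in>C. dist x' x < d \<longrightarrow> dist (N x') (N x) \<le> e"
    proof (intro exI[of _ "e / (B * K + 1)"] conjI ballI impI)
      fix x' assume "dist x' x < e / (B * K + 1)"
      then have "(B * K + 1) * norm (x' - x) < e"
        using pos by (simp add: dist_norm field_simps)
      moreover have "B * K * norm (x' - x) \<le> (B * K + 1) * norm (x' - x)"
        by (intro mult_right_mono) auto
      ultimately show "dist (N x') (N x) \<le> e"
        using lip[of x x'] lip[of x' x] by (simp add: dist_real_def norm_minus_commute abs_le_iff)
    qed (use pos \<open>e > 0\<close> in auto)
  qed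
  then obtain x where x: "x \<in> C" "\<And>y. y \<in> C \<Longrightarrow> N x \<le> N y"
    using continuous_attains_inf[of C N] C by blast
  have "h ** x = x" if h: "h \<in> \<Gamma>" for h
  proof (rule ccontr)
    assume neq: "h ** x \<noteq> x"
    define y where "y = (1/2) *\<^sub>R x + (1/2) *\<^sub>R (h ** x)"
    have "y \<in> C"
      unfolding y_def using \<open>convex C\<close> x(1) stable[OF h x(1)]
      by (simp add: convex_def)
    obtain a where a: "a \<in> \<Gamma>" "N y = norm (a ** y)"
      using N_attained by blast
    let ?u = "a ** x" and ?v = "a ** (h ** x)"
    have "?u \<noteq> ?v"
      using neq inv[OF a(1)] unfolding invertible_def
      by (metis matrix_mul_assoc matrix_mul_lid)
    have le: "norm ?u \<le> N x" "norm ?v \<le> N x"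
      using upper[OF a(1)] upper[OF mult[OF a(1) h]] by (auto simp: matrix_mul_assoc)
    have "a ** y = (1/2) *\<^sub>R (?u + ?v)"
      by (simp add: y_def matrix_add_ldistrib matrix_mult_scaleR_right scaleR_add_right)
    then have "norm (?u + ?v) = 2 * N y"
      using a(2) by simp
    moreover have "N x \<le> N y"
      using x(2) \<open>y \<in> C\<close> by blast
    ultimately have "(norm (?u + ?v))\<^sup>2 \<ge> (2 * N x)\<^sup>2"
      using order_trans[OF norm_ge_zero le(1)] by (intro power_mono) auto
    moreover have "(norm (?u + ?v))\<^sup>2 + (norm (?u - ?v))\<^sup>2 = 2 * (norm ?u)\<^sup>2 + 2 * (norm ?v)\<^sup>2"
      unfolding power2_norm_eq_inner by (simp add: algebra_simps inner_commute)
    moreover have "(norm ?u)\<^sup>2 \<le> (N x)\<^sup>2" "(norm ?v)\<^sup>2 \<le> (N x)\<^sup>2"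
      using le by (auto intro: power_mono)
    ultimately have "(norm (?u - ?v))\<^sup>2 \<le> 0"
      unfolding power_mult_distrib power2_eq_square[of 2] by linarith
    then show False
      using \<open>?u \<noteq> ?v\<close> by simp
  qed
  with x(1) that show ?thesis
    by blast
qed

section \<open>Restriction of a representation to the maximal torus\<close>

lemma continuous_on_circle:
  fixes f :: "complex \<Rightarrow> 'a::topological_space"
  assumes "continuous_on (sphere 0 1) f"
  shows "continuous_on A (\<lambda>t. f (cis t))"
  by (rule continuous_on_compose2[OF assms]) (auto intro!: continuous_intros simp: cis_conv_exp)

lemma integrable_on_circle:
  fixes f :: "complex \<Rightarrow> 'a::euclidean_space"
  assumes "continuous_on (sphere 0 1) f"
  shows "(\<lambda>t. f (cis t)) integrable_on {a..b}"
  by (rule integrable_continuous_real) (rule continuous_on_circle[OF assms])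

text \<open>The Fourier coefficients of \<open>f\<close> vanish, hence so do those of \<open>h f\<close> for every polynomial \<open>h\<close>
  in \<open>Re z\<close> and \<open>Im z\<close>; choosing \<open>h\<close> close to \<open>cnj f\<close> gives \<open>f = 0\<close>.\<close>

lemma fourier_coefficients_zero:
  fixes f :: "complex \<Rightarrow> complex"
  assumes cont: "continuous_on (sphere 0 1) f"
    and zero: "\<And>k :: int. integral {0..2 * pi} (\<lambda>t. cis t powi k * f (cis t)) = 0"
    and z: "norm z = 1"
  shows "f z = 0"
proof -
  define \<F> where "\<F> = {f. continuous_on (sphere 0 1) f \<and>
    (\<forall>k :: int. integral {0..2 * pi} (\<lambda>t. cis t powi k * f (cis t)) = 0)}"
  have cont_powi: "continuous_on (sphere 0 1) (\<lambda>z :: complex. z powi k)" for k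
    by (intro continuous_intros) auto
  have int: "(\<lambda>t. cis t powi k * f (cis t)) integrable_on {0..2 * pi}" if "f \<in> \<F>" for f and k :: int
    using that by (intro integrable_on_circle[of "\<lambda>z. z powi k * f z"] continuous_on_mult cont_powi)
      (simp add: \<F>_def)
  have \<F>_add: "(\<lambda>z. f z + g z) \<in> \<F>" if "f \<in> \<F>" "g \<in> \<F>" for f g
    using that int[OF that(1)] int[OF that(2)]
    by (auto simp: \<F>_def distrib_left integral_add intro: continuous_on_add)
  have \<F>_scale: "(\<lambda>z. c * f z) \<in> \<F>" if "f \<in> \<F>" for f c
    using that integral_mult_right[of "{0..2 * pi}" c "\<lambda>t. cis t powi _ * f (cis t)"]
    by (auto simp: \<F>_def mult.left_commute intro!: continuous_on_mult_left)
  have \<F>_shift: "(\<lambda>z. z powi j * f z) \<in> \<F>" if "f \<in> \<F>" for f j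
    using that
    by (auto simp: \<F>_def mult.assoc[symmetric] power_int_add[symmetric]
        intro!: continuous_on_mult cont_powi)
  have \<F>_poly: "(\<lambda>z. of_real (h z) * f z) \<in> \<F>" if "real_polynomial_function h" "f \<in> \<F>" for h f
    using that
  proof (induction h arbitrary: f rule: real_polynomial_function.induct)
    case (linear h)
    \<comment> \<open>A real-linear map on C is a combination of z and \<open>cnj z\<close>, and on
      the circle \<open>cnj z\<close> is the inverse of z. Multiplication by it therefore only
      shifts Fourier coefficients.\<close>
    have eq: "of_real (h z) * f z = ((h 1 - \<i> * h \<i>) / 2) * (z powi 1 * f z) +
      ((h 1 + \<i> * h \<i>) / 2) * (z powi (- 1) * f z)" if "z \<in> sphere 0 1" for z
    proof -
      have "z = Re z *\<^sub>R 1 + Im z *\<^sub>R \<i>"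
        by (simp add: complex_eq_iff)
      then have "h z = h (Re z *\<^sub>R 1 + Im z *\<^sub>R \<i>)"
        by (rule arg_cong)
      also have "\<dots> = Re z * h 1 + Im z * h \<i>"
        using linear(1) by (simp add: linear_add linear_scale bounded_linear.linear)
      finally have "h z = Re z * h 1 + Im z * h \<i>" .
      moreover have "inverse z = cnj z"
        using that by (simp add: inverse_eq_divide divide_conv_cnj)
      ultimately show ?thesis
        by (simp add: complex_eq_iff power_int_minus algebra_simps add_divide_distrib diff_divide_distrib)
    qed
    have "(\<lambda>z. ((h 1 - \<i> * h \<i>) / 2) * (z powi 1 * f z) +
      ((h 1 + \<i> * h \<i>) / 2) * (z powi (- 1) * f z)) \<in> \<F>"
      by (intro \<F>_add \<F>_scale \<F>_shift linear)
    then show ?case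
      unfolding \<F>_def mem_Collect_eq by (subst continuous_on_cong[OF refl eq]) (auto simp: eq)
  next
    case (const c)
    then show ?case by (rule \<F>_scale)
  next
    case (add h1 h2)
    show ?case
      using \<F>_add[OF add.IH(1)[OF add.prems] add.IH(2)[OF add.prems]] by (simp add: distrib_right)
  next
    case (mult h1 h2)
    show ?case
      using mult.IH(1)[OF mult.IH(2)[OF mult.prems]] by (simp add: mult.assoc)
  qed
  have f: "f \<in> \<F>"
    using cont zero by (simp add: \<F>_def)
  have "bounded (f ` sphere 0 1)"
    by (intro compact_imp_bounded compact_continuous_image cont compact_sphere)
  then obtain B where B: "\<And>z. norm z = 1 \<Longrightarrow> norm (f z) \<le> B"
    unfolding bounded_iff by (metis image_eqI mem_sphere_0)
  have "B \<ge> 0"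
    using order_trans[OF norm_ge_zero B[of 1]] by simp
  let ?I = "integral {0..2 * pi} (\<lambda>t. cnj (f (cis t)) * f (cis t))"
  have cont_cnj: "continuous_on (sphere 0 1) (\<lambda>z. cnj (f z))"
    by (intro continuous_intros cont)
  have small: "norm ?I \<le> e * (B * (2 * pi))" if "e > 0" for e
  proof -
    obtain g where g: "polynomial_function g" "\<And>z. norm z = 1 \<Longrightarrow> norm (cnj (f z) - g z) < e"
      using Stone_Weierstrass_polynomial_function[OF compact_sphere cont_cnj \<open>e > 0\<close>] by auto
    have cg: "continuous_on (sphere 0 1) g"
      by (rule continuous_on_polymonial_function[OF g(1)])
    have "real_polynomial_function (Re \<circ> g)" "real_polynomial_function (Im \<circ> g)"
      using g(1) bounded_linear_Re bounded_linear_Im unfolding polynomial_function_def by blast+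
    then have "(\<lambda>z. of_real ((Re \<circ> g) z) * f z + \<i> * (of_real ((Im \<circ> g) z) * f z)) \<in> \<F>"
      by (intro \<F>_add \<F>_scale \<F>_poly f)
    also have "(\<lambda>z. of_real ((Re \<circ> g) z) * f z + \<i> * (of_real ((Im \<circ> g) z) * f z)) = (\<lambda>z. g z * f z)"
      by (auto simp: fun_eq_iff complex_eq_iff)
    finally have "integral {0..2 * pi} (\<lambda>t. cis t powi 0 * (g (cis t) * f (cis t))) = 0"
      unfolding \<F>_def by blast
    then have "?I = integral {0..2 * pi} (\<lambda>t. (cnj (f (cis t)) - g (cis t)) * f (cis t))"
      using integrable_on_circle[of "\<lambda>z. cnj (f z) * f z" 0 "2 * pi"]
        integrable_on_circle[of "\<lambda>z. g z * f z" 0 "2 * pi"] cont cont_cnj cg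
      by (simp add: left_diff_distrib integral_diff continuous_on_mult)
    also have "norm \<dots> \<le> (e * B) * (2 * pi - 0)"
    proof (rule integral_bound)
      show "continuous_on {0..2 * pi} (\<lambda>t. (cnj (f (cis t)) - g (cis t)) * f (cis t))"
        by (intro continuous_on_circle[of "\<lambda>z. (cnj (f z) - g z) * f z"] continuous_intros cont cg)
      fix t :: real
      show "norm ((cnj (f (cis t)) - g (cis t)) * f (cis t)) \<le> e * B"
        unfolding norm_mult using g(2)[of "cis t"] B[of "cis t"] \<open>e > 0\<close> by (intro mult_mono) auto
    qed auto
    finally show ?thesis by simp
  qed
  have "norm ?I \<le> 0"
  proof (rule field_le_epsilon)
    fix e :: real assume "e > 0"
    \<comment> \<open>The added 1 keeps the denominator positive if B = 0.\<close>
    then have "e / (B * (2 * pi) + 1) > 0"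
      using \<open>B \<ge> 0\<close> by (simp add: add_nonneg_pos)
    from small[OF this] have "norm ?I \<le> e * ((B * (2 * pi)) / (B * (2 * pi) + 1))"
      by simp
    also have "\<dots> \<le> e * 1"
      using \<open>e > 0\<close> \<open>B \<ge> 0\<close> by (intro mult_left_mono) (auto simp: divide_le_eq_1 add_nonneg_pos)
    finally show "norm ?I \<le> 0 + e" by simp
  qed
  then have "?I = 0" by simp
  have eq: "(\<lambda>t. cnj (f (cis t)) * f (cis t)) = (\<lambda>t. of_real ((norm (f (cis t)))\<^sup>2))"
    by (simp only: complex_norm_square mult.commute)
  have cn: "continuous_on {0..2 * pi} (\<lambda>t. (norm (f (cis t)))\<^sup>2)"
    by (intro continuous_on_circle[of "\<lambda>z. (norm (f z))\<^sup>2"] continuous_intros cont)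
  have "integral {0..2 * pi} (\<lambda>t. (norm (f (cis t)))\<^sup>2) = 0"
    using \<open>?I = 0\<close> integral_linear[OF integrable_continuous_real[OF cn] bounded_linear_of_real[where 'a = complex]]
    unfolding eq by (simp add: o_def)
  then have "\<forall>t\<in>{0..2 * pi}. (norm (f (cis t)))\<^sup>2 = 0"
    by (subst (asm) integral_eq_0_iff[OF cn]) auto
  moreover obtain t where "0 \<le> t" "t < 2 * pi" "z = cis t"
    using complex_unimodular_polar[OF z] by (metis cis_conv_exp cis.ctr)
  ultimately show ?thesis by simp
qed

section \<open>Weight projections of a circle action\<close>

lemma integral_periodic_shift:
  fixes h :: "real \<Rightarrow> 'a::euclidean_space"
  assumes cont: "continuous_on UNIV h" and per: "\<And>t. h (t + p) = h t" and "0 \<le> a" "0 \<le> p"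
  shows "integral {0..p} (\<lambda>t. h (t + a)) = integral {0..p} h"
proof -
  have int: "h integrable_on {x..y}" for x y
    by (rule integrable_continuous_real) (rule continuous_on_subset[OF cont subset_UNIV])
  have shift: "integral {x..y} (\<lambda>t. h (t + c)) = integral {x + c..y + c} h" for x y c
    using integral_shift_Icc_real[of x y h "c"] by (simp add: o_def add.commute)
  have "integral {0..a} h + integral {a..p + a} h = integral {0..p} h + integral {p..p + a} h"
    using assms(3,4) by (simp add: Henstock_Kurzweil_Integration.integral_combine int)
  moreover have "integral {p..p + a} h = integral {0..a} h"
    using shift[of 0 a p] by (simp add: per add.commute)
  moreover have "integral {0..p} (\<lambda>t. h (t + a)) = integral {a..p + a} h"
    using shift[of 0 p a] by simp
  ultimately show ?thesis by simp
qed

text \<open>For a representation \<open>R\<close> of the circle this is 2 pi times the projection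
  onto the weight space of weight k.\<close>

definition circle_proj :: "(complex \<Rightarrow> complex^'n^'n) \<Rightarrow> int \<Rightarrow> complex^'n \<Rightarrow> complex^'n" where
  "circle_proj R k v = integral {0..2 * pi} (\<lambda>t. cis t powi (- k) *s (R (cis t) *v v))"

lemma continuous_on_vector_smult [continuous_intros]:
  fixes f :: "'a::topological_space \<Rightarrow> complex" and g :: "'a \<Rightarrow> complex^'n"
  assumes "continuous_on S f" "continuous_on S g"
  shows "continuous_on S (\<lambda>x. f x *s g x)"
  unfolding vector_scalar_mult_def by (intro continuous_intros assms)

lemma continuous_on_circle_powi [continuous_intros]:
  "continuous_on (sphere 0 1) (\<lambda>z :: complex. z powi k)"
  by (intro continuous_intros) auto

lemma bounded_linear_matrix_vector_mult: "bounded_linear (\<lambda>v. (A :: complex^'n^'m) *v v)"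
  by (rule bounded_bilinear.bounded_linear_right[OF bounded_bilinear_matrix_vector_mult])

lemma bounded_linear_vector_smult: "bounded_linear (\<lambda>v. c *s (v :: complex^'n))"
  by (auto intro!: linear_conv_bounded_linear[THEN iffD1] linearI simp: vec_eq_iff algebra_simps)

lemma mat_vector_mult: "mat c *v v = c *s v" for v :: "'a::semiring_1^'n"
  by (simp add: vec_eq_iff matrix_vector_mult_def mat_def if_distrib[of "\<lambda>x. x * _"] cong: if_cong)

lemma matrix_mult_circle_proj:
  assumes "continuous_on (sphere 0 1) R"
  shows "A *v circle_proj R k v = integral {0..2 * pi} (\<lambda>t. cis t powi (- k) *s (A *v (R (cis t) *v v)))"
proof -
  have "(\<lambda>t. cis t powi (- k) *s (R (cis t) *v v)) integrable_on {0..2 * pi}"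
    by (intro integrable_on_circle[of "\<lambda>z. z powi (- k) *s (R z *v v)"] continuous_intros assms)
  from integral_linear[OF this bounded_linear_matrix_vector_mult[of A]] show ?thesis
    by (simp add: circle_proj_def o_def matrix_vector_mult_smult)
qed

lemma circle_proj_eigenvector:
  assumes cont: "continuous_on (sphere 0 1) R"
    and hom: "\<And>z w. norm z = 1 \<Longrightarrow> norm w = 1 \<Longrightarrow> R (z * w) = R z ** R w"
    and z: "norm z = 1"
  shows "R z *v circle_proj R k v = z powi k *s circle_proj R k v"
proof -
  obtain a where a: "0 \<le> a" "z = cis a"
    using complex_unimodular_polar[OF z] by (metis cis_conv_exp cis.ctr)
  define h where "h t = cis t powi (- k) *s (R (cis t) *v v)" for t
  have cont_h: "continuous_on A h" for A
    unfolding h_def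
    by (intro continuous_on_circle[of "\<lambda>z. z powi (- k) *s (R z *v v)"] continuous_intros cont)
  have per: "h (t + 2 * pi) = h t" for t
    by (simp add: h_def cis_mult[symmetric])
  have "R z *v circle_proj R k v = integral {0..2 * pi} (\<lambda>t. z powi k *s h (t + a))"
    unfolding matrix_mult_circle_proj[OF cont]
  proof (rule integral_cong)
    fix t
    have "R z *v (R (cis t) *v v) = R (cis (t + a)) *v v"
      using hom[of z "cis t"] by (simp add: matrix_vector_mul_assoc a cis_mult add.commute)
    moreover have "cis t powi (- k) = z powi k * cis (t + a) powi (- k)"
      by (simp add: a cis_mult[symmetric] power_int_mult_distrib power_int_minus)
    ultimately show "cis t powi (- k) *s (R z *v (R (cis t) *v v)) = z powi k *s h (t + a)"
      by (simp add: h_def)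
  qed
  also have "\<dots> = z powi k *s integral {0..2 * pi} (\<lambda>t. h (t + a))"
  proof -
    have "continuous_on {0..2 * pi} (\<lambda>t. h (t + a))"
      by (rule continuous_on_compose2[OF cont_h[of UNIV]]) (auto intro!: continuous_intros)
    from integral_linear[OF integrable_continuous_real[OF this] bounded_linear_vector_smult] show ?thesis
      by (simp add: o_def)
  qed
  also have "integral {0..2 * pi} (\<lambda>t. h (t + a)) = circle_proj R k v"
    unfolding circle_proj_def h_def[symmetric]
    by (rule integral_periodic_shift) (use cont_h per a in auto)
  finally show ?thesis .
qed

text \<open>Completeness of the weight projections, without convergence of Fourier series: the
  entries of \<open>M *v (R z *v v)\<close> have vanishing Fourier coefficients, hence vanish, and z
  = 1 recovers \<open>M *v v\<close>.\<close>

lemma vanishing_on_circle_proj: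
  fixes M :: "complex^'n^'m"
  assumes cont: "continuous_on (sphere 0 1) R" and "R 1 = mat 1"
    and zero: "\<And>k. M *v circle_proj R k v = 0"
  shows "M *v v = 0"
proof -
  have "(M *v (R 1 *v v)) $ i = 0" for i
  proof (rule fourier_coefficients_zero[where f = "\<lambda>z. (M *v (R z *v v)) $ i" and z = 1])
    show cont': "continuous_on (sphere 0 1) (\<lambda>z. (M *v (R z *v v)) $ i)"
      by (intro continuous_intros cont)
    fix k
    have "(\<lambda>t. cis t powi k *s (M *v (R (cis t) *v v))) integrable_on {0..2 * pi}"
      by (intro integrable_on_circle[of "\<lambda>z. z powi k *s (M *v (R z *v v))"] continuous_intros cont)
    from integral_linear[OF this bounded_linear_vec_nth[of i]]
    show "integral {0..2 * pi} (\<lambda>t. cis t powi k * (M *v (R (cis t) *v v)) $ i) = 0"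
      using zero[of "- k"] matrix_mult_circle_proj[OF cont, of M "- k" v] by (simp add: o_def)
  qed auto
  then show ?thesis
    by (simp add: vec_eq_iff \<open>R 1 = mat 1\<close>)
qed

text \<open>Turns spanning into a vanishing statement, the form in which Fourier analysis delivers
  it. A vector outside the span gives a nonzero linear map that fixes this vector and kills a basis
  of the span.\<close>

lemma span_UNIV_if_annihilator_zero:
  fixes S :: "('a::field^'n) set"
  assumes "\<And>M :: 'a^'n^'n. (\<And>s. s \<in> S \<Longrightarrow> M *v s = 0) \<Longrightarrow> M = 0"
  shows "vec.span S = UNIV"
proof (rule ccontr)
  assume "vec.span S \<noteq> UNIV"
  then obtain v where v: "v \<notin> vec.span S" by auto
  obtain B where B: "B \<subseteq> S" "vec.independent B" "S \<subseteq> vec.span B"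
    using vec.maximal_independent_subset by blast
  have "v \<notin> vec.span B"
    using v vec.span_mono[OF B(1)] by blast
  then have "vec.independent (insert v B)" "v \<notin> B"
    using B(2) vec.span_base by (auto simp: vec.independent_insert)
  from vec.linear_independent_extend[OF \<open>vec.independent (insert v B)\<close>, of "\<lambda>x. if x = v then v else 0"]
  obtain g :: "'a^'n \<Rightarrow> 'a^'n" where g: "Vector_Spaces.linear (*s) (*s) g"
    "\<And>x. x \<in> insert v B \<Longrightarrow> g x = (if x = v then v else 0)"
    by blast
  have "matrix g *v s = 0" if "s \<in> vec.span B" for s
    using that
  proof (induction rule: vec.span_induct_alt)
    case (step c x y)
    then show ?case
      using g(2)[of x] \<open>v \<notin> B\<close> by (auto simp: matrix_works[OF g(1)] algebra_simps matrix_vector_mult_smult)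
  qed simp
  then have "matrix g = 0"
    using B(3) by (intro assms) auto
  then show False
    using g(2)[of v] v matrix_works[OF g(1), of v] vec.span_zero by force
qed

text \<open>One basis is chosen from \<open>S\<close> before \<open>A\<close> is given, because all
  torus elements must be diagonalized by the same basis. With \<open>P\<close> the matrix of basis
  columns, \<open>A ** P\<close> is \<open>P\<close> times a diagonal matrix.\<close>

lemma trace_eq_sum_eigenvalues:
  fixes S :: "('a::field^'n) set"
  assumes "vec.span S = UNIV"
  obtains f :: "'n \<Rightarrow> 'a^'n" where "\<And>j. f j \<in> S" "\<And>j. f j \<noteq> 0"
    "\<And>A c. (\<And>j. A *v f j = c j *s f j) \<Longrightarrow> trace A = (\<Sum>j\<in>UNIV. c j)"
    "\<And>A :: 'a^'n^'n. (\<And>j. A *v f j = 0) \<Longrightarrow> A = 0"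
proof -
  obtain B where B: "B \<subseteq> S" "vec.independent B" "S \<subseteq> vec.span B"
    using vec.maximal_independent_subset by blast
  have span: "vec.span B = UNIV"
    using assms vec.span_minimal[OF B(3) vec.subspace_span] by auto
  have "card B = CARD('n)"
    using vec.dim_eq_card[OF refl B(2)] span vec_dim_card vec.dim_span by metis
  then obtain f where f: "bij_betw f (UNIV :: 'n set) B"
    using finite_same_card_bij[of "UNIV :: 'n set" B] vec.finiteI_independent[OF B(2)] by auto
  then have fB: "f j \<in> B" for j
    by (auto simp: bij_betw_def)
  define P where "P = (\<chi> i j. f j $ i)"
  have P_axis: "(\<chi> i. P $ i $ j) = f j" for j
    by (simp add: P_def vec_eq_iff)
  have "\<exists>Q. P ** Q = mat 1"
    unfolding matrix_right_invertible_span_columns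
  proof -
    have "columns P = B"
      using f by (auto simp: columns_def column_def P_axis bij_betw_def)
    then show "vec.span (columns P) = UNIV"
      by (simp add: span)
  qed
  then obtain Q where Q: "P ** Q = mat 1" by blast
  show thesis
  proof
    fix A :: "'a^'n^'n" and c assume A: "\<And>j. A *v f j = c j *s f j"
    have "(A ** P) $ i $ j = (P ** (\<chi> i j. if i = j then c j else 0)) $ i $ j" for i j
      using arg_cong[OF A[of j], of "\<lambda>v. v $ i"]
      by (simp add: P_def matrix_matrix_mult_def matrix_vector_mult_def mult.commute if_distrib[of "(*) _"] cong: if_cong)
    then have "A ** P = P ** (\<chi> i j. if i = j then c j else 0)"
      by (simp add: vec_eq_iff)
    then have "A ** P ** Q = P ** (\<chi> i j. if i = j then c j else 0) ** Q"
      by simp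
    then have "A = P ** (\<chi> i j. if i = j then c j else 0) ** Q"
      by (simp add: matrix_mul_assoc[symmetric] Q)
    then have "trace A = trace (Q ** (P ** (\<chi> i j. if i = j then c j else 0)))"
      using trace_mul_sym[of "P ** (\<chi> i j. if i = j then c j else 0)" Q] by simp
    then have "trace A = trace ((Q ** P) ** (\<chi> i j. if i = j then c j else 0))"
      by (simp only: matrix_mul_assoc)
    also have "Q ** P = mat 1"
      using Q matrix_left_right_inverse by blast
    finally show "trace A = (\<Sum>j\<in>UNIV. c j)"
      by (simp add: trace_def)
  next
    fix A :: "'a^'n^'n" assume A: "\<And>j. A *v f j = 0"
    then have "A ** P = 0"
      by (simp add: P_def vec_eq_iff matrix_matrix_mult_def matrix_vector_mult_def)
    then have "A ** P ** Q = 0" by simp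
    then show "A = 0"
      by (simp add: matrix_mul_assoc[symmetric] Q)
  next
    fix j show "f j \<in> S" "f j \<noteq> 0"
      using fB[of j] B vec.dependent_zero by (blast, metis)
  qed
qed

text \<open>The kernel and the fixed space of \<open>E\<close> span everything, so in an eigenbasis
  the trace counts the fixed basis vectors, and in characteristic 0 the count itself must be
  0.\<close>

lemma idempotent_trace_zero:
  fixes E :: "complex^'n^'n"
  assumes "E ** E = E" "trace E = 0"
  shows "E = 0"
proof -
  let ?S = "{v. E *v v = v} \<union> {v. E *v v = 0}"
  have "vec.span ?S = UNIV"
  proof (rule span_UNIV_if_annihilator_zero)
    fix M :: "complex^'n^'n" assume M: "\<And>s. s \<in> ?S \<Longrightarrow> M *v s = 0"
    have "M *v v = 0" for v
    proof -
      have "M *v (E *v v) = 0" "M *v (v - E *v v) = 0"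
        by (rule M; simp add: matrix_vector_mul_assoc assms matrix_vector_mult_diff_distrib)+
      then show ?thesis by (simp add: matrix_vector_mult_diff_distrib)
    qed
    then show "M = 0"
      by (metis matrix_eq matrix_vector_mult_0)
  qed
  then obtain f :: "'n \<Rightarrow> complex^'n" where f: "\<And>j. f j \<in> ?S"
      "\<And>A c. (\<And>j. A *v f j = c j *s f j) \<Longrightarrow> trace A = (\<Sum>j\<in>UNIV. c j)"
      "\<And>A :: complex^'n^'n. (\<And>j. A *v f j = 0) \<Longrightarrow> A = 0"
    by (rule trace_eq_sum_eigenvalues) blast
  define c where "c j = (if E *v f j = 0 then 0 else 1 :: nat)" for j
  have "trace E = (\<Sum>j\<in>UNIV. of_nat (c j))"
    by (rule f(2)) (use f(1) in \<open>auto simp: c_def\<close>)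
  then have "(\<Sum>j\<in>UNIV. c j) = 0"
    using assms(2) by (simp flip: of_nat_sum)
  then show ?thesis
    by (intro f(3)) (auto simp: c_def split: if_splits)
qed

section \<open>Weights of a representation of SU(3)\<close>

lemma SU3_rep_mult:
  assumes "SU3_rep \<rho>" "g \<in> carrier SU3" "h \<in> carrier SU3"
  shows "\<rho> (g ** h) = \<rho> g ** \<rho> h"
  using assms by (auto simp: SU3_rep_def hom_def GL_def SU3_def)

lemma SU3_rep_invertible: "SU3_rep \<rho> \<Longrightarrow> g \<in> carrier SU3 \<Longrightarrow> invertible (\<rho> g)"
  by (auto simp: SU3_rep_def hom_def GL_def)

lemma SU3_rep_one:
  assumes "SU3_rep \<rho>"
  shows "\<rho> (mat 1) = mat 1"
proof -
  obtain A where A: "A ** \<rho> (mat 1) = mat 1"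
    using SU3_rep_invertible[OF assms SU3_one] by (auto simp: invertible_def)
  have "\<rho> (mat 1) ** \<rho> (mat 1) = \<rho> (mat 1)"
    using SU3_rep_mult[OF assms SU3_one SU3_one] by simp
  then have "A ** \<rho> (mat 1) ** \<rho> (mat 1) = A ** \<rho> (mat 1)"
    by (simp add: matrix_mul_assoc[symmetric])
  then show ?thesis by (simp add: A)
qed

lemma diag3_mult: "diag3 s ** diag3 t = diag3 (s * t)"
  by (simp add: vec_eq_iff matrix_matrix_mult_def forall_3 sum_3)

lemma diag3_SU3_iff:
  "diag3 t \<in> carrier SU3 \<longleftrightarrow> (\<forall>i. norm (t $ i) = 1) \<and> t $ 1 * t $ 2 * t $ 3 = 1"
proof -
  have "cnj z * z = 1 \<longleftrightarrow> norm z = 1" for z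
    using complex_norm_square[of z]
    by (metis mult.commute norm_ge_zero of_real_eq_1_iff power2_eq_1_iff power_one abs_norm_cancel abs_1 power2_eq_iff_nonneg zero_le_one)
  then show ?thesis
    by (simp add: SU3_iff vec_eq_iff matrix_matrix_mult_def forall_3 sum_3 mat_def det_3)
qed

text \<open>Coordinates that split the torus into two commuting circles, so that one-variable
  Fourier analysis can be applied twice.\<close>

definition torus_elem :: "complex \<Rightarrow> complex \<Rightarrow> complex^3^3" where
  "torus_elem a b = diag3 (vector [a, b, inverse (a * b)])"

lemma torus_elem_SU3: "norm a = 1 \<Longrightarrow> norm b = 1 \<Longrightarrow> torus_elem a b \<in> carrier SU3"
  unfolding torus_elem_def diag3_SU3_iff
  by (auto simp: forall_3 norm_mult norm_divide field_simps)

lemma torus_elem_mult: "torus_elem a b ** torus_elem c d = torus_elem (a * c) (b * d)"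
  unfolding torus_elem_def diag3_mult
  by (rule arg_cong[where f = diag3]) (simp add: vec_eq_iff forall_3)

lemma torus_elem_1: "torus_elem 1 1 = mat 1"
  by (simp add: torus_elem_def vec_eq_iff mat_def forall_3)

lemma continuous_on_torus_elem:
  assumes "continuous_on A f" "continuous_on A g" "\<And>x. x \<in> A \<Longrightarrow> f x \<noteq> 0 \<and> g x \<noteq> 0"
  shows "continuous_on A (\<lambda>x. torus_elem (f x) (g x))"
proof -
  have "continuous_on A (\<lambda>x. if i = j then vector [f x, g x, inverse (f x * g x)] $ i else 0)" for i j :: 3
    by (cases "i = j"; use exhaust_3[of i] assms in \<open>elim disjE; simp; intro continuous_intros; auto\<close>)
  then show ?thesis
    unfolding torus_elem_def diag3_def by (intro continuous_on_vec_lambda)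
qed

text \<open>Unlike \<open>is_weight\<close>, this admits v = 0, so a projection of a vector
  qualifies even if it vanishes.\<close>

definition torus_eigenvector :: "(complex^3^3 \<Rightarrow> complex^'n^'n) \<Rightarrow> int \<times> int \<Rightarrow> complex^'n \<Rightarrow> bool" where
  "torus_eigenvector \<rho> w v \<longleftrightarrow>
     (\<forall>t. diag3 t \<in> carrier SU3 \<longrightarrow> \<rho> (diag3 t) *v v = weight_char w t *s v)"

text \<open>Projecting along both circles yields simultaneous eigenvectors, and a matrix that kills
  all of these is 0 by two applications of \<open>vanishing_on_circle_proj\<close>.\<close>

lemma torus_eigenvector_span:
  fixes \<rho> :: "complex^3^3 \<Rightarrow> complex^'n^'n"
  assumes rep: "SU3_rep \<rho>"
  shows "vec.span {v. \<exists>w. torus_eigenvector \<rho> w v} = UNIV"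
proof (rule span_UNIV_if_annihilator_zero)
  fix M :: "complex^'n^'n" assume M: "\<And>s. s \<in> {v. \<exists>w. torus_eigenvector \<rho> w v} \<Longrightarrow> M *v s = 0"
  define R1 R2 where "R1 z = \<rho> (torus_elem z 1)" and "R2 z = \<rho> (torus_elem 1 z)" for z
  have cont_rep: "continuous_on (carrier SU3) \<rho>"
    using rep by (simp add: SU3_rep_def)
  have cont: "continuous_on (sphere 0 1) R1" "continuous_on (sphere 0 1) R2"
    unfolding R1_def R2_def
    by (rule continuous_on_compose2[OF cont_rep];
        force intro!: continuous_on_torus_elem continuous_intros torus_elem_SU3)+
  have hom: "R1 (z * w) = R1 z ** R1 w" "R2 (z * w) = R2 z ** R2 w" "R1 z ** R2 w = R2 w ** R1 z"
    "R1 z ** R2 w = \<rho> (torus_elem z w)"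
    if "norm z = 1" "norm w = 1" for z w
    using that by (simp_all add: R1_def R2_def SU3_rep_mult[OF rep, symmetric] torus_elem_SU3 torus_elem_mult)
  have one: "R1 1 = mat 1" "R2 1 = mat 1"
    by (simp_all add: R1_def R2_def torus_elem_1 SU3_rep_one[OF rep])
  have "M *v v = 0" for v
  proof (rule vanishing_on_circle_proj[OF cont(1) one(1)])
    fix k
    show "M *v circle_proj R1 k v = 0"
    proof (rule vanishing_on_circle_proj[OF cont(2) one(2)])
      fix l
      let ?u = "circle_proj R2 l (circle_proj R1 k v)"
      have u2: "R2 z *v ?u = z powi l *s ?u" if "norm z = 1" for z
        by (rule circle_proj_eigenvector[OF cont(2) hom(2) that])
      \<comment> \<open>The two circles commute, so \<open>R1 z\<close> passes through the
        projection for \<open>R2\<close>. The resulting scalar is written as a matrix so that it can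
        be pulled out of the integral by the same rule.\<close>
      have u1: "R1 z *v ?u = z powi k *s ?u" if z: "norm z = 1" for z
      proof -
        have "R1 z *v ?u = circle_proj R2 l (R1 z *v circle_proj R1 k v)"
          unfolding matrix_mult_circle_proj[OF cont(2)] unfolding circle_proj_def[of R2]
          by (intro integral_cong) (simp add: matrix_vector_mul_assoc hom(3)[OF z])
        also have "R1 z *v circle_proj R1 k v = z powi k *s circle_proj R1 k v"
          by (rule circle_proj_eigenvector[OF cont(1) hom(1) z])
        also have "circle_proj R2 l (z powi k *s circle_proj R1 k v) = mat (z powi k) *v ?u"
          unfolding matrix_mult_circle_proj[OF cont(2)] unfolding circle_proj_def[of R2]
          by (intro integral_cong) (simp add: matrix_vector_mult_smult mat_vector_mult)
        finally show ?thesis by (simp add: mat_vector_mult)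
      qed
      \<comment> \<open>The weight (a, b) takes the value t1^(a+b) t2^b, so exponents k and l on the
        two circles mean b = l and a = k - l.\<close>
      have "torus_eigenvector \<rho> (k - l, l) ?u"
        unfolding torus_eigenvector_def
      proof (intro allI impI)
        fix t assume "diag3 t \<in> carrier SU3"
        then have n: "norm (t $ 1) = 1" "norm (t $ 2) = 1" and prod: "t $ 1 * t $ 2 * t $ 3 = 1"
          by (auto simp: diag3_SU3_iff)
        then have nz: "t $ 1 \<noteq> 0" "t $ 2 \<noteq> 0" by auto
        have "t $ 3 = inverse (t $ 1 * t $ 2)"
          using prod by (metis inverse_unique)
        then have "diag3 t = torus_elem (t $ 1) (t $ 2)"
          unfolding torus_elem_def by (intro arg_cong[where f = diag3]) (simp add: vec_eq_iff forall_3)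
        then have "\<rho> (diag3 t) *v ?u = R1 (t $ 1) *v (R2 (t $ 2) *v ?u)"
          by (simp add: hom(4)[OF n, symmetric] matrix_vector_mul_assoc)
        also have "\<dots> = (t $ 2 powi l * t $ 1 powi k) *s ?u"
          by (simp add: u1 u2 n matrix_vector_mult_smult vector_smult_assoc)
        also have "t $ 2 powi l * t $ 1 powi k = weight_char (k - l, l) t"
          using nz by (simp add: weight_char_def power_int_mult_distrib power_int_diff)
        finally show "\<rho> (diag3 t) *v ?u = weight_char (k - l, l) t *s ?u" .
      qed
      then show "M *v ?u = 0"
        by (intro M) blast
    qed
  qed
  then show "M = 0"
    by (metis matrix_eq matrix_vector_mult_0)
qed

text \<open>Weights are listed with multiplicity, one for each vector of a common eigenbasis of the
  torus.\<close>

lemma SU3_rep_trace_torus: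
  fixes \<rho> :: "complex^3^3 \<Rightarrow> complex^'n^'n"
  assumes rep: "SU3_rep \<rho>"
  obtains w :: "'n \<Rightarrow> int \<times> int" where "\<And>j. is_weight \<rho> (w j)"
    "\<And>t. diag3 t \<in> carrier SU3 \<Longrightarrow> trace (\<rho> (diag3 t)) = (\<Sum>j\<in>UNIV. weight_char (w j) t)"
proof -
  obtain f :: "'n \<Rightarrow> complex^'n" where f: "\<And>j. f j \<in> {v. \<exists>w. torus_eigenvector \<rho> w v}" "\<And>j. f j \<noteq> 0"
    "\<And>A c. (\<And>j. A *v f j = c j *s f j) \<Longrightarrow> trace A = (\<Sum>j\<in>UNIV. c j)"
    by (rule trace_eq_sum_eigenvalues[OF torus_eigenvector_span[OF rep]]) blast
  from f(1) have "\<forall>j. \<exists>w. torus_eigenvector \<rho> w (f j)"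
    by simp
  then obtain w where w: "\<And>j. torus_eigenvector \<rho> (w j) (f j)"
    unfolding choice_iff by blast
  show thesis
  proof
    show "is_weight \<rho> (w j)" for j
      unfolding is_weight_def using f(2)[of j] w[of j, unfolded torus_eigenvector_def]
      by (intro exI[of _ "f j"] conjI)
    show "trace (\<rho> (diag3 t)) = (\<Sum>j\<in>UNIV. weight_char (w j) t)" if "diag3 t \<in> carrier SU3" for t
      using w[unfolded torus_eigenvector_def] that by (intro f(3)) blast
  qed
qed

section \<open>Operators commuting with tensor squares\<close>

definition kron2 :: "complex^'n^'n \<Rightarrow> complex^('n \<times> 'n)^('n \<times> 'n)" where
  "kron2 g = (\<chi> p q. g $ fst p $ fst q * g $ snd p $ snd q)"

lemma kron2_nth [simp]: "kron2 g $ (a, b) $ (c, d) = g $ a $ c * g $ b $ d"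
  by (simp add: kron2_def)

lemma sum_UNIV_prod:
  "(\<Sum>p\<in>UNIV. f p) = (\<Sum>a\<in>UNIV. \<Sum>b\<in>UNIV. f (a, b))" for f :: "'a::finite \<times> 'b::finite \<Rightarrow> 'c::comm_monoid_add"
  unfolding sum.cartesian_product UNIV_Times_UNIV by simp

lemma kron2_mult: "kron2 (g ** h) = kron2 g ** kron2 h"
  by (simp add: vec_eq_iff matrix_matrix_mult_def sum_UNIV_prod sum_product mult_ac)

lemma kron2_mat_1: "kron2 (mat 1) = mat 1"
  by (simp add: vec_eq_iff mat_def)

lemma kron2_dagger: "kron2 (dagger g) = dagger (kron2 g)"
  by (simp add: vec_eq_iff)

text \<open>The operator \<alpha> 1 + \<beta> SWAP on the tensor square.\<close>

definition swap_form :: "complex \<Rightarrow> complex \<Rightarrow> complex^('n::finite \<times> 'n)^('n \<times> 'n)" where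
  "swap_form \<alpha> \<beta> = (\<chi> p q. (if p = q then \<alpha> else 0) + (if p = prod.swap q then \<beta> else 0))"

lemma swap_form_nth [simp]:
  "swap_form \<alpha> \<beta> $ (a, b) $ (c, d) = (if a = c \<and> b = d then \<alpha> else 0) + (if a = d \<and> b = c then \<beta> else 0)"
  by (simp add: swap_form_def)

lemma swap_form_commute: "kron2 g ** swap_form \<alpha> \<beta> = swap_form \<alpha> \<beta> ** kron2 g"
proof -
  have "kron2 g $ (a, b) $ (d, c) = kron2 g $ (b, a) $ (c, d)" for a b c d
    by simp
  moreover have "(kron2 g ** swap_form \<alpha> \<beta>) $ (a, b) $ (c, d) = kron2 g $ (a, b) $ (c, d) * \<alpha> + kron2 g $ (a, b) $ (d, c) * \<beta>" for a b c d
    unfolding matrix_matrix_mult_def swap_form_def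
    by (simp add: distrib_left sum.distrib if_distrib[of "(*) _"] cong: if_cong)
  moreover have "(swap_form \<alpha> \<beta> ** kron2 g) $ (a, b) $ (c, d) = \<alpha> * kron2 g $ (a, b) $ (c, d) + \<beta> * kron2 g $ (b, a) $ (c, d)" for a b c d
  proof -
    have "(a, b) = prod.swap r \<longleftrightarrow> r = (b, a)" for r by (cases r) auto
    then show ?thesis
    unfolding matrix_matrix_mult_def swap_form_def
    by (simp add: distrib_right sum.distrib if_distrib[of "\<lambda>x. x * _"] cong: if_cong)
  qed
  ultimately show ?thesis
    by (simp add: vec_eq_iff mult.commute)
qed

text \<open>For a finite group of unitary matrices this is the property of being a unitary
  2-design.\<close>

definition swap_commutant :: "(complex^'n^'n) set \<Rightarrow> bool" where
  "swap_commutant H \<longleftrightarrow>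
     (\<forall>A. (\<forall>h\<in>H. kron2 h ** A = A ** kron2 h) \<longrightarrow> (\<exists>\<alpha> \<beta>. A = swap_form \<alpha> \<beta>))"

text \<open>The matrix written out is the adjugate of g. Since det g = 1 it is the inverse, which
  for a unitary matrix is \<open>dagger g\<close>.\<close>

lemma SU3_minor_eq_cnj:
  assumes "g \<in> carrier SU3"
  shows "(\<chi> i j. if i = 1 \<and> j = 1 then g $ 2 $ 2 * g $ 3 $ 3 - g $ 2 $ 3 * g $ 3 $ 2
    else if i = 1 \<and> j = 2 then g $ 1 $ 3 * g $ 3 $ 2 - g $ 1 $ 2 * g $ 3 $ 3
    else if i = 1 \<and> j = 3 then g $ 1 $ 2 * g $ 2 $ 3 - g $ 1 $ 3 * g $ 2 $ 2
    else if i = 2 \<and> j = 1 then g $ 2 $ 3 * g $ 3 $ 1 - g $ 2 $ 1 * g $ 3 $ 3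
    else if i = 2 \<and> j = 2 then g $ 1 $ 1 * g $ 3 $ 3 - g $ 1 $ 3 * g $ 3 $ 1
    else if i = 2 \<and> j = 3 then g $ 1 $ 3 * g $ 2 $ 1 - g $ 1 $ 1 * g $ 2 $ 3
    else if i = 3 \<and> j = 1 then g $ 2 $ 1 * g $ 3 $ 2 - g $ 2 $ 2 * g $ 3 $ 1
    else if i = 3 \<and> j = 2 then g $ 1 $ 2 * g $ 3 $ 1 - g $ 1 $ 1 * g $ 3 $ 2
    else g $ 1 $ 1 * g $ 2 $ 2 - g $ 1 $ 2 * g $ 2 $ 1) = dagger g" (is "?C = _")
proof -
  have "g ** ?C = mat (det g)"
    by (simp add: vec_eq_iff forall_3 matrix_matrix_mult_def sum_3 mat_def det_3 algebra_simps)
  then have "dagger g ** (g ** ?C) = dagger g ** mat 1"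
    by (simp add: SU3_det[OF assms])
  then show ?thesis
    by (simp add: matrix_mul_assoc SU3_dagger_mult[OF assms])
qed

text \<open>Up to sign, each 2 by 2 minor is the conjugate of an entry.\<close>

lemma SU3_minor_nonzero:
  assumes g: "g \<in> carrier SU3" and nz: "\<And>i j. g $ i $ j \<noteq> 0" and "a \<noteq> b" "i \<noteq> j"
  shows "g $ a $ i * g $ b $ j \<noteq> g $ a $ j * g $ b $ i"
proof -
  have "\<forall>i j. dagger g $ i $ j \<noteq> 0"
    using nz by simp
  then have "g $ 2 $ 2 * g $ 3 $ 3 \<noteq> g $ 2 $ 3 * g $ 3 $ 2" "g $ 1 $ 3 * g $ 3 $ 2 \<noteq> g $ 1 $ 2 * g $ 3 $ 3"
    "g $ 1 $ 2 * g $ 2 $ 3 \<noteq> g $ 1 $ 3 * g $ 2 $ 2" "g $ 2 $ 3 * g $ 3 $ 1 \<noteq> g $ 2 $ 1 * g $ 3 $ 3"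
    "g $ 1 $ 1 * g $ 3 $ 3 \<noteq> g $ 1 $ 3 * g $ 3 $ 1" "g $ 1 $ 3 * g $ 2 $ 1 \<noteq> g $ 1 $ 1 * g $ 2 $ 3"
    "g $ 2 $ 1 * g $ 3 $ 2 \<noteq> g $ 2 $ 2 * g $ 3 $ 1" "g $ 1 $ 2 * g $ 3 $ 1 \<noteq> g $ 1 $ 1 * g $ 3 $ 2"
    "g $ 1 $ 1 * g $ 2 $ 2 \<noteq> g $ 1 $ 2 * g $ 2 $ 1"
    unfolding SU3_minor_eq_cnj[OF g, symmetric] forall_3 by simp_all
  note minors = this this[symmetric]
  have "\<forall>a b i j. a \<noteq> b \<longrightarrow> i \<noteq> j \<longrightarrow> g $ a $ i * g $ b $ j \<noteq> g $ a $ j * g $ b $ i"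
    unfolding forall_3 using minors by (simp add: mult.commute)
  with assms(3,4) show ?thesis by blast
qed

lemma kron2_diag3_commute:
  assumes "kron2 (diag3 y) ** A = A ** kron2 (diag3 y)"
  shows "y $ a * y $ b * A $ (a, b) $ (c, d) = y $ c * y $ d * A $ (a, b) $ (c, d)"
proof -
  have diag: "kron2 (diag3 y) $ p $ q = (if p = q then y $ fst p * y $ snd p else 0)" for p q
    by (cases p; cases q) (auto simp: diag3_def)
  show ?thesis
    using arg_cong[OF assms, of "\<lambda>M. M $ (a, b) $ (c, d)"]
    by (simp add: matrix_matrix_mult_def diag if_distrib[of "\<lambda>x. x * _"] if_distrib[of "(*) _"]
        mult.commute cong: if_cong)
qed

text \<open>\<open>M\<close> is a permutation matrix times a scalar e, and the tensor square sees
  only e * e; a sign therefore drops out.\<close>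

lemma kron2_monomial_commute:
  assumes M: "\<And>i j. M $ i $ j = (if i = s j then e else 0)" and "inj s" "e * e = 1"
    and comm: "kron2 M ** A = A ** kron2 M"
  shows "A $ (s a, s b) $ (s c, s d) = A $ (a, b) $ (c, d)"
proof -
  have "(kron2 M ** A) $ (s a, s b) $ (c, d) = A $ (a, b) $ (c, d)"
  proof -
    have "(kron2 M ** A) $ (s a, s b) $ (c, d) =
        (\<Sum>x\<in>UNIV. \<Sum>y\<in>UNIV. if y = b then if x = a then A $ (x, y) $ (c, d) else 0 else 0)"
      unfolding matrix_matrix_mult_def vec_lambda_beta sum_UNIV_prod
      using \<open>inj s\<close> by (intro sum.cong refl) (auto simp: M inj_eq \<open>e * e = 1\<close>)
    then show ?thesis by simp
  qed
  moreover have "(A ** kron2 M) $ (s a, s b) $ (c, d) = A $ (s a, s b) $ (s c, s d)"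
  proof -
    have "(A ** kron2 M) $ (s a, s b) $ (c, d) =
        (\<Sum>x\<in>UNIV. \<Sum>y\<in>UNIV. if y = s d then if x = s c then A $ (s a, s b) $ (x, y) else 0 else 0)"
      unfolding matrix_matrix_mult_def vec_lambda_beta sum_UNIV_prod
      by (intro sum.cong refl) (auto simp: M \<open>e * e = 1\<close>)
    then show ?thesis by simp
  qed
  ultimately show ?thesis
    using comm by simp
qed

text \<open>By the condition on y, commuting with the diagonal matrix leaves in \<open>A\<close>
  only the entries joining a pair of indices to itself or to its reversal. The relation with
  \<open>Z\<close> is then compared entry by entry, and dividing by entries and minors of
  \<open>Z\<close> leaves two free constants.\<close>

lemma swap_commutant_diag:
  fixes y :: "complex^3"
  assumes Y: "\<And>a b c d. y $ a * y $ b = y $ c * y $ d \<Longrightarrow> (a = c \<and> b = d) \<or> (a = d \<and> b = c)"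
    and Z: "\<And>i j. Z $ i $ j \<noteq> 0"
    and minor: "\<And>a b i j. a \<noteq> b \<Longrightarrow> i \<noteq> j \<Longrightarrow> Z $ a $ i * Z $ b $ j \<noteq> Z $ a $ j * Z $ b $ i"
  shows "swap_commutant {diag3 y, Z}"
  unfolding swap_commutant_def
proof (intro allI impI)
  fix A :: "complex^(3 \<times> 3)^(3 \<times> 3)"
  assume comm: "\<forall>h\<in>{diag3 y, Z}. kron2 h ** A = A ** kron2 h"
  have supp: "A $ (a, b) $ (c, d) = 0" if "\<not> ((a = c \<and> b = d) \<or> (a = d \<and> b = c))" for a b c d
  proof -
    have "kron2 (diag3 y) ** A = A ** kron2 (diag3 y)"
      using comm by simp
    from kron2_diag3_commute[OF this, of a b c d] show ?thesis
      using Y[of a b c d] that by auto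
  qed
  have off: "A $ (a, b) $ q = 0" "A $ q $ (a, b) = 0" if "q \<noteq> (a, b)" "q \<noteq> (b, a)" for a b q
    using that by (cases q; auto intro!: supp)+
  have ZA: "kron2 Z ** A = A ** kron2 Z"
    using comm by simp
  have left: "(\<Sum>r\<in>UNIV. kron2 Z $ p $ r * A $ r $ (c, d)) = (\<Sum>r\<in>{(c, d), (d, c)}. kron2 Z $ p $ r * A $ r $ (c, d))" for p c d
    by (rule sum.mono_neutral_right) (auto simp: off)
  have right: "(\<Sum>r\<in>UNIV. A $ (a, b) $ r * kron2 Z $ r $ q) = (\<Sum>r\<in>{(a, b), (b, a)}. A $ (a, b) $ r * kron2 Z $ r $ q)" for a b q
    by (rule sum.mono_neutral_right) (auto simp: off)
  have eq: "(\<Sum>r\<in>{(c, d), (d, c)}. kron2 Z $ (a, b) $ r * A $ r $ (c, d)) =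
      (\<Sum>r\<in>{(a, b), (b, a)}. A $ (a, b) $ r * kron2 Z $ r $ (c, d))" for a b c d
    using ZA[unfolded vec_eq_iff matrix_matrix_mult_def, rule_format, of "(a, b)" "(c, d)"]
    by (simp only: vec_lambda_beta left right)
  define D where "D i j = A $ (i, j) $ (i, j)" for i j
  define s where "s = D 1 1"
  have s: "A $ (i, i) $ (i, i) = s" for i
    using eq[of i i 1 1] Z[of i 1] by (simp add: D_def s_def)
  \<comment> \<open>Row (1, 1) of the relation with \<open>Z\<close> ties the reversal entry to the
    diagonal one; \<open>X2\<close> uses column (1, 1) in the same way.\<close>
  have X1: "A $ (j, i) $ (i, j) = s - D i j" if "i \<noteq> j" for i j
  proof -
    have "Z $ 1 $ i * Z $ 1 $ j * (D i j + A $ (j, i) $ (i, j)) = Z $ 1 $ i * Z $ 1 $ j * s"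
      using eq[of 1 1 i j] that by (simp add: D_def s algebra_simps)
    then have "D i j + A $ (j, i) $ (i, j) = s"
      using Z[of 1 i] Z[of 1 j] by simp
    then show ?thesis by (simp add: eq_diff_eq add.commute)
  qed
  have X2: "A $ (i, j) $ (j, i) = s - D i j" if "i \<noteq> j" for i j
  proof -
    have "Z $ i $ 1 * Z $ j $ 1 * (D i j + A $ (i, j) $ (j, i)) = Z $ i $ 1 * Z $ j $ 1 * s"
      using eq[of i j 1 1] that by (simp add: D_def s algebra_simps)
    then have "D i j + A $ (i, j) $ (j, i) = s"
      using Z[of i 1] Z[of j 1] by simp
    then show ?thesis by (simp add: eq_diff_eq add.commute)
  qed
  define u where "u = D 1 2"
  \<comment> \<open>In row (1, 2), column (i, j), eliminating the reversal entries makes s cancel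
    and leaves a 2 by 2 minor of \<open>Z\<close> as a factor.\<close>
  have D: "D i j = u" if "i \<noteq> j" for i j
  proof -
    have "(D i j - D 1 2) * (Z $ 1 $ i * Z $ 2 $ j - Z $ 1 $ j * Z $ 2 $ i) = 0"
      using eq[of 1 2 i j] that X1[OF that] X2[of 1 2] by (simp add: D_def[symmetric] algebra_simps)
    then show ?thesis
      using minor[of 1 2 i j] that by (simp add: u_def)
  qed
  have "A = swap_form u (s - u)"
  proof -
    have "A $ (a, b) $ (c, d) = swap_form u (s - u) $ (a, b) $ (c, d)" for a b c d
    proof (cases "(a = c \<and> b = d) \<or> (a = d \<and> b = c)")
      case True
      then consider "a = b" "c = a" "d = a" | "a \<noteq> b" "c = a" "d = b" | "a \<noteq> b" "c = b" "d = a"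
        by metis
      then show ?thesis
      proof cases
        case 1
        then show ?thesis using s[of a] by simp
      next
        case 2
        then show ?thesis using D[of a b] by (simp add: D_def)
      next
        case 3
        then show ?thesis using D[of a b] X2[of a b] by simp
      qed
    next
      case False
      then have "swap_form u (s - u) $ (a, b) $ (c, d) = 0"
        unfolding swap_form_nth by (simp only: de_Morgan_disj if_False add_0)
      then show ?thesis using supp[OF False] by (simp only:)
    qed
    then show ?thesis by (simp add: vec_eq_iff)
  qed
  then show "\<exists>\<alpha> \<beta>. A = swap_form \<alpha> \<beta>" by blast
qed

lemma commute_kron2_mult:
  assumes "kron2 g ** A = A ** kron2 g" "kron2 h ** A = A ** kron2 h"
  shows "kron2 (g ** h) ** A = A ** kron2 (g ** h)"
  by (metis assms kron2_mult matrix_mul_assoc)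

text \<open>The commutant of the Heisenberg group generated by the clock and shift matrices is a
  full matrix algebra over the three pairs with indices adding up to \<open>2\<close> modulo \<open>3\<close>; the hypotheses on
  \<open>V\<close> and \<open>X\<close> cut it down to the span of the identity and the swap.\<close>

lemma swap_commutant_heisenberg:
  fixes w c :: complex
  assumes w: "w ^ 2 + w + 1 = 0" and "c \<noteq> 0"
    and V: "V = map_matrix ((*) c) (mat3 [[1, 1, 1], [1, w, w ^ 2], [1, w ^ 2, w]])"
    and X: "X = map_matrix ((*) c) (mat3 [[1, 1, w ^ 2], [1, w, w], [w, 1, w]])"
    and P: "V ** V = mat3 [[-1, 0, 0], [0, 0, -1], [0, -1, 0]]"
    and clock: "V ** V ** (X ** X) = mat3 [[1, 0, 0], [0, w, 0], [0, 0, w ^ 2]]"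
    and shift: "V ** (X ** X) ** V = mat3 [[0, 0, 1], [1, 0, 0], [0, 1, 0]]"
  shows "swap_commutant {V, X}"
  unfolding swap_commutant_def
proof (intro allI impI)
  fix A :: "complex^(3 \<times> 3)^(3 \<times> 3)"
  assume "\<forall>h\<in>{V, X}. kron2 h ** A = A ** kron2 h"
  then have VA: "kron2 V ** A = A ** kron2 V" and XA: "kron2 X ** A = A ** kron2 X"
    by auto
  note mult = commute_kron2_mult
  define y where "y = (vector [1, w, w ^ 2] :: complex^3)"
  note entry = arg_cong[where f = "\<lambda>M. M $ p $ q" for p q]
  note expand = mat3_def matrix_matrix_mult_def sum_UNIV_prod sum_3
  have w3: "w \<noteq> 1" "w ^ 2 \<noteq> 1" "w ^ 2 \<noteq> w"
  proof -
    show "w \<noteq> 1" using w by auto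
    moreover have "w ^ 3 = 1" using w by algebra
    ultimately show "w ^ 2 \<noteq> 1" "w ^ 2 \<noteq> w"
      using w by (auto simp: power3_eq_cube power2_eq_square)
  qed
  have "diag3 y = V ** V ** (X ** X)"
    unfolding clock by (simp add: y_def vec_eq_iff forall_3 mat3_def)
  then have clock_comm: "kron2 (diag3 y) ** A = A ** kron2 (diag3 y)"
    by (simp only:) (intro mult VA XA)
  have y: "y $ 1 = 1" "y $ 2 = w" "y $ 3 = w ^ 2" by (simp_all add: y_def)
  \<comment> \<open>The eigenvalues are w^(i-1) with w of order 3, so \<open>A\<close> connects only
    index pairs with equal sum modulo 3.\<close>
  have supp: "A $ (a, b) $ (c, d) = 0" if "y $ a * y $ b \<noteq> y $ c * y $ d" for a b c d
    using kron2_diag3_commute[OF clock_comm, of a b c d] that by simp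
  have shift_comm: "kron2 (mat3 [[0, 0, 1], [1, 0, 0], [0, 1, 0]]) ** A = A ** kron2 (mat3 [[0, 0, 1], [1, 0, 0], [0, 1, 0]])"
    unfolding shift[symmetric] by (intro mult VA XA)
  have P_comm: "kron2 (mat3 [[-1, 0, 0], [0, 0, -1], [0, -1, 0]]) ** A = A ** kron2 (mat3 [[-1, 0, 0], [0, 0, -1], [0, -1, 0]])"
    unfolding P[symmetric] by (intro mult VA)
  define s where "s i = (if i = 1 then 2 else if i = 2 then 3 else 1 :: 3)" for i :: 3
  have s3: "s (s (s i)) = i" for i
    using exhaust_3[of i] by (auto simp: s_def)
  then have "inj s"
    by (metis injI)
  have "\<forall>i j. mat3 [[0, 0, 1], [1, 0, 0], [0, 1, 0]] $ i $ j = (if i = s j then 1 else 0 :: complex)"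
    unfolding forall_3 by (simp add: mat3_def s_def)
  then have shift_inv: "A $ (s a, s b) $ (s c, s d) = A $ (a, b) $ (c, d)" for a b c d
    by (intro kron2_monomial_commute[OF _ \<open>inj s\<close> _ shift_comm, of "1"]) auto
  \<comment> \<open>Negation of i - 1 modulo 3. The sign of \<open>V ** V\<close> cancels in the
    tensor square.\<close>
  define r where "r i = (if i = 1 then 1 else if i = 2 then 3 else 2 :: 3)" for i :: 3
  have "inj r"
    using exhaust_3 by (intro injI) (auto simp: r_def split: if_splits)
  have "\<forall>i j. mat3 [[-1, 0, 0], [0, 0, -1], [0, -1, 0]] $ i $ j = (if i = r j then -1 else 0 :: complex)"
    unfolding forall_3 by (simp add: mat3_def r_def)
  then have P_inv: "A $ (r a, r b) $ (r c, r d) = A $ (a, b) $ (c, d)" for a b c d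
    by (intro kron2_monomial_commute[OF _ \<open>inj r\<close> _ P_comm, of "-1"]) auto
  have w_powers: "w * w = w ^ 2" "w * w ^ 2 = 1" "w ^ 2 * w = 1" "w ^ 2 * w ^ 2 = w" "w ^ 4 = w"
  proof -
    show "w ^ 4 = w" using w by algebra
    show "w * w ^ 2 = 1" using w by algebra
    then show "w ^ 2 * w = 1" by (simp add: mult.commute)
    show "w ^ 2 * w ^ 2 = w" using w by algebra
  qed (simp add: power2_eq_square)
  have supp_row: "A $ (a, b) $ (c, d) = 0" "A $ (c, d) $ (a, b) = 0"
    if "(a, b) \<in> {(1, 1), (2, 3), (3, 2)}" "(c, d) \<notin> {(1, 1), (2, 3), (3, 2)}" for a b c d
    using that exhaust_3[of c] exhaust_3[of d] w3
    by (auto intro!: supp simp: y w_powers)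
  have "A $ (1, 1) $ (3, 2) = A $ (1, 1) $ (2, 3)" "A $ (3, 2) $ (1, 1) = A $ (2, 3) $ (1, 1)"
    "A $ (3, 2) $ (3, 2) = A $ (2, 3) $ (2, 3)" "A $ (3, 2) $ (2, 3) = A $ (2, 3) $ (3, 2)"
    using P_inv[of 1 1 2 3] P_inv[of 2 3 1 1] P_inv[of 2 3 2 3] P_inv[of 2 3 3 2]
    by (simp_all add: r_def)
  note parity = this
  \<comment> \<open>Five unknowns remain in the block of (1, 1), (2, 3), (3, 2). Three entries of
    the relations with \<open>V\<close> and \<open>X\<close> reduce them to two. The factor w^2 - w
    below arises because the first row and the first column of \<open>X\<close> differ.\<close>
  have "c * c * (2 * A $ (2, 3) $ (1, 1)) = c * c * (2 * A $ (1, 1) $ (2, 3))"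
    using VA[THEN entry, of "(1, 1)" "(1, 1)"]
    by (simp add: expand V supp_row parity algebra_simps)
  then have xy: "A $ (2, 3) $ (1, 1) = A $ (1, 1) $ (2, 3)"
    using \<open>c \<noteq> 0\<close> by simp
  have "c * c * ((w ^ 2 - w) * (2 * A $ (1, 1) $ (2, 3))) = 0"
    using XA[THEN entry, of "(1, 1)" "(1, 1)"]
    by (simp add: expand X supp_row parity xy algebra_simps)
  then have x: "A $ (1, 1) $ (2, 3) = 0"
    using \<open>c \<noteq> 0\<close> w3 by simp
  have "c * c * (A $ (1, 1) $ (1, 1)) = c * c * (A $ (2, 3) $ (2, 3) + A $ (2, 3) $ (3, 2))"
    using VA[THEN entry, of "(1, 1)" "(2, 3)"]
    by (simp add: expand V supp_row parity xy x algebra_simps)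
  then have k0: "A $ (1, 1) $ (1, 1) = A $ (2, 3) $ (2, 3) + A $ (2, 3) $ (3, 2)"
    using \<open>c \<noteq> 0\<close> by simp
  let ?F = "swap_form (A $ (2, 3) $ (2, 3)) (A $ (2, 3) $ (3, 2)) :: complex^(3 \<times> 3)^(3 \<times> 3)"
  have row: "A $ (a, b) $ (c, d) = ?F $ (a, b) $ (c, d)" if "(a, b) \<in> {(1, 1), (2, 3), (3, 2)}" for a b c d
  proof (cases "(c, d) \<in> {(1, 1), (2, 3), (3, 2)}")
    case True
    have entries: "A $ (1, 1) $ (1, 1) = ?F $ (1, 1) $ (1, 1)" "A $ (1, 1) $ (2, 3) = ?F $ (1, 1) $ (2, 3)"
      "A $ (1, 1) $ (3, 2) = ?F $ (1, 1) $ (3, 2)" "A $ (2, 3) $ (1, 1) = ?F $ (2, 3) $ (1, 1)"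
      "A $ (2, 3) $ (2, 3) = ?F $ (2, 3) $ (2, 3)" "A $ (2, 3) $ (3, 2) = ?F $ (2, 3) $ (3, 2)"
      "A $ (3, 2) $ (1, 1) = ?F $ (3, 2) $ (1, 1)" "A $ (3, 2) $ (2, 3) = ?F $ (3, 2) $ (2, 3)"
      "A $ (3, 2) $ (3, 2) = ?F $ (3, 2) $ (3, 2)"
      by (simp_all add: parity xy x k0)
    have "(a, b) = (1, 1) \<or> (a, b) = (2, 3) \<or> (a, b) = (3, 2)" "(c, d) = (1, 1) \<or> (c, d) = (2, 3) \<or> (c, d) = (3, 2)"
      using that True by auto
    then show ?thesis
      unfolding prod.inject using entries by (elim disjE conjE) (simp_all only:)
  next
    case False
    then have "\<not> (a = c \<and> b = d)" "\<not> (a = d \<and> b = c)"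
      using that by auto
    then have "?F $ (a, b) $ (c, d) = 0"
      unfolding swap_form_nth by (simp only: if_False add_0)
    then show ?thesis
      using supp_row(1)[OF that False] by (simp only:)
  qed
  have "A $ (a, b) $ (c, d) = ?F $ (a, b) $ (c, d)" for a b c d
  proof -
    have F_inv: "?F $ (s a, s b) $ (s c, s d) = ?F $ (a, b) $ (c, d)" for a b c d
      by (simp add: inj_eq[OF \<open>inj s\<close>])
    \<comment> \<open>A shift of both indices raises their sum by 2 modulo 3, so at most two shifts
      lead into the block.\<close>
    consider "(a, b) \<in> {(1, 1), (2, 3), (3, 2)}" | "(s a, s b) \<in> {(1, 1), (2, 3), (3, 2)}"
      | "(s (s a), s (s b)) \<in> {(1, 1), (2, 3), (3, 2)}"
      using exhaust_3[of a] exhaust_3[of b] by (auto simp: s_def)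
    then show ?thesis
      using row[of a b c d] row[of "s a" "s b" "s c" "s d"] row[of "s (s a)" "s (s b)" "s (s c)" "s (s d)"]
      unfolding F_inv shift_inv by cases
  qed
  then show "\<exists>\<alpha> \<beta>. A = swap_form \<alpha> \<beta>"
    by (metis vec_eq_iff surj_pair)
qed

section \<open>The two finite groups\<close>

text \<open>The lattice Z + Z \<alpha>, which is a ring as soon as it contains \<alpha> *
  \<alpha>.\<close>

definition in_lattice :: "complex \<Rightarrow> complex \<Rightarrow> bool" where
  "in_lattice \<alpha> x \<longleftrightarrow> (\<exists>a b :: int. x = of_int a + of_int b * \<alpha>)"

lemma in_lattice_of_int: "in_lattice \<alpha> (of_int n)"
  unfolding in_lattice_def by (rule exI[of _ n], rule exI[of _ 0]) simp

lemma in_lattice_generator: "in_lattice \<alpha> \<alpha>"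
  unfolding in_lattice_def by (rule exI[of _ 0], rule exI[of _ 1]) simp

lemma in_lattice_add: "in_lattice \<alpha> x \<Longrightarrow> in_lattice \<alpha> y \<Longrightarrow> in_lattice \<alpha> (x + y)"
  unfolding in_lattice_def
proof (elim exE)
  fix a b c d :: int assume "x = of_int a + of_int b * \<alpha>" "y = of_int c + of_int d * \<alpha>"
  then have "x + y = of_int (a + c) + of_int (b + d) * \<alpha>"
    by (simp add: algebra_simps)
  then show "\<exists>a b. x + y = of_int a + of_int b * \<alpha>" by blast
qed

lemma in_lattice_uminus: "in_lattice \<alpha> x \<Longrightarrow> in_lattice \<alpha> (- x)"
  unfolding in_lattice_def
proof (elim exE)
  fix a b :: int assume "x = of_int a + of_int b * \<alpha>"
  then have "- x = of_int (- a) + of_int (- b) * \<alpha>"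
    by simp
  then show "\<exists>a b. - x = of_int a + of_int b * \<alpha>" by blast
qed

lemma in_lattice_diff: "in_lattice \<alpha> x \<Longrightarrow> in_lattice \<alpha> y \<Longrightarrow> in_lattice \<alpha> (x - y)"
  using in_lattice_add[OF _ in_lattice_uminus] by fastforce

lemma in_lattice_mult:
  assumes "in_lattice \<alpha> (\<alpha> * \<alpha>)" "in_lattice \<alpha> x" "in_lattice \<alpha> y"
  shows "in_lattice \<alpha> (x * y)"
proof -
  obtain p q a b c d :: int where pq: "\<alpha> * \<alpha> = of_int p + of_int q * \<alpha>"
    and x: "x = of_int a + of_int b * \<alpha>" and y: "y = of_int c + of_int d * \<alpha>"
    using assms unfolding in_lattice_def by blast
  have "x * y = of_int (a * c) + of_int (a * d + b * c) * \<alpha> + of_int (b * d) * (\<alpha> * \<alpha>)"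
    by (simp add: x y algebra_simps)
  also have "\<dots> = of_int (a * c + b * d * p) + of_int (a * d + b * c + b * d * q) * \<alpha>"
    by (simp add: pq algebra_simps)
  finally show ?thesis
    unfolding in_lattice_def by blast
qed

lemma in_lattice_numeral: "in_lattice \<alpha> 0" "in_lattice \<alpha> 1" "in_lattice \<alpha> (numeral n)"
  using in_lattice_of_int[of \<alpha> 0] in_lattice_of_int[of \<alpha> 1] in_lattice_of_int[of \<alpha> "numeral n"]
  by simp_all

lemma in_lattice_numeral_mult: "in_lattice \<alpha> (numeral n * \<alpha>)"
  unfolding in_lattice_def by (rule exI[of _ 0], rule exI[of _ "numeral n"]) simp

lemmas in_lattice_intros = in_lattice_numeral_mult in_lattice_numeral in_lattice_generator in_lattice_add
  in_lattice_uminus in_lattice_diff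

lemma in_lattice_sum: "(\<And>i. i \<in> S \<Longrightarrow> in_lattice \<alpha> (f i)) \<Longrightarrow> in_lattice \<alpha> (sum f S)"
  by (induction S rule: infinite_finite_induct) (auto intro: in_lattice_intros)

text \<open>The imaginary part bounds the coefficient of \<alpha>; then the norm bounds the other
  coefficient.\<close>

lemma finite_bounded_lattice:
  assumes "Im \<alpha> \<noteq> 0"
  shows "finite {x. in_lattice \<alpha> x \<and> norm x \<le> B}"
proof (rule finite_subset)
  define N where "N = \<lceil>B / \<bar>Im \<alpha>\<bar>\<rceil>"
  define M where "M = \<lceil>B + of_int N * norm \<alpha>\<rceil>"
  show "{x. in_lattice \<alpha> x \<and> norm x \<le> B} \<subseteq> (\<lambda>(a, b). of_int a + of_int b * \<alpha>) ` ({- M..M} \<times> {- N..N})"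
  proof
    fix x assume "x \<in> {x. in_lattice \<alpha> x \<and> norm x \<le> B}"
    then obtain a b :: int where x: "x = of_int a + of_int b * \<alpha>" and B: "norm x \<le> B"
      by (auto simp: in_lattice_def)
    have "\<bar>of_int b\<bar> * \<bar>Im \<alpha>\<bar> \<le> B"
      using order_trans[OF abs_Im_le_cmod[of x] B] by (simp add: x abs_mult)
    then have "\<bar>of_int b\<bar> \<le> B / \<bar>Im \<alpha>\<bar>"
      using assms by (simp add: field_simps)
    then have b: "\<bar>b\<bar> \<le> N"
      unfolding N_def by linarith
    have "norm (of_int a :: complex) \<le> norm x + norm (of_int b * \<alpha>)"
      using norm_triangle_ineq4[of x "of_int b * \<alpha>"] by (simp add: x)
    also have "\<dots> \<le> B + of_int N * norm \<alpha>"
      using B b by (auto simp: norm_mult intro!: add_mono mult_right_mono)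
    finally have "\<bar>a\<bar> \<le> M"
      unfolding M_def by simp linarith
    with b x show "x \<in> (\<lambda>(a, b). of_int a + of_int b * \<alpha>) ` ({- M..M} \<times> {- N..N})"
      by (auto intro!: image_eqI[of _ _ "(a, b)"])
  qed
qed auto

lemma finite_matrix_entries:
  assumes "finite L"
  shows "finite {M :: 'a^'n^'m. \<forall>i j. M $ i $ j \<in> L}"
proof (rule finite_subset)
  show "{M :: 'a^'n^'m. \<forall>i j. M $ i $ j \<in> L} \<subseteq>
    (\<lambda>f. \<chi> i j. f (i, j)) ` PiE UNIV (\<lambda>_. L)"
  proof
    fix M :: "'a^'n^'m" assume "M \<in> {M. \<forall>i j. M $ i $ j \<in> L}"
    then show "M \<in> (\<lambda>f. \<chi> i j. f (i, j)) ` PiE UNIV (\<lambda>_. L)"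
      by (intro image_eqI[of _ _ "\<lambda>(i, j). M $ i $ j"]) (auto simp: vec_eq_iff)
  qed
qed (intro finite_imageI finite_PiE; simp add: assms)

text \<open>A group of unitary matrices that preserves a full lattice over an imaginary quadratic order is
  finite, since its matrices with respect to a lattice basis have bounded lattice entries.\<close>

lemma finite_generate_lattice:
  assumes S: "S \<subseteq> carrier SU3" and "Im \<alpha> \<noteq> 0" and sq: "in_lattice \<alpha> (\<alpha> * \<alpha>)" and "det C \<noteq> 0"
    and gen: "\<And>h. h \<in> S \<Longrightarrow> \<exists>R. (\<forall>i j. in_lattice \<alpha> (R $ i $ j)) \<and> h ** C = C ** R"
    and inv: "\<And>h. h \<in> S \<Longrightarrow> \<exists>R. (\<forall>i j. in_lattice \<alpha> (R $ i $ j)) \<and> dagger h ** C = C ** R"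
  shows "finite (generate SU3 S)"
proof -
  obtain D where D: "D ** C = mat 1" "C ** D = mat 1"
    using \<open>det C \<noteq> 0\<close> invertible_det_nz[of C] unfolding invertible_def by blast
  have SU3: "g \<in> carrier SU3" if "g \<in> generate SU3 S" for g
    using group.generate_in_carrier[OF group_SU3 S that] .
  have lat: "\<exists>R. (\<forall>i j. in_lattice \<alpha> (R $ i $ j)) \<and> g ** C = C ** R" if "g \<in> generate SU3 S" for g
    using that
  proof (induction rule: generate.induct)
    case one
    show ?case
    proof (intro exI conjI allI)
      show "in_lattice \<alpha> (mat 1 $ i $ j)" for i j
        by (simp add: mat_def in_lattice_numeral)
    qed simp
  next
    case (incl h)
    then show ?case by (rule gen)
  next
    case (inv h)
    then show ?case
      unfolding SU3_inv[OF subsetD[OF S inv]] by (rule assms(6))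
  next
    case (eng g h)
    then obtain R T where "\<forall>i j. in_lattice \<alpha> (R $ i $ j)" "g ** C = C ** R"
        "\<forall>i j. in_lattice \<alpha> (T $ i $ j)" "h ** C = C ** T" by blast
    then have "(g ** h) ** C = C ** (R ** T)"
      by (metis matrix_mul_assoc)
    moreover have "in_lattice \<alpha> ((R ** T) $ i $ j)" for i j
      using \<open>\<forall>i j. in_lattice \<alpha> (R $ i $ j)\<close> \<open>\<forall>i j. in_lattice \<alpha> (T $ i $ j)\<close>
      by (auto simp: matrix_matrix_mult_def intro!: in_lattice_sum in_lattice_mult[OF sq])
    ultimately show ?case
      by auto
  qed
  \<comment> \<open>A bound on the entries of \<open>D ** g ** C\<close> that is uniform in g,
    because entries of unitary matrices have norm at most 1.\<close>
  define B where "B i j = (\<Sum>k\<in>UNIV. \<Sum>l\<in>UNIV. norm (D $ i $ l) * norm (C $ k $ j))" for i j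
  define B' where "B' = Max (range (\<lambda>(i, j). B i j))"
  have B': "B i j \<le> B'" for i j
    unfolding B'_def by (rule Max_ge) (auto intro: rev_image_eqI[of "(i, j)"])
  let ?L = "{x. in_lattice \<alpha> x \<and> norm x \<le> B'}"
  have "(\<lambda>g. D ** g ** C) ` generate SU3 S \<subseteq> {M. \<forall>i j. M $ i $ j \<in> ?L}"
  proof clarify
    fix g and i j :: 3 assume g: "g \<in> generate SU3 S"
    obtain R where R: "\<forall>i j. in_lattice \<alpha> (R $ i $ j)" "g ** C = C ** R"
      using lat[OF g] by blast
    have "D ** g ** C = R"
      using R(2) D(1) by (metis matrix_mul_assoc matrix_mul_lid)
    moreover have "norm ((D ** g ** C) $ i $ j) \<le> B i j"
      unfolding matrix_matrix_mult_def B_def vec_lambda_beta sum_distrib_right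
    proof (intro order_trans[OF norm_sum] sum_mono)
      fix k l
      have "norm (g $ l $ k) \<le> 1"
        by (rule norm_unitary_le[OF SU3_dagger_mult[OF SU3[OF g]]])
      then have "norm (D $ i $ l) * norm (g $ l $ k) * norm (C $ k $ j) \<le> norm (D $ i $ l) * 1 * norm (C $ k $ j)"
        by (intro mult_mono) auto
      then show "norm (D $ i $ l * g $ l $ k * C $ k $ j) \<le> norm (D $ i $ l) * norm (C $ k $ j)"
        by (simp add: norm_mult)
    qed
    ultimately show "in_lattice \<alpha> ((D ** g ** C) $ i $ j) \<and> norm ((D ** g ** C) $ i $ j) \<le> B'"
      using R(1) B'[of i j] by auto
  qed
  then have "finite ((\<lambda>g. D ** g ** C) ` generate SU3 S)"
    by (rule finite_subset[OF _ finite_matrix_entries[OF finite_bounded_lattice[OF \<open>Im \<alpha> \<noteq> 0\<close>]]])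
  moreover have "inj (\<lambda>g. D ** g ** C)"
  proof (rule injI)
    fix g h assume "D ** g ** C = D ** h ** C"
    then have "C ** (D ** g ** C) ** D = C ** (D ** h ** C) ** D" by simp
    then have "(C ** D) ** g ** (C ** D) = (C ** D) ** h ** (C ** D)"
      by (simp only: matrix_mul_assoc)
    then show "g = h" by (simp add: D)
  qed
  ultimately show ?thesis
    by (meson finite_imageD inj_on_subset subset_UNIV)
qed

section \<open>Roots of unity of order 3 and 7\<close>

lemma \<xi>_eq_cis: "\<xi> n = cis (2 * pi / n)"
  by (simp add: \<xi>_def cis_conv_exp mult_ac)

lemma \<xi>_power_eq_iff:
  assumes "n > 0"
  shows "\<xi> n ^ j = \<xi> n ^ k \<longleftrightarrow> j mod n = k mod n"
proof -
  have "\<xi> n ^ m = exp (2 * of_real pi * \<i> * of_nat m / of_nat n)" for m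
    unfolding \<xi>_def exp_of_nat_mult[symmetric] by (simp add: mult_ac)
  then show ?thesis
    using complex_root_unity_eq[of n j k] assms by simp
qed

lemma cnj_\<xi>: "n > 0 \<Longrightarrow> cnj (\<xi> n) = \<xi> n ^ (n - 1)"
proof -
  assume "n > 0"
  then have "\<xi> n * \<xi> n ^ (n - 1) = 1"
    using \<xi>_power_eq_iff[of n n 0] by (simp flip: power_Suc)
  moreover have "\<xi> n * cnj (\<xi> n) = 1"
    by (simp add: \<xi>_eq_cis cis_cnj cis_mult)
  moreover have "\<xi> n \<noteq> 0"
    by (simp add: \<xi>_def)
  ultimately show ?thesis
    by (metis mult_left_cancel)
qed

text \<open>With the square root of 3 and the imaginary unit expressed through
  \<open>\<xi> 3\<close>, all identities for \<open>V_mat\<close> and \<open>X_mat\<close> become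
  polynomial ones modulo the first equation.\<close>

lemma \<xi>3_identities: "\<xi> 3 ^ 2 + \<xi> 3 + 1 = 0" "1 / (of_real (sqrt 3) * \<i>) = - (1 + 2 * \<xi> 3) / 3"
  "cnj (\<xi> 3) = \<xi> 3 ^ 2" "Im (\<xi> 3) \<noteq> 0"
proof -
  have eq: "\<xi> 3 = Complex (-1/2) (sqrt 3 / 2)"
    by (simp add: \<xi>_eq_cis complex_eq_iff cos_120 sin_120)
  show "\<xi> 3 ^ 2 + \<xi> 3 + 1 = 0"
    by (simp add: eq complex_eq_iff power2_eq_square)
  show "1 / (of_real (sqrt 3) * \<i>) = - (1 + 2 * \<xi> 3) / 3"
  proof -
    have theta: "1 + 2 * \<xi> 3 = of_real (sqrt 3) * \<i>"
      by (simp add: eq complex_eq_iff)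
    have "(of_real (sqrt 3) * \<i>) * (of_real (sqrt 3) * \<i>) = (- 3 :: complex)"
      by (simp add: complex_eq_iff)
    then show ?thesis
      unfolding theta by (simp add: divide_eq_eq)
  qed
  show "cnj (\<xi> 3) = \<xi> 3 ^ 2"
    using cnj_\<xi>[of 3] by simp
  show "Im (\<xi> 3) \<noteq> 0" by (simp add: eq)
qed

text \<open>The second equation evaluates the quadratic Gauss sum modulo \<open>7\<close>; \<open>det Z_mat = 1\<close> depends on its sign.\<close>

lemma \<xi>7_identities: defines "z \<equiv> \<xi> 7"
  shows "z ^ 6 + z ^ 5 + z ^ 4 + z ^ 3 + z ^ 2 + z + 1 = 0"
    "\<i> / of_real (sqrt 7) = (z + z ^ 2 + z ^ 4 - z ^ 3 - z ^ 5 - z ^ 6) / 7"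
    "cnj z = z ^ 6" "Im (z + z ^ 2 + z ^ 4) \<noteq> 0"
proof -
  have "z ^ 7 = 1" "z \<noteq> 1"
    using \<xi>_power_eq_iff[of 7 7 0] \<xi>_power_eq_iff[of 7 1 0] by (simp_all add: z_def)
  moreover have "z ^ 7 - 1 = (z - 1) * (z ^ 6 + z ^ 5 + z ^ 4 + z ^ 3 + z ^ 2 + z + 1)"
    by (simp add: eval_nat_numeral algebra_simps)
  ultimately show sum0: "z ^ 6 + z ^ 5 + z ^ 4 + z ^ 3 + z ^ 2 + z + 1 = 0"
    by auto
  show cnj_z: "cnj z = z ^ 6"
    using cnj_\<xi>[of 7] by (simp add: z_def)
  define t where "t = Im (z + z ^ 2 + z ^ 4)"
  have "z ^ 12 = z ^ 5" "z ^ 24 = z ^ 3"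
    using \<xi>_power_eq_iff[of 7 12 5] \<xi>_power_eq_iff[of 7 24 3] by (simp_all add: z_def)
  then have "cnj (z + z ^ 2 + z ^ 4) = z ^ 6 + z ^ 5 + z ^ 3"
    by (simp add: cnj_z flip: power_mult)
  then have s: "z + z ^ 2 + z ^ 4 - z ^ 3 - z ^ 5 - z ^ 6 = 2 * \<i> * of_real t"
    using complex_diff_cnj[of "z + z ^ 2 + z ^ 4"] unfolding t_def[symmetric]
    by (simp del: complex_cnj_add add: algebra_simps)
  have "(z + z ^ 2 + z ^ 4 - z ^ 3 - z ^ 5 - z ^ 6) ^ 2 = - 7"
    using sum0 by algebra
  then have "(of_real (2 * t) :: complex) ^ 2 = 7"
    unfolding s by (simp add: power_mult_distrib)
  then have "(2 * t) ^ 2 = 7"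
    by (metis of_real_eq_iff of_real_numeral of_real_power)
  \<comment> \<open>The square leaves the sign of t open. The only negative summand, -sin(pi/7), is
    outweighed by sin(2 pi/7).\<close>
  moreover have "t > 0"
  proof -
    have "Im (z ^ k) = sin (real k * (2 * pi / 7))" for k
      unfolding z_def \<xi>_eq_cis Complex.DeMoivre by simp
    from this[of 1] this[of 2] this[of 4]
    have "t = sin (2 * pi / 7) + sin (4 * pi / 7) + sin (8 * pi / 7)"
      by (simp add: t_def)
    moreover have "sin (8 * pi / 7) = - sin (pi / 7)"
      using sin_periodic_pi[of "pi / 7"] by (simp add: field_simps)
    moreover have "sin (pi / 7) < sin (2 * pi / 7)"
      using pi_gt_zero by (intro sin_monotone_2pi; linarith)
    moreover have "sin (4 * pi / 7) > 0"
      by (rule sin_gt_zero) auto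
    ultimately show ?thesis by linarith
  qed
  ultimately have "2 * t = sqrt 7"
    by (intro real_sqrt_unique[symmetric]) auto
  then show "\<i> / of_real (sqrt 7) = (z + z ^ 2 + z ^ 4 - z ^ 3 - z ^ 5 - z ^ 6) / 7"
    unfolding s using real_sqrt_mult_self[of 7]
    by (auto simp: complex_eq_iff field_simps)
  show "Im (z + z ^ 2 + z ^ 4) \<noteq> 0"
    using \<open>t > 0\<close> by (simp add: t_def)
qed

lemma lattice_witness:
  "h ** C = C ** R \<Longrightarrow> \<forall>i j. in_lattice \<alpha> (R $ i $ j) \<Longrightarrow>
    \<exists>R. (\<forall>i j. in_lattice \<alpha> (R $ i $ j)) \<and> h ** C = C ** R"
  by blast

section \<open>Explicit 3 by 3 matrices and the generators\<close>

lemma mat3_nth [simp]: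
  "mat3 [[a, b, c], [d, e, f], [g, h, i]] $ 1 = vector [a, b, c]"
  "mat3 [[a, b, c], [d, e, f], [g, h, i]] $ 2 = vector [d, e, f]"
  "mat3 [[a, b, c], [d, e, f], [g, h, i]] $ 3 = vector [g, h, i]"
  by (simp_all add: mat3_def)

lemma mat3_mult:
  "mat3 [[a, b, c], [d, e, f], [g, h, i]] ** mat3 [[a', b', c'], [d', e', f'], [g', h', i']] =
    mat3 [[a * a' + b * d' + c * g', a * b' + b * e' + c * h', a * c' + b * f' + c * i'],
          [d * a' + e * d' + f * g', d * b' + e * e' + f * h', d * c' + e * f' + f * i'],
          [g * a' + h * d' + i * g', g * b' + h * e' + i * h', g * c' + h * f' + i * i']]"
  by (simp add: vec_eq_iff forall_3 matrix_matrix_mult_def sum_3)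

lemma dagger_mat3:
  "dagger (mat3 [[a, b, c], [d, e, f], [g, h, i]]) =
    mat3 [[cnj a, cnj d, cnj g], [cnj b, cnj e, cnj h], [cnj c, cnj f, cnj i]]"
  by (simp add: vec_eq_iff forall_3)

lemma det_mat3:
  "det (mat3 [[a, b, c], [d, e, f], [g, h, i]]) =
    a * e * i + b * f * g + c * d * h - a * f * h - b * d * i - c * e * g"
  by (simp add: det_3)

lemma map_matrix_mat3:
  "map_matrix k (mat3 [[a, b, c], [d, e, f], [g, h, i]]) =
    mat3 [[k a, k b, k c], [k d, k e, k f], [k g, k h, k i]]"
  by (simp add: vec_eq_iff forall_3)

lemma mat_1_mat3: "mat 1 = mat3 [[1, 0, 0], [0, 1, 0], [0, 0, 1]]"
  by (simp add: vec_eq_iff forall_3 mat_def)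

lemma mat3_eqI:
  assumes "a = a'" "b = b'" "c = c'" "d = d'" "e = e'" "f = f'" "g = g'" "h = h'" "i = i'"
  shows "mat3 [[a, b, c], [d, e, f], [g, h, i]] = mat3 [[a', b', c'], [d', e', f'], [g', h', i']]"
  by (simp add: assms)

lemma V_X_mat3:
  defines "w \<equiv> \<xi> 3" and "c \<equiv> - (1 + 2 * \<xi> 3) / 3"
  shows "V_mat = mat3 [[c, c, c], [c, c * w, c * w ^ 2], [c, c * w ^ 2, c * w]]"
    "X_mat = mat3 [[c, c, c * w ^ 2], [c, c * w, c * w], [c * w, c, c * w]]"
    "dagger V_mat = mat3 [[- c, - c, - c], [- c, - c * w ^ 2, - c * w], [- c, - c * w, - c * w ^ 2]]"
    "dagger X_mat = mat3 [[- c, - c, - c * w ^ 2], [- c, - c * w ^ 2, - c], [- c * w, - c * w ^ 2, - c * w ^ 2]]"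
proof -
  show V: "V_mat = mat3 [[c, c, c], [c, c * w, c * w ^ 2], [c, c * w ^ 2, c * w]]"
    and X: "X_mat = mat3 [[c, c, c * w ^ 2], [c, c * w, c * w], [c * w, c, c * w]]"
    unfolding V_mat_def X_mat_def \<xi>3_identities(2) map_matrix_mat3 c_def w_def by simp_all
  have w: "w ^ 2 + w + 1 = 0" using \<xi>3_identities(1) by (simp add: w_def)
  have cnj_w: "cnj w = w ^ 2" using \<xi>3_identities(3) by (simp add: w_def)
  have w4: "w ^ 4 = w" using w by algebra
  have "cnj c = - (1 + 2 * w ^ 2) / 3"
    by (simp add: c_def \<xi>3_identities(3) w_def)
  also have "\<dots> = - c"
    using w unfolding c_def w_def[symmetric] by (simp add: field_simps) algebra
  finally have cnj_c: "cnj c = - c" .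
  show "dagger V_mat = mat3 [[- c, - c, - c], [- c, - c * w ^ 2, - c * w], [- c, - c * w, - c * w ^ 2]]"
    "dagger X_mat = mat3 [[- c, - c, - c * w ^ 2], [- c, - c * w ^ 2, - c], [- c * w, - c * w ^ 2, - c * w ^ 2]]"
    unfolding V X dagger_mat3 by (simp_all add: cnj_c cnj_w w4)
qed

lemma V_mat_SU3: "V_mat \<in> carrier SU3" and X_mat_SU3: "X_mat \<in> carrier SU3"
proof -
  define w c where "w = \<xi> 3" and "c = - (1 + 2 * \<xi> 3) / 3"
  have w: "w ^ 2 + w + 1 = 0" and c: "3 * c = - (1 + 2 * w)"
    using \<xi>3_identities(1) by (simp_all add: w_def c_def)
  note VX = V_X_mat3[folded w_def c_def]
  have "dagger V_mat ** V_mat = mat 1" "dagger X_mat ** X_mat = mat 1"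
    unfolding VX(3,4) unfolding VX(1,2) mat3_mult mat_1_mat3
    by (rule mat3_eqI; use w c in algebra)+
  moreover have "det V_mat = 1" "det X_mat = 1"
    unfolding VX(1,2) det_mat3 using w c by algebra+
  ultimately show "V_mat \<in> carrier SU3" "X_mat \<in> carrier SU3"
    by (auto simp: SU3_iff)
qed

text \<open>These words exhibit the Heisenberg group inside the group: \<open>V_mat ** V_mat\<close>
  is minus the parity, the other two are clock and shift.\<close>

lemma Sigma72x3_words:
  shows "V_mat ** V_mat = mat3 [[-1, 0, 0], [0, 0, -1], [0, -1, 0]]"
    and "V_mat ** V_mat ** (X_mat ** X_mat) = mat3 [[1, 0, 0], [0, \<xi> 3, 0], [0, 0, \<xi> 3 ^ 2]]"
    and "V_mat ** (X_mat ** X_mat) ** V_mat = mat3 [[0, 0, 1], [1, 0, 0], [0, 1, 0]]"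
proof -
  define w c where "w = \<xi> 3" and "c = - (1 + 2 * \<xi> 3) / 3"
  have w: "w ^ 2 + w + 1 = 0" and c: "3 * c = - (1 + 2 * w)"
    using \<xi>3_identities(1) by (simp_all add: w_def c_def)
  note VX = V_X_mat3[folded w_def c_def]
  show VV: "V_mat ** V_mat = mat3 [[-1, 0, 0], [0, 0, -1], [0, -1, 0]]"
    unfolding VX(1) mat3_mult by (rule mat3_eqI; use w c in algebra)
  have XX: "X_mat ** X_mat = mat3 [[-1, 0, 0], [0, 0, - (w ^ 2)], [0, - w, 0]]"
    unfolding VX(2) mat3_mult by (rule mat3_eqI; use w c in algebra)
  show "V_mat ** V_mat ** (X_mat ** X_mat) = mat3 [[1, 0, 0], [0, \<xi> 3, 0], [0, 0, \<xi> 3 ^ 2]]"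
    unfolding VV XX mat3_mult w_def[symmetric] by (rule mat3_eqI; simp)
  show "V_mat ** (X_mat ** X_mat) ** V_mat = mat3 [[0, 0, 1], [1, 0, 0], [0, 1, 0]]"
    unfolding VX(1) XX mat3_mult by (rule mat3_eqI; use w c in algebra)
qed

lemma finite_Sigma72x3: "finite Sigma72x3"
proof -
  define w c where "w = \<xi> 3" and "c = - (1 + 2 * \<xi> 3) / 3"
  have w: "w ^ 2 + w + 1 = 0" and c: "3 * c = - (1 + 2 * w)" and Im: "Im w \<noteq> 0"
    using \<xi>3_identities(1,4) by (simp_all add: w_def c_def)
  note VX = V_X_mat3[folded w_def c_def]
  \<comment> \<open>With \<theta> = 1 + 2 w, a square root of -3, the columns span the vectors over
    Z[w] whose three coordinates agree modulo \<theta>. The division by \<theta> in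
    \<open>V_mat\<close> and \<open>X_mat\<close> does not lead out of this lattice.\<close>
  define C where "C = mat3 [[1, 0, 0], [1, 1 + 2 * w, 0], [1, 0, 1 + 2 * w]]"
  have C: "V_mat ** C = C ** mat3 [[- 1 - 2 * w, 1, 1], [1, 1 + w, w], [1, w, 1 + w]]"
    "X_mat ** C = C ** mat3 [[- 1 - w, 1, - 1 - w], [- w, 1 + w, 1], [- w, 0, 1]]"
    "dagger V_mat ** C = C ** mat3 [[1 + 2 * w, - 1, - 1], [- 1, - w, - 1 - w], [- 1, - 1 - w, - w]]"
    "dagger X_mat ** C = C ** mat3 [[1 + w, - 1, 1 + w], [0, - w, w], [- 1, - w, 0]]"
    unfolding VX(3,4) unfolding VX(1,2) C_def mat3_mult by (rule mat3_eqI; use w c in algebra)+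
  have "1 + 2 * w \<noteq> 0"
    using Im by (auto simp: complex_eq_iff)
  then have det: "det C \<noteq> 0"
    by (simp add: C_def det_mat3)
  have "w * w = - 1 - w"
    using w by algebra
  then have lat: "in_lattice w (w * w)"
    by (simp add: in_lattice_intros)
  have ex: "\<exists>R. (\<forall>i j. in_lattice w (R $ i $ j)) \<and> V_mat ** C = C ** R"
    "\<exists>R. (\<forall>i j. in_lattice w (R $ i $ j)) \<and> X_mat ** C = C ** R"
    "\<exists>R. (\<forall>i j. in_lattice w (R $ i $ j)) \<and> dagger V_mat ** C = C ** R"
    "\<exists>R. (\<forall>i j. in_lattice w (R $ i $ j)) \<and> dagger X_mat ** C = C ** R"
    by (rule lattice_witness[OF C(1)] lattice_witness[OF C(2)] lattice_witness[OF C(3)] lattice_witness[OF C(4)];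
        simp add: forall_3 in_lattice_intros)+
  show ?thesis
    unfolding Sigma72x3_def
  proof (rule finite_generate_lattice[OF _ Im lat det])
    show "{V_mat, X_mat} \<subseteq> carrier SU3"
      by (simp add: V_mat_SU3 X_mat_SU3)
    fix h assume "h \<in> {V_mat, X_mat}"
    then have h: "h = V_mat \<or> h = X_mat" by blast
    from h show "\<exists>R. (\<forall>i j. in_lattice w (R $ i $ j)) \<and> h ** C = C ** R"
      by (elim disjE) (simp_all only: ex)
    from h show "\<exists>R. (\<forall>i j. in_lattice w (R $ i $ j)) \<and> dagger h ** C = C ** R"
      by (elim disjE) (simp_all only: ex)
  qed
qed

text \<open>The Gauss sum moves the entries into Q(\<xi>7), where polynomial arithmetic decides
  identities. As \<open>Z_mat\<close> is Hermitian, it is its own inverse.\<close>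

lemma Z_mat3:
  defines "z \<equiv> \<xi> 7" and "k \<equiv> (\<xi> 7 + \<xi> 7 ^ 2 + \<xi> 7 ^ 4 - \<xi> 7 ^ 3 - \<xi> 7 ^ 5 - \<xi> 7 ^ 6) / 7"
  shows "Z_mat = mat3 [[k * (z ^ 4 - z ^ 3), k * (z ^ 2 - z ^ 5), k * (z - z ^ 6)],
      [k * (z ^ 2 - z ^ 5), k * (z - z ^ 6), k * (z ^ 4 - z ^ 3)],
      [k * (z - z ^ 6), k * (z ^ 4 - z ^ 3), k * (z ^ 2 - z ^ 5)]]"
    and "dagger Z_mat = Z_mat" and "7 * k = z + z ^ 2 + z ^ 4 - z ^ 3 - z ^ 5 - z ^ 6"
proof -
  have k: "k = \<i> / of_real (sqrt 7)"
    unfolding k_def \<xi>7_identities(2) ..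
  show Z: "Z_mat = mat3 [[k * (z ^ 4 - z ^ 3), k * (z ^ 2 - z ^ 5), k * (z - z ^ 6)],
      [k * (z ^ 2 - z ^ 5), k * (z - z ^ 6), k * (z ^ 4 - z ^ 3)],
      [k * (z - z ^ 6), k * (z ^ 4 - z ^ 3), k * (z ^ 2 - z ^ 5)]]"
    unfolding Z_mat_def map_matrix_mat3 z_def k ..
  have cnj_k: "cnj k = - k"
    by (simp add: k)
  have powers: "z ^ 12 = z ^ 5" "z ^ 18 = z ^ 4" "z ^ 24 = z ^ 3" "z ^ 30 = z ^ 2" "z ^ 36 = z"
    using \<xi>_power_eq_iff[of 7 12 5] \<xi>_power_eq_iff[of 7 18 4] \<xi>_power_eq_iff[of 7 24 3]
      \<xi>_power_eq_iff[of 7 30 2] \<xi>_power_eq_iff[of 7 36 1] by (simp_all add: z_def)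
  have cnj_z: "cnj z = z ^ 6"
    using \<xi>7_identities(3) by (simp add: z_def)
  have "cnj (k * (z ^ 4 - z ^ 3)) = k * (z ^ 4 - z ^ 3)" "cnj (k * (z ^ 2 - z ^ 5)) = k * (z ^ 2 - z ^ 5)"
    "cnj (k * (z - z ^ 6)) = k * (z - z ^ 6)"
    by (simp_all add: cnj_k cnj_z powers algebra_simps flip: power_mult)
  then show "dagger Z_mat = Z_mat"
    unfolding Z dagger_mat3 by (simp only:)
  show "7 * k = z + z ^ 2 + z ^ 4 - z ^ 3 - z ^ 5 - z ^ 6"
    by (simp add: k_def z_def)
qed

lemma Y_mat_diag3: "Y_mat = diag3 (vector [\<xi> 7, \<xi> 7 ^ 2, \<xi> 7 ^ 4])"
  unfolding Y_mat_def by (simp add: vec_eq_iff forall_3)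

lemma Y_mat_SU3: "Y_mat \<in> carrier SU3" and Z_mat_SU3: "Z_mat \<in> carrier SU3"
proof -
  have "\<xi> 7 ^ 7 = 1"
    using \<xi>_power_eq_iff[of 7 7 0] by simp
  moreover have "\<xi> 7 * \<xi> 7 ^ 2 * \<xi> 7 ^ 4 = \<xi> 7 ^ 7" "\<xi> 7 * \<xi> 7 ^ 6 = \<xi> 7 ^ 7" for z
    by (simp_all add: eval_nat_numeral)
  moreover have "(\<xi> 7 ^ 6) ^ 2 * \<xi> 7 ^ 2 = (\<xi> 7 ^ 7) ^ 2" "(\<xi> 7 ^ 6) ^ 4 * \<xi> 7 ^ 4 = (\<xi> 7 ^ 7) ^ 4"
    by (simp_all flip: power_mult power_add)
  ultimately show "Y_mat \<in> carrier SU3"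
    unfolding Y_mat_def SU3_iff dagger_mat3 mat3_mult mat_1_mat3 det_mat3
    by (simp add: \<xi>7_identities(3) mult.commute[of "\<xi> 7 ^ 6"])
  define z k where "z = \<xi> 7" and "k = (\<xi> 7 + \<xi> 7 ^ 2 + \<xi> 7 ^ 4 - \<xi> 7 ^ 3 - \<xi> 7 ^ 5 - \<xi> 7 ^ 6) / 7"
  note Z = Z_mat3[folded z_def k_def]
  have z: "z ^ 6 + z ^ 5 + z ^ 4 + z ^ 3 + z ^ 2 + z + 1 = 0"
    using \<xi>7_identities(1) by (simp add: z_def)
  have "dagger Z_mat ** Z_mat = mat 1"
    unfolding Z(2) unfolding Z(1) mat3_mult mat_1_mat3
    by (rule mat3_eqI; use z Z(3) in algebra)
  moreover have "det Z_mat = 1"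
    unfolding Z(1) det_mat3 using z Z(3) by algebra
  ultimately show "Z_mat \<in> carrier SU3"
    by (simp add: SU3_iff)
qed

lemma finite_Sigma168: "finite Sigma168"
proof -
  define z k where "z = \<xi> 7" and "k = (\<xi> 7 + \<xi> 7 ^ 2 + \<xi> 7 ^ 4 - \<xi> 7 ^ 3 - \<xi> 7 ^ 5 - \<xi> 7 ^ 6) / 7"
  note Z = Z_mat3[folded z_def k_def]
  have z: "z ^ 6 + z ^ 5 + z ^ 4 + z ^ 3 + z ^ 2 + z + 1 = 0"
    using \<xi>7_identities(1) by (simp add: z_def)
  define a where "a = z + z ^ 2 + z ^ 4"
  \<comment> \<open>The columns are (1-z)^2, (1-z)^2 z and (1-z)^2 z^2 under the embeddings taking z
    to z, z^2 and z^4. They form a basis over Z[a] of the ideal (1-z)^2 of Z[z].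
    \<open>Y_mat\<close> acts as multiplication by z, with the companion matrix of its cubic over
    Z[a]; the relation for \<open>Z_mat\<close> shows that the ideal is also stable under
    it.\<close>
  define C where "C = mat3 [[(1 - z) ^ 2, (1 - z) ^ 2 * z, (1 - z) ^ 2 * z ^ 2],
    [(1 - z ^ 2) ^ 2, (1 - z ^ 2) ^ 2 * z ^ 2, (1 - z ^ 2) ^ 2 * z ^ 4],
    [(1 - z ^ 4) ^ 2, (1 - z ^ 4) ^ 2 * z ^ 4, (1 - z ^ 4) ^ 2 * z]]"
  have Y: "Y_mat = mat3 [[z, 0, 0], [0, z ^ 2, 0], [0, 0, z ^ 4]]"
    by (simp add: Y_mat_def z_def)
  have z7: "z ^ 7 = 1"
    using z by algebra
  have "(z ^ 6) ^ 2 = z ^ 5" "(z ^ 6) ^ 4 = z ^ 3"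
    using z by algebra+
  then have Y': "dagger Y_mat = mat3 [[z ^ 6, 0, 0], [0, z ^ 5, 0], [0, 0, z ^ 3]]"
    unfolding Y dagger_mat3 using \<xi>7_identities(3) by (simp add: z_def)
  have C: "Y_mat ** C = C ** mat3 [[0, 0, 1], [1, 0, 1 + a], [0, 1, a]]"
    "Z_mat ** C = C ** mat3 [[- 3 - a, 0, 2 - a], [- 2 - 2 * a, - 1, 4], [- 1 - 2 * a, 0, 3 + a]]"
    "dagger Y_mat ** C = C ** mat3 [[- 1 - a, 1, 0], [- a, 0, 1], [1, 0, 0]]"
    unfolding Y' unfolding Y Z(1) C_def mat3_mult by (rule mat3_eqI; ((use z Z(3) a_def in algebra) | (simp add: algebra_simps eval_nat_numeral; fail)))+
  \<comment> \<open>\<open>C\<close> is a diagonal matrix times the Vandermonde matrix of z, z^2,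
    z^4.\<close>
  have "det C = ((1 - z) * (1 - z ^ 2) * (1 - z ^ 4)) ^ 2 * (z ^ 2 - z) * (z ^ 4 - z) * (z ^ 4 - z ^ 2)"
    unfolding C_def det_mat3 using z by algebra
  moreover have "z \<noteq> 1" "z ^ 2 \<noteq> 1" "z ^ 4 \<noteq> 1" "z ^ 2 \<noteq> z" "z ^ 4 \<noteq> z" "z ^ 4 \<noteq> z ^ 2"
    using \<xi>_power_eq_iff[of 7 1 0] \<xi>_power_eq_iff[of 7 2 0] \<xi>_power_eq_iff[of 7 4 0]
      \<xi>_power_eq_iff[of 7 2 1] \<xi>_power_eq_iff[of 7 4 1] \<xi>_power_eq_iff[of 7 4 2]
    by (simp_all add: z_def)
  ultimately have det: "det C \<noteq> 0" by simp
  have "a * a = - 2 - a"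
    using z unfolding a_def by algebra
  then have lat: "in_lattice a (a * a)"
    by (simp add: in_lattice_intros)
  have ex: "\<exists>R. (\<forall>i j. in_lattice a (R $ i $ j)) \<and> Y_mat ** C = C ** R"
    "\<exists>R. (\<forall>i j. in_lattice a (R $ i $ j)) \<and> Z_mat ** C = C ** R"
    "\<exists>R. (\<forall>i j. in_lattice a (R $ i $ j)) \<and> dagger Y_mat ** C = C ** R"
    by (rule lattice_witness[OF C(1)] lattice_witness[OF C(2)] lattice_witness[OF C(3)];
        simp add: forall_3 in_lattice_intros)+
  have Im: "Im a \<noteq> 0"
    using \<xi>7_identities(4) by (simp add: a_def z_def)
  show ?thesis
    unfolding Sigma168_def
  proof (rule finite_generate_lattice[OF _ Im lat det])
    show "{Y_mat, Z_mat} \<subseteq> carrier SU3"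
      by (simp add: Y_mat_SU3 Z_mat_SU3)
    fix h assume "h \<in> {Y_mat, Z_mat}"
    then have h: "h = Y_mat \<or> h = Z_mat" by blast
    from h show "\<exists>R. (\<forall>i j. in_lattice a (R $ i $ j)) \<and> h ** C = C ** R"
      by (elim disjE) (simp_all only: ex)
    from h show "\<exists>R. (\<forall>i j. in_lattice a (R $ i $ j)) \<and> dagger h ** C = C ** R"
      by (elim disjE) (simp_all only: ex Z(2))
  qed
qed

text \<open>The exponents 1, 2, 4 form a perfect difference set modulo 7, so a sum of two of them
  determines both.\<close>

lemma \<xi>7_products_distinct:
  fixes y :: "complex^3"
  defines "y \<equiv> vector [\<xi> 7, \<xi> 7 ^ 2, \<xi> 7 ^ 4]"
  assumes "y $ a * y $ b = y $ c * y $ d"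
  shows "(a = c \<and> b = d) \<or> (a = d \<and> b = c)"
proof -
  define e where "e i = (if i = 1 then 1 else if i = 2 then 2 else 4 :: nat)" for i :: 3
  have "y $ i = \<xi> 7 ^ e i" for i
    using exhaust_3[of i] by (auto simp: y_def e_def)
  then have "\<xi> 7 ^ (e a + e b) = \<xi> 7 ^ (e c + e d)"
    using assms(2) by (simp add: power_add)
  then have "(e a + e b) mod 7 = (e c + e d) mod 7"
    by (simp add: \<xi>_power_eq_iff)
  moreover have "\<forall>a b c d. (e a + e b) mod 7 = (e c + e d) mod 7 \<longrightarrow> (a = c \<and> b = d) \<or> (a = d \<and> b = c)"
    unfolding forall_3 by (simp add: e_def)
  ultimately show ?thesis by blast
qed

lemma Z_mat_nonzero: "Z_mat $ i $ j \<noteq> 0"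
proof -
  have "\<i> / of_real (sqrt 7) \<noteq> (0 :: complex)"
    by simp
  moreover have "\<xi> 7 ^ 4 \<noteq> \<xi> 7 ^ 3" "\<xi> 7 ^ 2 \<noteq> \<xi> 7 ^ 5" "\<xi> 7 \<noteq> \<xi> 7 ^ 6"
    using \<xi>_power_eq_iff[of 7 4 3] \<xi>_power_eq_iff[of 7 2 5] \<xi>_power_eq_iff[of 7 1 6] by simp_all
  ultimately have "\<forall>i j. Z_mat $ i $ j \<noteq> 0"
    unfolding forall_3 Z_mat_def by (simp add: map_matrix_mat3)
  then show ?thesis by blast
qed

section \<open>Averages over the finite group\<close>

lemma swap_commutant_Sigma168: "swap_commutant {Y_mat, Z_mat}"
  unfolding Y_mat_diag3
  by (rule swap_commutant_diag[OF \<xi>7_products_distinct Z_mat_nonzero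
        SU3_minor_nonzero[OF Z_mat_SU3 Z_mat_nonzero]])

lemma swap_commutant_Sigma72x3: "swap_commutant {V_mat, X_mat}"
  by (rule swap_commutant_heisenberg[OF \<xi>3_identities(1) _ V_mat_def X_mat_def Sigma72x3_words]) simp

lemma swap_commutant_mono: "swap_commutant H \<Longrightarrow> H \<subseteq> G \<Longrightarrow> swap_commutant G"
  unfolding swap_commutant_def by blast

section \<open>Tensor products, traces against the swap, and twirling on two factors\<close>

definition kron :: "complex^'n^'n \<Rightarrow> complex^'n^'n \<Rightarrow> complex^('n \<times> 'n)^('n \<times> 'n)" where
  "kron A B = (\<chi> p q. A $ fst p $ fst q * B $ snd p $ snd q)"

lemma kron_nth [simp]: "kron A B $ (a, b) $ (c, d) = A $ a $ c * B $ b $ d"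
  by (simp add: kron_def)

lemma kron_mult: "kron A B ** kron C D = kron (A ** C) (B ** D)"
  by (simp add: vec_eq_iff matrix_matrix_mult_def sum_UNIV_prod sum_product mult_ac)

lemma kron_dagger: "dagger (kron A B) = kron (dagger A) (dagger B)"
  by (simp add: vec_eq_iff)

lemma kron2_eq_kron: "kron2 g = kron g g"
  by (simp add: vec_eq_iff)

lemma trace_swap_form: "trace (swap_form \<alpha> \<beta> :: complex^(3 \<times> 3)^(3 \<times> 3)) = 9 * \<alpha> + 3 * \<beta>"
  by (simp add: trace_def sum_UNIV_prod sum_3)

lemma swap_form_mult_swap: "swap_form \<alpha> \<beta> ** swap_form 0 1 = swap_form \<beta> \<alpha>"
proof -
  have "p = prod.swap q \<longleftrightarrow> q = prod.swap p" for p q :: "'a \<times> 'a"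
    by (cases p; cases q) auto
  then have "(swap_form \<alpha> \<beta> ** swap_form 0 1) $ p $ q = swap_form \<alpha> \<beta> $ p $ prod.swap q" for p q :: "'a \<times> 'a"
    by (simp add: matrix_matrix_mult_def swap_form_def[of 0] if_distrib[of "(*) _"] cong: if_cong)
  then show ?thesis
    by (auto simp: vec_eq_iff)
qed

text \<open>The swap trick, which turns a pairing on the tensor square into a trace on one
  factor.\<close>

lemma trace_kron_swap: "trace (kron A B ** swap_form 0 1) = trace (A ** B)"
proof -
  have "p = prod.swap q \<longleftrightarrow> q = prod.swap p" for p q :: "'a \<times> 'a"
    by (cases p; cases q) auto
  then have "(kron A B ** swap_form 0 1) $ p $ q = kron A B $ p $ prod.swap q" for p q
    by (simp add: matrix_matrix_mult_def swap_form_def[of 0] if_distrib[of "(*) _"] cong: if_cong)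
  then show ?thesis
    by (simp add: trace_def matrix_matrix_mult_def sum_UNIV_prod)
qed

lemma trace_kron: "trace (kron A B) = trace A * trace B"
  by (simp add: trace_def sum_UNIV_prod sum_product)

text \<open>Everything the remaining argument needs to know about the two groups.\<close>

locale swap_design =
  fixes G :: "(complex^3^3) set"
  assumes subgroup: "subgroup G SU3" and finite_G: "finite G" and commutant: "swap_commutant G"
begin

lemma SU3: "g \<in> G \<Longrightarrow> g \<in> carrier SU3"
  using subgroup.subset[OF subgroup] by blast

lemma mult_closed: "g \<in> G \<Longrightarrow> h \<in> G \<Longrightarrow> g ** h \<in> G"
  using subgroup.m_closed[OF subgroup, of g h] by simp

lemma dagger_closed: "g \<in> G \<Longrightarrow> dagger g \<in> G"
  using subgroup.m_inv_closed[OF subgroup, of g] SU3_inv[OF SU3] by simp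

lemma one_closed: "mat 1 \<in> G"
  using subgroup.one_closed[OF subgroup] by simp

lemma card_G_pos: "card G > 0"
  using one_closed finite_G card_gt_0_iff by blast

lemma bij_betw_mult:
  assumes "h \<in> G" shows "bij_betw ((**) h) G G"
proof (rule bij_betw_byWitness[where f' = "(**) (dagger h)"])
  show "\<forall>g\<in>G. dagger h ** (h ** g) = g" "\<forall>g\<in>G. h ** (dagger h ** g) = g"
    by (simp_all add: matrix_mul_assoc SU3_dagger_mult SU3_mult_dagger SU3 assms)
qed (use assms mult_closed dagger_closed in auto)

lemma bij_betw_dagger: "bij_betw dagger G G"
  by (rule bij_betw_byWitness[where f' = dagger]) (use dagger_closed in auto)

lemma kron2_unitary:
  assumes "g \<in> carrier SU3"
  shows "kron2 g ** dagger (kron2 g) = mat 1" "dagger (kron2 g) ** kron2 g = mat 1"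
  using assms by (simp_all add: kron2_mult[symmetric] kron2_dagger[symmetric] SU3_mult_dagger
      SU3_dagger_mult kron2_mat_1)

lemma conj_swap_form:
  assumes "g \<in> carrier SU3"
  shows "kron2 g ** swap_form \<alpha> \<beta> ** dagger (kron2 g) = swap_form \<alpha> \<beta>"
  unfolding swap_form_commute
  by (simp add: matrix_mul_assoc[symmetric] kron2_unitary[OF assms])

text \<open>Unnormalized, with the dagger on the right, whereas \<open>twirl\<close> has it on the
  left. Over a group both orders give the same sum, and this one turns conjugation by h into left
  translation.\<close>

definition average2 :: "complex^(3 \<times> 3)^(3 \<times> 3) \<Rightarrow> complex^(3 \<times> 3)^(3 \<times> 3)" where
  "average2 B = (\<Sum>g\<in>G. kron2 g ** B ** dagger (kron2 g))"

lemma average2_conj: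
  "kron2 h ** average2 B ** dagger (kron2 h) = (\<Sum>g\<in>G. kron2 (h ** g) ** B ** dagger (kron2 (h ** g)))"
  unfolding average2_def matrix_mult_sum_right matrix_mult_sum_left
  by (simp add: kron2_mult dagger_mult matrix_mul_assoc)

lemma average2_swap_form: obtains \<alpha> \<beta> where "average2 B = swap_form \<alpha> \<beta>"
proof -
  have "kron2 h ** average2 B = average2 B ** kron2 h" if h: "h \<in> G" for h
  proof -
    have "kron2 h ** average2 B ** dagger (kron2 h) = average2 B"
      unfolding average2_conj unfolding average2_def
      by (rule sum.reindex_bij_betw[OF bij_betw_mult[OF h]])
    then have "kron2 h ** average2 B ** (dagger (kron2 h) ** kron2 h) = average2 B ** kron2 h"
      by (simp add: matrix_mul_assoc)
    then show ?thesis
      by (simp add: kron2_unitary[OF SU3[OF h]])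
  qed
  then show ?thesis
    using commutant that unfolding swap_commutant_def by blast
qed

lemma trace_average2: "trace (average2 B) = of_nat (card G) * trace B"
  and trace_average2_swap: "trace (average2 B ** swap_form 0 1) = of_nat (card G) * trace (B ** swap_form 0 1)"
proof -
  have conj: "trace (kron2 g ** B ** dagger (kron2 g)) = trace B" if "g \<in> G" for g B
    using trace_mul_sym[of "kron2 g ** B" "dagger (kron2 g)"]
    by (simp add: matrix_mul_assoc kron2_unitary[OF SU3[OF that]])
  show "trace (average2 B) = of_nat (card G) * trace B"
    by (simp add: average2_def trace_sum conj)
  have "average2 B ** swap_form 0 1 = average2 (B ** swap_form 0 1)"
    unfolding average2_def matrix_mult_sum_left
  proof (rule sum.cong[OF refl])
    fix g assume "g \<in> G"
    have "dagger (kron2 g) ** swap_form 0 1 = swap_form 0 1 ** dagger (kron2 g)"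
      unfolding kron2_dagger[symmetric] by (rule swap_form_commute)
    then show "kron2 g ** B ** dagger (kron2 g) ** swap_form 0 1 = kron2 g ** (B ** swap_form 0 1) ** dagger (kron2 g)"
      by (simp add: matrix_mul_assoc[symmetric])
  qed
  then show "trace (average2 B ** swap_form 0 1) = of_nat (card G) * trace (B ** swap_form 0 1)"
    by (simp add: average2_def trace_sum conj)
qed

lemma average2_zero:
  assumes "trace B = 0" "trace (B ** swap_form 0 1) = 0"
  shows "average2 B = 0"
proof -
  obtain \<alpha> \<beta> where eq: "average2 B = swap_form \<alpha> \<beta>"
    by (rule average2_swap_form)
  \<comment> \<open>On the tensor square of C^3 the identity has trace 9 and the swap trace 3;
    multiplying by the swap exchanges \<alpha> and \<beta>. The system has determinant 72.\<close>
  have "9 * \<alpha> + 3 * \<beta> = 0" "9 * \<beta> + 3 * \<alpha> = 0"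
    using trace_average2[of B] trace_average2_swap[of B]
    unfolding eq swap_form_mult_swap trace_swap_form assms by simp_all
  then have "\<alpha> = 0" "\<beta> = 0"
    by algebra+
  then show ?thesis
    by (simp add: eq vec_eq_iff)
qed

text \<open>Tensoring with an idle second factor reduces the one-body average to the two-body one: a
  combination of identity and swap of the form \<open>kron S (mat 1)\<close> has scalar
  \<open>S\<close>, and the trace makes the scalar 0.\<close>

lemma sum_conj_traceless:
  assumes "trace A = 0"
  shows "(\<Sum>g\<in>G. dagger g ** A ** g) = 0"
proof -
  define S where "S = (\<Sum>g\<in>G. g ** A ** dagger g)"
  obtain \<alpha> \<beta> where eq: "average2 (kron A (mat 1)) = swap_form \<alpha> \<beta>"
    by (rule average2_swap_form)
  have "average2 (kron A (mat 1)) = (\<Sum>g\<in>G. kron (g ** A ** dagger g) (mat 1))"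
    unfolding average2_def kron2_eq_kron kron_dagger kron_mult
    by (intro sum.cong refl) (simp add: SU3_mult_dagger SU3)
  also have "\<dots> = kron S (mat 1)"
    by (simp add: vec_eq_iff S_def sum_distrib_right)
  finally have "kron S (mat 1) = swap_form \<alpha> \<beta>"
    using eq by simp
  then have entry: "S $ a $ c * mat 1 $ b $ d = swap_form \<alpha> \<beta> $ (a, b) $ (c, d)" for a b c d
    by (metis kron_nth)
  have "S $ a $ c = (if a = c then \<alpha> else 0)" for a c
  proof -
    \<comment> \<open>For such b the swap does not contribute to the entry at (a, b), (c, b); in
      dimension 3 there is always one.\<close>
    have "\<exists>b. b \<noteq> a \<and> b \<noteq> c"
      using exhaust_3[of a] exhaust_3[of c] by (elim disjE) (auto intro: exI[of _ 1] exI[of _ 2] exI[of _ 3])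
    then obtain b where "b \<noteq> a" "b \<noteq> c" by blast
    then show ?thesis
      using entry[of a c b b] by (auto simp: mat_def)
  qed
  then have S: "S = mat \<alpha>"
    by (simp add: vec_eq_iff mat_def)
  have "trace S = (\<Sum>g\<in>G. trace A)"
    unfolding S_def trace_sum
  proof (rule sum.cong[OF refl])
    fix g assume "g \<in> G"
    then show "trace (g ** A ** dagger g) = trace A"
      using trace_mul_sym[of "g ** A" "dagger g"] by (simp add: matrix_mul_assoc SU3_dagger_mult SU3)
  qed
  then have "trace S = 0"
    by (simp only: assms sum.neutral_const)
  then have "\<alpha> = 0"
    by (simp add: S trace_def mat_def)
  then have "S = 0"
    using S by simp
  moreover have "S = (\<Sum>g\<in>G. dagger g ** A ** g)"
    unfolding S_def by (subst sum.reindex_bij_betw[OF bij_betw_dagger, symmetric]) simp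
  ultimately show ?thesis by simp
qed

lemma sum_conj_kron_zero:
  assumes "trace B = 0" "trace (B ** swap_form 0 1) = 0"
  shows "(\<Sum>g\<in>G. dagger (kron2 g) ** B ** kron2 g) = 0"
proof -
  have "average2 B = (\<Sum>g\<in>G. dagger (kron2 g) ** B ** kron2 g)"
    unfolding average2_def
    by (subst sum.reindex_bij_betw[OF bij_betw_dagger, symmetric]) (simp add: kron2_dagger)
  then show ?thesis
    using average2_zero[OF assms] by simp
qed

end

lemma swap_design_Sigma:
  assumes "\<G> = Sigma168 \<or> \<G> = Sigma72x3"
  shows "swap_design \<G>"
  using assms
proof
  assume G: "\<G> = Sigma168"
  show ?thesis
  proof (rule swap_design.intro)
    show "subgroup \<G> SU3"
      unfolding G Sigma168_def
      by (rule group.generate_is_subgroup[OF group_SU3]) (simp add: Y_mat_SU3 Z_mat_SU3)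
    show "swap_commutant \<G>"
      unfolding G Sigma168_def
      by (rule swap_commutant_mono[OF swap_commutant_Sigma168]) (auto intro: generate.incl)
  qed (simp add: G finite_Sigma168)
next
  assume G: "\<G> = Sigma72x3"
  show ?thesis
  proof (rule swap_design.intro)
    show "subgroup \<G> SU3"
      unfolding G Sigma72x3_def
      by (rule group.generate_is_subgroup[OF group_SU3]) (simp add: V_mat_SU3 X_mat_SU3)
    show "swap_commutant \<G>"
      unfolding G Sigma72x3_def
      by (rule swap_commutant_mono[OF swap_commutant_Sigma72x3]) (auto intro: generate.incl)
  qed (simp add: G finite_Sigma72x3)
qed

section \<open>Operators on N qutrits\<close>

lemma prod_UNIV_sum:
  fixes f :: "'q::finite \<Rightarrow> 'a::finite \<Rightarrow> 'c::comm_semiring_1"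
  shows "(\<Prod>k\<in>UNIV. \<Sum>u\<in>UNIV. f k u) = (\<Sum>r\<in>UNIV. \<Prod>k\<in>UNIV. f k (r k))"
  using prod_sum_PiE[of UNIV "\<lambda>_. UNIV" f] by (simp add: PiE_UNIV_domain)

lemma tensor_op_mult: "tensor_op A ** tensor_op B = tensor_op (\<lambda>k. A k ** B k)"
  by (simp add: vec_eq_iff tensor_op_def matrix_matrix_mult_def prod_UNIV_sum prod.distrib)

lemma dagger_tensor_op: "dagger (tensor_op A) = tensor_op (\<lambda>k. dagger (A k))"
  by (simp add: vec_eq_iff tensor_op_def)

lemma conj_global_pulse:
  "dagger (global_pulse g) ** tensor_op A ** global_pulse g = tensor_op (\<lambda>k. dagger g ** A k ** g)"
  by (simp add: global_pulse_def dagger_tensor_op tensor_op_mult)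

lemma on_qutrit_nth:
  "on_qutrit i A $ s $ t = A $ s i $ t i * (\<Prod>k\<in>UNIV - {i}. mat 1 $ s k $ t k)"
  by (simp add: on_qutrit_def tensor_op_def prod.remove[of UNIV i])

text \<open>The idle qutrits contribute only a product of Kronecker deltas, unaffected by the
  pulses. This reduces the twirl for every N to an average on two tensor factors.\<close>

lemma on_qutrit_mult_nth:
  assumes "i \<noteq> j"
  shows "(on_qutrit i A ** on_qutrit j B) $ s $ t =
    A $ s i $ t i * B $ s j $ t j * (\<Prod>k\<in>UNIV - {i} - {j}. mat 1 $ s k $ t k)"
proof -
  have "(on_qutrit i A ** on_qutrit j B) $ s $ t =
      (\<Prod>k\<in>UNIV. (if k = i then A else if k = j then B else mat 1) $ s k $ t k)"
    unfolding on_qutrit_def tensor_op_mult by (auto simp: tensor_op_def assms intro!: prod.cong)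
  also have "\<dots> = A $ s i $ t i * (\<Prod>k\<in>UNIV - {i}. (if k = i then A else if k = j then B else mat 1) $ s k $ t k)"
    by (simp add: prod.remove[of UNIV i])
  also have "\<dots> = A $ s i $ t i * (B $ s j $ t j *
      (\<Prod>k\<in>UNIV - {i} - {j}. (if k = i then A else if k = j then B else mat 1) $ s k $ t k))"
    using assms by (subst prod.remove[of "UNIV - {i}" j]) auto
  also have "(\<Prod>k\<in>UNIV - {i} - {j}. (if k = i then A else if k = j then B else mat 1) $ s k $ t k) =
      (\<Prod>k\<in>UNIV - {i} - {j}. mat 1 $ s k $ t k)"
    by (rule prod.cong) auto
  finally show ?thesis
    by (simp add: mult.assoc)
qed

lemma conj_on_qutrit:
  assumes "g \<in> carrier SU3"
  shows "dagger (global_pulse g) ** on_qutrit i A ** global_pulse g = on_qutrit i (dagger g ** A ** g)"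
  unfolding on_qutrit_def conj_global_pulse
  by (rule arg_cong[where f = tensor_op]) (auto simp: SU3_dagger_mult[OF assms])

lemma conj_on_qutrit_mult:
  assumes g: "g \<in> carrier SU3"
  shows "dagger (global_pulse g) ** (on_qutrit i A ** on_qutrit j B) ** global_pulse g =
    on_qutrit i (dagger g ** A ** g) ** on_qutrit j (dagger g ** B ** g)"
proof -
  have "global_pulse g ** dagger (global_pulse g) = (mat 1 :: 'a operator)"
  proof -
    have "global_pulse g ** dagger (global_pulse g) = (tensor_op (\<lambda>k. mat 1) :: 'a operator)"
      by (simp add: global_pulse_def dagger_tensor_op tensor_op_mult SU3_mult_dagger[OF g])
    also have "\<dots> = mat 1"
      by (auto simp: vec_eq_iff tensor_op_def mat_def fun_eq_iff)
    finally show ?thesis .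
  qed
  then have "on_qutrit i A ** on_qutrit j B =
      on_qutrit i A ** (global_pulse g ** dagger (global_pulse g)) ** on_qutrit j B"
    by simp
  then show ?thesis
    unfolding conj_on_qutrit[OF g, symmetric] by (simp only: matrix_mul_assoc)
qed

section \<open>Gell-Mann matrices and decoupling\<close>

lemma exhaust_8:
  fixes x :: 8
  shows "x = 1 \<or> x = 2 \<or> x = 3 \<or> x = 4 \<or> x = 5 \<or> x = 6 \<or> x = 7 \<or> x = 8"
proof (induct x)
  case (of_int z)
  then have "0 \<le> z" and "z < 8" by simp_all
  \<comment> \<open>In the type \<open>8\<close> the numeral 8 equals 0, so the case z = 0 is the
    index 8.\<close>
  then have "z = 0 \<or> z = 1 \<or> z = 2 \<or> z = 3 \<or> z = 4 \<or> z = 5 \<or> z = 6 \<or> z = 7" by arith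
  then show ?case by auto
qed

lemma forall_8: "(\<forall>i::8. P i) \<longleftrightarrow> P 1 \<and> P 2 \<and> P 3 \<and> P 4 \<and> P 5 \<and> P 6 \<and> P 7 \<and> P 8"
  by (metis exhaust_8)

lemma gell_mann_simps:
  "gell_mann 1 = mat3 [[0, 1, 0], [1, 0, 0], [0, 0, 0]]"
  "gell_mann 2 = mat3 [[0, - \<i>, 0], [\<i>, 0, 0], [0, 0, 0]]"
  "gell_mann 3 = mat3 [[1, 0, 0], [0, - 1, 0], [0, 0, 0]]"
  "gell_mann 4 = mat3 [[0, 0, 1], [0, 0, 0], [1, 0, 0]]"
  "gell_mann 5 = mat3 [[0, 0, - \<i>], [0, 0, 0], [\<i>, 0, 0]]"
  "gell_mann 6 = mat3 [[0, 0, 0], [0, 0, 1], [0, 1, 0]]"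
  "gell_mann 7 = mat3 [[0, 0, 0], [0, 0, - \<i>], [0, \<i>, 0]]"
  "gell_mann 8 = mat3 [[1 / of_real (sqrt 3), 0, 0], [0, 1 / of_real (sqrt 3), 0], [0, 0, - 2 / of_real (sqrt 3)]]"
  by (simp_all add: gell_mann_def map_matrix_mat3)

lemma trace_mat3: "trace (mat3 [[a, b, c], [d, e, f], [g, h, i]]) = a + e + i"
  by (simp add: trace_def sum_3)

lemma trace_gell_mann: "trace (gell_mann a) = 0"
proof -
  have "\<forall>a. trace (gell_mann a) = 0"
    unfolding forall_8 gell_mann_simps trace_mat3 by (simp add: field_simps)
  then show ?thesis by blast
qed

lemma trace_gell_mann_mult: "trace (gell_mann a ** gell_mann b) = (if a = b then 2 else 0)"
proof -
  have "complex_of_real (sqrt 3) * complex_of_real (sqrt 3) = 3"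
    by (simp flip: of_real_mult)
  then have "\<forall>a b. trace (gell_mann a ** gell_mann b) = (if a = b then 2 else 0)"
    unfolding forall_8 gell_mann_simps mat3_mult trace_mat3 by (simp add: field_simps)
  then show ?thesis by blast
qed

context swap_design
begin

lemma twirl_nth:
  "twirl G S $ s $ t = (1 / real (card G)) *\<^sub>R (\<Sum>g\<in>G. (dagger (global_pulse g) ** S ** global_pulse g) $ s $ t)"
  by (simp add: twirl_def)

lemma twirl_one_body:
  fixes i :: "'q::finite"
  shows "twirl G (\<Sum>a\<in>UNIV. n $ a *\<^sub>R on_qutrit i (gell_mann a)) = 0"
proof -
  define A where "A = (\<Sum>a\<in>UNIV. n $ a *\<^sub>R gell_mann a)"
  have A: "(\<Sum>a\<in>UNIV. n $ a *\<^sub>R on_qutrit i (gell_mann a)) = on_qutrit i A"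
    by (simp add: vec_eq_iff on_qutrit_nth A_def sum_distrib_right)
  have "trace A = 0"
    by (simp add: A_def trace_sum trace_scaleR trace_gell_mann)
  have "twirl G (on_qutrit i A) $ s $ t = 0" for s t
  proof -
    have "(\<Sum>g\<in>G. (dagger (global_pulse g) ** on_qutrit i A ** global_pulse g) $ s $ t) =
        (\<Sum>g\<in>G. (dagger g ** A ** g) $ s i $ t i * (\<Prod>k\<in>UNIV - {i}. mat 1 $ s k $ t k))"
      by (rule sum.cong[OF refl]) (simp add: conj_on_qutrit[OF SU3] on_qutrit_nth)
    also have "\<dots> = (\<Sum>g\<in>G. dagger g ** A ** g) $ s i $ t i * (\<Prod>k\<in>UNIV - {i}. mat 1 $ s k $ t k)"
      by (simp add: sum_distrib_right)
    finally show ?thesis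
      by (simp add: twirl_nth sum_conj_traceless[OF \<open>trace A = 0\<close>])
  qed
  then show ?thesis
    unfolding A by (simp add: vec_eq_iff)
qed

text \<open>The two-site operator is traceless because the Gell-Mann matrices are, and its trace
  against the swap is twice the trace of \<open>M\<close> by their orthogonality. This is where
  \<open>trace M = 0\<close> enters.\<close>

lemma twirl_two_body:
  fixes i j :: "'q::finite" and M :: "real^8^8"
  assumes "i \<noteq> j" and M: "trace M = 0"
  shows "twirl G (\<Sum>a\<in>UNIV. \<Sum>b\<in>UNIV.
    M $ a $ b *\<^sub>R (on_qutrit i (gell_mann a) ** on_qutrit j (gell_mann b))) = 0" (is "twirl G ?S = 0")
proof -
  define B where "B = (\<Sum>a\<in>UNIV. \<Sum>b\<in>UNIV. M $ a $ b *\<^sub>R kron (gell_mann a) (gell_mann b))"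
  have "trace B = 0"
    by (simp add: B_def trace_sum trace_scaleR trace_kron trace_gell_mann)
  moreover have "trace (B ** swap_form 0 1) = (\<Sum>a\<in>UNIV. \<Sum>b\<in>UNIV. M $ a $ b *\<^sub>R (if a = b then 2 else 0))"
    by (simp add: B_def matrix_mult_sum_left trace_sum matrix_mult_scaleR_left trace_scaleR
        trace_kron_swap trace_gell_mann_mult)
  then have "trace (B ** swap_form 0 1) = 0"
    using M by (simp add: if_distrib[of "\<lambda>x. _ *\<^sub>R x"] trace_def scaleR_left.sum[symmetric] cong: if_cong)
  ultimately have zero: "(\<Sum>g\<in>G. dagger (kron2 g) ** B ** kron2 g) = 0"
    by (rule sum_conj_kron_zero)
  have "twirl G ?S $ s $ t = 0" for s t
  proof -
    define r where "r = (\<Prod>k\<in>UNIV - {i} - {j}. mat 1 $ s k $ t k :: complex)"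
    have "(dagger (global_pulse g) ** ?S ** global_pulse g) $ s $ t =
        (dagger (kron2 g) ** B ** kron2 g) $ (s i, s j) $ (t i, t j) * r" if "g \<in> G" for g
    proof -
      have "dagger (global_pulse g) ** ?S ** global_pulse g = (\<Sum>a\<in>UNIV. \<Sum>b\<in>UNIV. M $ a $ b *\<^sub>R
          (dagger (global_pulse g) ** (on_qutrit i (gell_mann a) ** on_qutrit j (gell_mann b)) ** global_pulse g))"
        by (simp only: matrix_mult_sum_left matrix_mult_sum_right matrix_mult_scaleR_left matrix_mult_scaleR_right)
      also have "\<dots> $ s $ t = (\<Sum>a\<in>UNIV. \<Sum>b\<in>UNIV. M $ a $ b *\<^sub>R
          (kron (dagger g ** gell_mann a ** g) (dagger g ** gell_mann b ** g) $ (s i, s j) $ (t i, t j) * r))"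
        by (simp add: conj_on_qutrit_mult[OF SU3[OF that]] on_qutrit_mult_nth[OF \<open>i \<noteq> j\<close>] r_def)
      also have "\<dots> = (\<Sum>a\<in>UNIV. \<Sum>b\<in>UNIV. M $ a $ b *\<^sub>R
          kron (dagger g ** gell_mann a ** g) (dagger g ** gell_mann b ** g)) $ (s i, s j) $ (t i, t j) * r"
        by (simp add: sum_distrib_right)
      also have "(\<Sum>a\<in>UNIV. \<Sum>b\<in>UNIV. M $ a $ b *\<^sub>R
          kron (dagger g ** gell_mann a ** g) (dagger g ** gell_mann b ** g)) = dagger (kron2 g) ** B ** kron2 g"
        unfolding B_def kron2_eq_kron kron_dagger
        by (simp only: matrix_mult_sum_left matrix_mult_sum_right matrix_mult_scaleR_left
            matrix_mult_scaleR_right kron_mult)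
      finally show ?thesis .
    qed
    then have "(\<Sum>g\<in>G. (dagger (global_pulse g) ** ?S ** global_pulse g) $ s $ t) =
        (\<Sum>g\<in>G. dagger (kron2 g) ** B ** kron2 g) $ (s i, s j) $ (t i, t j) * r"
      by (simp add: sum_distrib_right)
    then show ?thesis
      by (simp add: twirl_nth zero)
  qed
  then show ?thesis
    by (simp add: vec_eq_iff)
qed

end

section \<open>Diagonalization in SU(3)\<close>

text \<open>The vector p(A) w, evaluated by Horner's scheme.\<close>

definition poly_apply :: "'a::comm_ring_1^'n^'n \<Rightarrow> 'a^'n \<Rightarrow> 'a poly \<Rightarrow> 'a^'n" where
  "poly_apply A w p = fold_coeffs (\<lambda>a v. a *s w + A *v v) p 0"

lemma poly_apply_0 [simp]: "poly_apply A w 0 = 0"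
  by (simp add: poly_apply_def)

lemma poly_apply_pCons [simp]: "poly_apply A w (pCons a p) = a *s w + A *v poly_apply A w p"
  by (cases "p = 0"; cases "a = 0") (simp_all add: poly_apply_def)

lemma poly_apply_add: "poly_apply A w (p + q) = poly_apply A w p + poly_apply A w q"
  by (induction p q rule: poly_induct2)
    (simp_all add: vector_sadd_rdistrib matrix_vector_right_distrib)

lemma poly_apply_smult: "poly_apply A w (smult c p) = c *s poly_apply A w p"
  by (induction p) (simp_all add: vector_add_ldistrib vector_smult_assoc matrix_vector_mult_smult)

lemma poly_apply_sum: "poly_apply A w (sum f S) = (\<Sum>i\<in>S. poly_apply A w (f i))"
  by (induction S rule: infinite_finite_induct) (simp_all add: poly_apply_add)

lemma poly_apply_in_subspace:
  assumes "vec.subspace W" "w \<in> W" "\<And>v. v \<in> W \<Longrightarrow> A *v v \<in> W"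
  shows "poly_apply A w p \<in> W"
  by (induction p) (use assms in \<open>auto intro: vec.subspace_add vec.subspace_scale vec.subspace_0\<close>)

text \<open>Otherwise the n + 1 vectors w, A w, ..., A^n w would be independent in dimension
  n.\<close>

lemma annihilating_poly_exists:
  fixes A :: "'a::field^'n^'n"
  shows "\<exists>p. p \<noteq> 0 \<and> poly_apply A w p = 0"
proof (rule ccontr)
  assume "\<not> ?thesis"
  then have inj: "p = 0" if "poly_apply A w p = 0" for p
    using that by blast
  define v where "v i = poly_apply A w (monom 1 i)" for i
  have "inj v"
  proof (rule injI)
    fix i j assume "v i = v j"
    then have "poly_apply A w (monom 1 i + smult (- 1) (monom 1 j)) = 0"
      unfolding poly_apply_add poly_apply_smult v_def by simp
    from inj[OF this] show "i = j"
      by (metis coeff_monom add_diff_cancel_right' diff_0 eq_neg_iff_add_eq_0 one_neq_zero smult_1_left smult_minus_left minus_minus neg_eq_iff_add_eq_0)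
  qed
  let ?S = "v ` {..CARD('n)}"
  have "vec.independent ?S"
    unfolding vec.independent_explicit
  proof (intro conjI allI impI ballI)
    fix u x assume zero: "(\<Sum>x\<in>?S. u x *s x) = 0" and x: "x \<in> ?S"
    have "poly_apply A w (\<Sum>i\<le>CARD('n). smult (u (v i)) (monom 1 i)) = (\<Sum>i\<le>CARD('n). u (v i) *s v i)"
      by (simp add: poly_apply_sum poly_apply_smult v_def)
    also have "\<dots> = (\<Sum>x\<in>?S. u x *s x)"
      using \<open>inj v\<close> by (subst sum.reindex) (auto intro: inj_on_subset)
    finally have "(\<Sum>i\<le>CARD('n). smult (u (v i)) (monom 1 i)) = 0"
      using inj zero by simp
    then have "coeff (\<Sum>i\<le>CARD('n). smult (u (v i)) (monom 1 i)) j = 0" for j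
      by simp
    then have "(\<Sum>i\<le>CARD('n). u (v i) * (if i = j then 1 else 0)) = 0" for j
      by (simp add: coeff_sum)
    then have "(if j \<le> CARD('n) then u (v j) else 0) = 0" for j
      by (simp add: if_distrib[of "(*) _"] cong: if_cong)
    then have "u (v j) = 0" if "j \<le> CARD('n)" for j
      using that by presburger
    with x show "u x = 0" by auto
  qed simp
  then have "card ?S \<le> CARD('n)"
    using vec.independent_card_le_dim[of ?S UNIV] vec_dim_card by (metis subset_UNIV)
  moreover have "card ?S = Suc (CARD('n))"
    using \<open>inj v\<close> by (subst card_image) (auto intro: inj_on_subset)
  ultimately show False by simp
qed

text \<open>If p has least degree among the nonzero polynomials with p(A) w = 0 and c is a root,
  then p / (x - c) applied to w is nonzero and is an eigenvector for c.\<close>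

lemma eigenvector_in_subspace:
  fixes A :: "complex^'n^'n"
  assumes W: "vec.subspace W" "w \<in> W" "w \<noteq> 0" and inv: "\<And>v. v \<in> W \<Longrightarrow> A *v v \<in> W"
  obtains v c where "v \<in> W" "v \<noteq> 0" "A *v v = c *s v"
proof -
  define P where "P p \<longleftrightarrow> p \<noteq> 0 \<and> poly_apply A w p = 0" for p
  obtain p where p: "P p" and min: "\<And>q. P q \<Longrightarrow> degree p \<le> degree q"
    using annihilating_poly_exists[of A w] ex_has_least_nat[of P _ degree] unfolding P_def by metis
  have "degree p \<noteq> 0"
  proof
    assume "degree p = 0"
    then obtain a where "p = [:a:]" by (rule degree_eq_zeroE)
    then show False
      using p \<open>w \<noteq> 0\<close> by (auto simp: P_def)
  qed
  then have "\<not> constant (poly p)"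
    by (simp add: constant_degree)
  then obtain c where "poly p c = 0"
    using fundamental_theorem_of_algebra by blast
  then obtain q where q: "p = [:- c, 1:] * q"
    by (metis dvdE poly_eq_0_iff_dvd)
  then have "q \<noteq> 0"
    using p by (auto simp: P_def)
  then have "degree q < degree p"
    unfolding q by (subst degree_mult_eq) auto
  then have "poly_apply A w q \<noteq> 0"
    using min[of q] \<open>q \<noteq> 0\<close> unfolding P_def by auto
  moreover have "p = smult (- c) q + pCons 0 q"
    unfolding q by simp
  then have "poly_apply A w p = (- c) *s poly_apply A w q + A *v poly_apply A w q"
    by (simp only: poly_apply_add poly_apply_smult poly_apply_pCons) simp
  then have "A *v poly_apply A w q = c *s poly_apply A w q"
    using p by (simp add: P_def vector_smult_lneg eq_neg_iff_add_eq_0 add.commute)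
  ultimately show ?thesis
    using that poly_apply_in_subspace[OF W(1,2) inv] by blast
qed

section \<open>The Hermitian inner product and unitary diagonalization\<close>

definition cinner :: "complex^'n \<Rightarrow> complex^'n \<Rightarrow> complex" where
  "cinner u v = (\<Sum>i\<in>UNIV. cnj (u $ i) * v $ i)"

lemma cinner_smult_right: "cinner u (c *s v) = c * cinner u v"
  and cinner_smult_left: "cinner (c *s u) v = cnj c * cinner u v"
  and cinner_add_right: "cinner u (v + w) = cinner u v + cinner u w"
  and cinner_0_right [simp]: "cinner u 0 = 0"
  and cinner_commute: "cinner v u = cnj (cinner u v)"
  by (simp_all add: cinner_def sum_distrib_left sum.distrib distrib_left mult_ac)

lemma cinner_self: "cinner v v = of_real ((norm v)\<^sup>2)"
  by (simp add: cinner_def norm_vec_def L2_set_def sum_nonneg complex_norm_square mult.commute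
      del: of_real_power)

lemma cinner_dagger: "cinner (dagger A *v u) v = cinner u (A *v v)"
  by (simp add: cinner_def matrix_vector_mult_def sum_distrib_left sum_distrib_right mult_ac)
    (rule sum.swap)

lemma cinner_unitary:
  assumes "dagger g ** g = mat 1"
  shows "cinner (g *v u) (g *v v) = cinner u v"
  by (simp add: cinner_dagger[of g, symmetric] matrix_vector_mul_assoc assms)

text \<open>A unitary matrix preserves the orthogonal complement of any set of its eigenvectors, so
  the next eigenvector can be found inside it.\<close>

lemma unitary_eigenvector_orthogonal:
  fixes g :: "complex^'n^'n"
  assumes g: "dagger g ** g = mat 1"
    and eig: "\<And>u. u \<in> S \<Longrightarrow> \<exists>c. g *v u = c *s u"
    and w: "w \<noteq> 0" "\<And>u. u \<in> S \<Longrightarrow> cinner u w = 0"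
  obtains v c where "cinner v v = 1" "\<And>u. u \<in> S \<Longrightarrow> cinner u v = 0" "g *v v = c *s v"
proof -
  let ?W = "{v. \<forall>u\<in>S. cinner u v = 0}"
  have W: "vec.subspace ?W"
    by (auto simp: vec.subspace_def cinner_add_right cinner_smult_right)
  have "g *v v \<in> ?W" if "v \<in> ?W" for v
  proof clarify
    fix u assume u: "u \<in> S"
    obtain c where c: "g *v u = c *s u"
      using eig[OF u] by blast
    have "cnj c * cinner u (g *v v) = 0"
      using cinner_unitary[OF g, of u v] that u by (simp add: c cinner_smult_left)
    \<comment> \<open>\<open>S\<close> may contain 0, for which c = 0 is a possible choice; as g is
      invertible, no other vector allows it.\<close>
    moreover have "u = 0" if "c = 0"
    proof -
      have "dagger g *v (g *v u) = 0"
        using that c by simp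
      then show ?thesis by (simp add: matrix_vector_mul_assoc g)
    qed
    ultimately show "cinner u (g *v v) = 0"
      by (auto simp: cinner_def)
  qed
  with W w obtain v c where v: "v \<in> ?W" "v \<noteq> 0" "g *v v = c *s v"
    by (elim eigenvector_in_subspace[of ?W w g]) auto
  let ?v = "complex_of_real (inverse (norm v)) *s v"
  have "cinner ?v ?v = 1"
    unfolding cinner_smult_left cinner_smult_right cinner_self[of v]
    using v(2) by (simp add: power2_eq_square field_simps)
  moreover have "cinner u ?v = 0" if "u \<in> S" for u
    using v(1) that by (simp add: cinner_smult_right)
  moreover have "g *v ?v = c *s ?v"
    by (simp add: matrix_vector_mult_smult v(3) vector_smult_assoc mult.commute)
  ultimately show ?thesis
    by (rule that)
qed

lemma orthogonal_vector_exists: "\<exists>w. w \<noteq> 0 \<and> cinner u w = 0 \<and> cinner v w = (0 :: complex)" for u v :: "complex^3"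
proof -
  define R :: "complex^3^3" where "R = (\<chi> i j. if i = 1 then cnj (u $ j) else if i = 2 then cnj (v $ j) else 0)"
  have "det R = 0"
    by (rule det_zero_row(1)[of 3]) (simp add: R_def row_def vec_eq_iff)
  then have "\<not> (\<exists>B. B ** R = mat 1)"
    by (metis det_mul det_I mult_zero_right zero_neq_one)
  then obtain w where w: "R *v w = 0" "w \<noteq> 0"
    unfolding matrix_left_invertible_ker by blast
  have "cinner u w = (R *v w) $ 1" "cinner v w = (R *v w) $ 2"
    by (simp_all add: cinner_def matrix_vector_mult_def R_def)
  with w show ?thesis by auto
qed

lemma det_diag3: "det (diag3 t) = t $ 1 * t $ 2 * t $ 3"
  by (simp add: det_3)

lemma SU3_diagonalization:
  assumes g: "g \<in> carrier SU3"
  obtains U t where "U \<in> carrier SU3" "diag3 t \<in> carrier SU3" "g = U ** diag3 t ** dagger U"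
proof -
  note gg = SU3_dagger_mult[OF g]
  obtain v1 c1 where v1: "cinner v1 v1 = 1" "g *v v1 = c1 *s v1"
    by (rule unitary_eigenvector_orthogonal[OF gg, of "{}" "axis 1 1"]) auto
  obtain w2 where w2: "w2 \<noteq> 0" "cinner v1 w2 = 0"
    using orthogonal_vector_exists[of v1 v1] by blast
  obtain v2 c2 where v2: "cinner v2 v2 = 1" "cinner v1 v2 = 0" "g *v v2 = c2 *s v2"
    using v1 w2 by (rule_tac unitary_eigenvector_orthogonal[OF gg, of "{v1}" w2]) auto
  obtain w3 where w3: "w3 \<noteq> 0" "cinner v1 w3 = 0" "cinner v2 w3 = 0"
    using orthogonal_vector_exists[of v1 v2] by blast
  obtain v3 c3 where v3: "cinner v3 v3 = 1" "cinner v1 v3 = 0" "cinner v2 v3 = 0" "g *v v3 = c3 *s v3"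
    using v1 v2 w3 by (rule_tac unitary_eigenvector_orthogonal[OF gg, of "{v1, v2}" w3]) auto
  define f where "f j = (if j = 1 then v1 else if j = 2 then v2 else v3)" for j :: 3
  define Q where "Q = (\<chi> i j. f j $ i)"
  define c where "c = (vector [c1, c2, c3] :: complex^3)"
  have orth: "\<forall>i j. cinner (f i) (f j) = (if i = j then 1 else 0)"
  proof -
    have "cinner v2 v1 = 0" "cinner v3 v1 = 0" "cinner v3 v2 = 0"
      using v2 v3 by (subst cinner_commute, simp)+
    with v1 v2 v3 show ?thesis
      unfolding forall_3 by (simp add: f_def)
  qed
  have QQ: "dagger Q ** Q = mat 1"
    using orth by (simp add: vec_eq_iff matrix_matrix_mult_def Q_def cinner_def mat_def)
  have "\<forall>j. g *v f j = c $ j *s f j"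
    unfolding forall_3 using v1 v2 v3 by (simp add: f_def c_def)
  then have gQ: "g ** Q = Q ** diag3 c"
    by (simp add: vec_eq_iff matrix_matrix_mult_def matrix_vector_mult_def Q_def mult.commute
        if_distrib[of "(*) _"] cong: if_cong)
  \<comment> \<open>Rescaling the third eigenvector by the phase 1 / det Q gives determinant 1 and
    keeps it an eigenvector.\<close>
  define s where "s = (vector [1, 1, inverse (det Q)] :: complex^3)"
  define U where "U = Q ** diag3 s"
  have "cnj (det Q) * det Q = 1"
    using arg_cong[OF QQ, of det] by (simp add: det_mul det_dagger)
  then have "of_real ((norm (det Q))\<^sup>2) = (1 :: complex)"
    by (simp only: complex_norm_square mult.commute)
  then have "norm (det Q) = 1"
    unfolding of_real_eq_1_iff power2_eq_1_iff using norm_ge_zero[of "det Q"] by linarith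
  then have d: "norm (det Q) = 1" "det Q \<noteq> 0" by auto
  have "dagger (diag3 s) ** diag3 s = mat 1"
  proof -
    have "cnj (inverse (det Q)) * inverse (det Q) = 1"
      using \<open>cnj (det Q) * det Q = 1\<close> by (metis complex_cnj_inverse inverse_1 inverse_mult_distrib)
    then show ?thesis
      by (simp add: vec_eq_iff matrix_matrix_mult_def forall_3 sum_3 mat_def s_def)
  qed
  then have "dagger U ** U = mat 1"
    unfolding U_def dagger_mult
    by (metis QQ matrix_mul_assoc matrix_mul_lid)
  moreover have "det U = 1"
    using d by (simp add: U_def det_mul det_diag3) (simp add: s_def)
  ultimately have U: "U \<in> carrier SU3"
    by (simp add: SU3_iff)
  have "g ** U = U ** diag3 c"
    unfolding U_def by (simp add: matrix_mul_assoc gQ) (simp add: matrix_mul_assoc[symmetric] diag3_mult mult.commute)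
  then have geq: "g = U ** diag3 c ** dagger U" and "diag3 c = dagger U ** (g ** U)"
    using SU3_mult_dagger[OF U] SU3_dagger_mult[OF U]
    by (metis matrix_mul_assoc matrix_mul_rid, metis matrix_mul_assoc matrix_mul_lid)
  then have "diag3 c \<in> carrier SU3"
    using U g by (simp add: SU3_mult SU3_dagger)
  with U geq show ?thesis
    by (intro that)
qed

section \<open>Characters of irreducible representations\<close>

context swap_design
begin

text \<open>For continuous f this says that the sum over every coset g G is \<open>card G\<close>
  times the Haar integral of f.\<close>

definition invariant_mean :: "(complex^3^3 \<Rightarrow> complex) \<Rightarrow> bool" where
  "invariant_mean f \<longleftrightarrow> (\<forall>g\<in>carrier SU3. (\<Sum>x\<in>G. f (g ** x)) = (\<Sum>x\<in>G. f x))"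

lemma invariant_mean_cong:
  assumes "invariant_mean f" "\<And>g. g \<in> carrier SU3 \<Longrightarrow> f g = f' g"
  shows "invariant_mean f'"
proof -
  have "(\<Sum>x\<in>G. f' (g ** x)) = (\<Sum>x\<in>G. f (g ** x))" "(\<Sum>x\<in>G. f' x) = (\<Sum>x\<in>G. f x)"
    if "g \<in> carrier SU3" for g
    using that by (auto intro!: sum.cong simp: assms(2) SU3 SU3_mult)
  with assms(1) show ?thesis
    by (simp add: invariant_mean_def)
qed

lemma invariant_mean_const: "invariant_mean (\<lambda>_. c)"
  by (simp add: invariant_mean_def)

lemma invariant_mean_add: "invariant_mean f \<Longrightarrow> invariant_mean h \<Longrightarrow> invariant_mean (\<lambda>g. f g + h g)"
  by (simp add: invariant_mean_def sum.distrib)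

lemma invariant_mean_diff: "invariant_mean f \<Longrightarrow> invariant_mean h \<Longrightarrow> invariant_mean (\<lambda>g. f g - h g)"
  by (simp add: invariant_mean_def sum_subtractf)

lemma invariant_mean_scale: "invariant_mean f \<Longrightarrow> invariant_mean (\<lambda>g. c * f g)"
  by (simp add: invariant_mean_def sum_distrib_left[symmetric])

lemma invariant_mean_sum: "(\<And>i. i \<in> S \<Longrightarrow> invariant_mean (f i)) \<Longrightarrow> invariant_mean (\<lambda>g. \<Sum>i\<in>S. f i g)"
  by (induction S rule: infinite_finite_induct) (auto intro: invariant_mean_const invariant_mean_add)

text \<open>The monomial is an entry of a matrix unit conjugated by g \<otimes> g. Its average over
  \<open>G\<close> is a combination of identity and swap, which conjugation by all of SU(3) fixes;
  here the property of \<open>G\<close> becomes invariance under SU(3).\<close>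

lemma invariant_mean_monomial:
  "invariant_mean (\<lambda>g. g $ a $ i * g $ b $ j * cnj (g $ c $ k) * cnj (g $ d $ l))"
proof -
  define B :: "complex^(3 \<times> 3)^(3 \<times> 3)" where "B = (\<chi> p q. if p = (i, j) \<and> q = (k, l) then 1 else 0)"
  have entry: "g $ a $ i * g $ b $ j * cnj (g $ c $ k) * cnj (g $ d $ l) =
      (kron2 g ** B ** dagger (kron2 g)) $ (a, b) $ (c, d)" for g
  proof -
    have "(kron2 g ** B) $ (a, b) $ q = (if q = (k, l) then kron2 g $ (a, b) $ (i, j) else 0)" for q
      by (simp add: matrix_matrix_mult_def B_def if_distrib[of "(*) _"] cong: if_cong)
    then have "(kron2 g ** B ** dagger (kron2 g)) $ (a, b) $ (c, d) =
        kron2 g $ (a, b) $ (i, j) * dagger (kron2 g) $ (k, l) $ (c, d)"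
      by (simp add: matrix_matrix_mult_def[of "kron2 g ** B"] if_distrib[of "\<lambda>x. x * _"] cong: if_cong)
    then show ?thesis
      by (simp add: mult_ac)
  qed
  have "(\<Sum>x\<in>G. (kron2 (g ** x) ** B ** dagger (kron2 (g ** x))) $ (a, b) $ (c, d)) =
      (\<Sum>x\<in>G. (kron2 x ** B ** dagger (kron2 x)) $ (a, b) $ (c, d))" if g: "g \<in> carrier SU3" for g
  proof -
    obtain \<alpha> \<beta> where "average2 B = swap_form \<alpha> \<beta>"
      by (rule average2_swap_form)
    then have "(\<Sum>x\<in>G. kron2 (g ** x) ** B ** dagger (kron2 (g ** x))) = average2 B"
      unfolding average2_conj[symmetric] by (simp only: conj_swap_form[OF g])
    from arg_cong[OF this, of "\<lambda>A. A $ (a, b) $ (c, d)"] show ?thesis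
      by (simp add: average2_def)
  qed
  then show ?thesis
    unfolding invariant_mean_def entry by blast
qed

lemma invariant_mean_class_functions:
  "invariant_mean (\<lambda>g. trace (g ** g) * cnj (trace (g ** g)))"
  "invariant_mean (\<lambda>g. trace (g ** g) * cnj (trace g) ^ 2)"
  "invariant_mean (\<lambda>g. trace g ^ 2 * cnj (trace (g ** g)))"
  "invariant_mean (\<lambda>g. trace g * cnj (trace g))"
proof -
  have tr2: "trace (g ** g) = (\<Sum>a\<in>UNIV. \<Sum>b\<in>UNIV. g $ a $ b * g $ b $ a)" for g :: "complex^3^3"
    by (simp add: trace_def matrix_matrix_mult_def)
  have trsq: "trace g ^ 2 = (\<Sum>a\<in>UNIV. \<Sum>b\<in>UNIV. g $ a $ a * g $ b $ b)" for g :: "complex^3^3"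
    by (simp add: trace_def power2_eq_square sum_product)
  have rows: "(\<Sum>k\<in>UNIV. g $ 1 $ k * cnj (g $ 1 $ k)) = 1" if "g \<in> carrier SU3" for g
    using arg_cong[OF SU3_mult_dagger[OF that], of "\<lambda>A. A $ 1 $ 1"] by (simp add: matrix_matrix_mult_def mat_def)
  note intros = invariant_mean_sum invariant_mean_monomial
  have "invariant_mean (\<lambda>g. \<Sum>c\<in>UNIV. \<Sum>d\<in>UNIV. \<Sum>a\<in>UNIV. \<Sum>b\<in>UNIV. g $ a $ b * g $ b $ a * cnj (g $ c $ d) * cnj (g $ d $ c))"
    by (intro intros)
  then show "invariant_mean (\<lambda>g. trace (g ** g) * cnj (trace (g ** g)))"
    by (rule invariant_mean_cong) (simp add: tr2 sum_distrib_left sum_distrib_right mult.assoc)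
  have "invariant_mean (\<lambda>g. \<Sum>c\<in>UNIV. \<Sum>d\<in>UNIV. \<Sum>a\<in>UNIV. \<Sum>b\<in>UNIV. g $ a $ b * g $ b $ a * cnj (g $ c $ c) * cnj (g $ d $ d))"
    by (intro intros)
  then show "invariant_mean (\<lambda>g. trace (g ** g) * cnj (trace g) ^ 2)"
    by (rule invariant_mean_cong)
      (simp add: tr2 trsq complex_cnj_power[symmetric] sum_distrib_left sum_distrib_right mult.assoc del: complex_cnj_power)
  have "invariant_mean (\<lambda>g. \<Sum>c\<in>UNIV. \<Sum>d\<in>UNIV. \<Sum>a\<in>UNIV. \<Sum>b\<in>UNIV. g $ a $ a * g $ b $ b * cnj (g $ c $ d) * cnj (g $ d $ c))"
    by (intro intros)
  then show "invariant_mean (\<lambda>g. trace g ^ 2 * cnj (trace (g ** g)))"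
    by (rule invariant_mean_cong) (simp add: tr2 trsq sum_distrib_left sum_distrib_right mult.assoc)
  \<comment> \<open>|tr g|^2 has only one factor g and one conjugate. The squared norm of the first
    row of g, which is 1, supplies the missing pair.\<close>
  have "invariant_mean (\<lambda>g. \<Sum>c\<in>UNIV. \<Sum>a\<in>UNIV. \<Sum>k\<in>UNIV. g $ a $ a * g $ 1 $ k * cnj (g $ c $ c) * cnj (g $ 1 $ k))"
    by (intro intros)
  then show "invariant_mean (\<lambda>g. trace g * cnj (trace g))"
  proof (rule invariant_mean_cong)
    fix g assume g: "g \<in> carrier SU3"
    have "(\<Sum>c\<in>UNIV. \<Sum>a\<in>UNIV. \<Sum>k\<in>UNIV. g $ a $ a * g $ 1 $ k * cnj (g $ c $ c) * cnj (g $ 1 $ k)) =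
        (\<Sum>c\<in>UNIV. \<Sum>a\<in>UNIV. g $ a $ a * cnj (g $ c $ c) * (\<Sum>k\<in>UNIV. g $ 1 $ k * cnj (g $ 1 $ k)))"
      by (simp only: sum_distrib_left mult_ac)
    then show "(\<Sum>c\<in>UNIV. \<Sum>a\<in>UNIV. \<Sum>k\<in>UNIV. g $ a $ a * g $ 1 $ k * cnj (g $ c $ c) * cnj (g $ 1 $ k)) =
        trace g * cnj (trace g)"
      unfolding rows[OF g] by (simp add: trace_def sum_distrib_left sum_distrib_right)
  qed
qed

end

section \<open>The Weyl group and orbit sums of weights\<close>

lemma trace_conj_SU3:
  assumes "U \<in> carrier SU3"
  shows "trace (U ** A ** dagger U) = trace A"
  using trace_mul_sym[of "U ** A" "dagger U"] by (simp add: matrix_mul_assoc SU3_dagger_mult[OF assms])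

text \<open>Signed permutation matrices representing the two simple reflections of the Weyl group.\<close>

definition refl1 :: "complex^3^3" where "refl1 = mat3 [[0, 1, 0], [1, 0, 0], [0, 0, -1]]"
definition refl2 :: "complex^3^3" where "refl2 = mat3 [[-1, 0, 0], [0, 0, 1], [0, 1, 0]]"

lemma refl_SU3: "refl1 \<in> carrier SU3" "refl2 \<in> carrier SU3"
  unfolding SU3_iff refl1_def refl2_def dagger_mat3 mat3_mult mat_1_mat3 det_mat3
  by (simp_all add: refl1_def)

lemma diag3_mat3: "diag3 t = mat3 [[t $ 1, 0, 0], [0, t $ 2, 0], [0, 0, t $ 3]]"
  by (simp add: vec_eq_iff forall_3)

lemma refl_diag3:
  "diag3 t ** refl1 = refl1 ** diag3 (vector [t $ 2, t $ 1, t $ 3])"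
  "diag3 t ** refl2 = refl2 ** diag3 (vector [t $ 1, t $ 3, t $ 2])"
  unfolding refl1_def refl2_def diag3_mat3 mat3_mult by simp_all

lemma refl_diag3_SU3:
  assumes "diag3 t \<in> carrier SU3"
  shows "diag3 (vector [t $ 2, t $ 1, t $ 3]) \<in> carrier SU3" "diag3 (vector [t $ 1, t $ 3, t $ 2]) \<in> carrier SU3"
  using assms by (simp_all add: diag3_SU3_iff forall_3 mult_ac)

text \<open>The simple reflections in coordinates of the fundamental weights: (a, b) - a \<alpha>1
  here, (a, b) - b \<alpha>2 for \<open>weyl2\<close>.\<close>

definition weyl1 :: "int \<times> int \<Rightarrow> int \<times> int" where "weyl1 w = (- fst w, fst w + snd w)"
definition weyl2 :: "int \<times> int \<Rightarrow> int \<times> int" where "weyl2 w = (fst w + snd w, - snd w)"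

lemma weight_char_refl:
  assumes "diag3 t \<in> carrier SU3"
  shows "weight_char w (vector [t $ 2, t $ 1, t $ 3]) = weight_char (weyl1 w) t"
    "weight_char w (vector [t $ 1, t $ 3, t $ 2]) = weight_char (weyl2 w) t"
proof -
  have nz: "t $ 1 \<noteq> 0" "t $ 2 \<noteq> 0" and "t $ 1 * t $ 2 * t $ 3 = 1"
    using assms by (auto simp: diag3_SU3_iff)
  then have 3: "t $ 1 * t $ 3 = inverse (t $ 2)"
    by (simp add: field_simps)
  show "weight_char w (vector [t $ 2, t $ 1, t $ 3]) = weight_char (weyl1 w) t"
    using nz by (simp add: weight_char_def weyl1_def power_int_mult_distrib power_int_add power_int_minus field_simps)
  show "weight_char w (vector [t $ 1, t $ 3, t $ 2]) = weight_char (weyl2 w) t"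
    using nz by (simp add: weight_char_def weyl2_def 3 power_int_mult_distrib power_int_add power_int_minus
        power_int_inverse field_simps)
qed

text \<open>The reflections normalize the torus, so their action on a weight vector gives a weight
  vector for the reflected weight.\<close>

lemma is_weight_weyl:
  assumes rep: "SU3_rep \<rho>" and w: "is_weight \<rho> w"
  shows "is_weight \<rho> (weyl1 w)" "is_weight \<rho> (weyl2 w)"
proof -
  obtain v where v: "v \<noteq> 0" "\<And>t. diag3 t \<in> carrier SU3 \<Longrightarrow> \<rho> (diag3 t) *v v = weight_char w t *s v"
    using w unfolding is_weight_def by blast
  have gen: "is_weight \<rho> w'" if P: "P \<in> carrier SU3"
    and conj: "\<And>t. diag3 t \<in> carrier SU3 \<Longrightarrow> diag3 t ** P = P ** diag3 (\<sigma> t)"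
    and \<sigma>: "\<And>t. diag3 t \<in> carrier SU3 \<Longrightarrow> diag3 (\<sigma> t) \<in> carrier SU3"
    and char: "\<And>t. diag3 t \<in> carrier SU3 \<Longrightarrow> weight_char w (\<sigma> t) = weight_char w' t" for P \<sigma> w'
    unfolding is_weight_def
  proof (intro exI conjI allI impI)
    obtain Q where "Q ** \<rho> P = mat 1"
      using SU3_rep_invertible[OF rep P] by (auto simp: invertible_def)
    then show "\<rho> P *v v \<noteq> 0"
      using v(1) by (metis matrix_vector_mul_assoc matrix_vector_mul_lid matrix_vector_mult_0_right)
    fix t assume t: "diag3 t \<in> carrier SU3"
    have "\<rho> (diag3 t) ** \<rho> P = \<rho> P ** \<rho> (diag3 (\<sigma> t))"
      by (simp only: SU3_rep_mult[OF rep, symmetric] t P \<sigma>[OF t] conj[OF t])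
    then have "\<rho> (diag3 t) *v (\<rho> P *v v) = \<rho> P *v (\<rho> (diag3 (\<sigma> t)) *v v)"
      by (simp add: matrix_vector_mul_assoc)
    then show "\<rho> (diag3 t) *v (\<rho> P *v v) = weight_char w' t *s (\<rho> P *v v)"
      by (simp add: v(2)[OF \<sigma>[OF t]] matrix_vector_mult_smult char[OF t])
  qed
  show "is_weight \<rho> (weyl1 w)"
    by (rule gen[OF refl_SU3(1) refl_diag3(1) refl_diag3_SU3(1) weight_char_refl(1)])
  show "is_weight \<rho> (weyl2 w)"
    by (rule gen[OF refl_SU3(2) refl_diag3(2) refl_diag3_SU3(2) weight_char_refl(2)])
qed

text \<open>A sum over the six group elements, not over the orbit: a weight on a wall is counted
  twice, the weight 0 six times.\<close>

definition weyl_sum :: "int \<times> int \<Rightarrow> complex^3 \<Rightarrow> complex" where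
  "weyl_sum w t = weight_char w t + weight_char (weyl1 w) t + weight_char (weyl2 w) t +
     weight_char (weyl1 (weyl2 w)) t + weight_char (weyl2 (weyl1 w)) t + weight_char (weyl1 (weyl2 (weyl1 w))) t"

lemma weyl_sum_weyl: "weyl_sum (weyl1 w) t = weyl_sum w t" "weyl_sum (weyl2 w) t = weyl_sum w t"
proof -
  have "weyl1 (weyl1 w) = w" "weyl2 (weyl2 w) = w" "weyl1 (weyl2 (weyl1 w)) = weyl2 (weyl1 (weyl2 w))" for w
    by (simp_all add: weyl1_def weyl2_def)
  then show "weyl_sum (weyl1 w) t = weyl_sum w t" "weyl_sum (weyl2 w) t = weyl_sum w t"
    unfolding weyl_sum_def by (simp_all add: add_ac)
qed

text \<open>The character on the torus is invariant under conjugation by the reflections, so it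
  equals its average over the Weyl group. Constancy of multiplicities on orbits need not be
  established.\<close>

lemma SU3_rep_trace_weyl_sum:
  fixes \<rho> :: "complex^3^3 \<Rightarrow> complex^'n^'n"
  assumes rep: "SU3_rep \<rho>"
  obtains w :: "'n \<Rightarrow> int \<times> int" where "\<And>j. is_weight \<rho> (w j)"
    "\<And>t. diag3 t \<in> carrier SU3 \<Longrightarrow> 6 * trace (\<rho> (diag3 t)) = (\<Sum>j\<in>UNIV. weyl_sum (w j) t)"
proof -
  obtain w :: "'n \<Rightarrow> int \<times> int" where w: "\<And>j. is_weight \<rho> (w j)"
    and tr: "\<And>t. diag3 t \<in> carrier SU3 \<Longrightarrow> trace (\<rho> (diag3 t)) = (\<Sum>j\<in>UNIV. weight_char (w j) t)"
    by (rule SU3_rep_trace_torus[OF rep]) blast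
  define ch where "ch f t = (\<Sum>j\<in>UNIV. weight_char (f (w j)) t)" for f and t
  have conj: "trace (\<rho> (diag3 t)) = trace (\<rho> (diag3 s))"
    if "diag3 t ** P = P ** diag3 s" "P \<in> carrier SU3" "diag3 t \<in> carrier SU3" "diag3 s \<in> carrier SU3" for s t P
  proof -
    have "diag3 t = P ** diag3 s ** dagger P"
      using that(1) SU3_mult_dagger[OF that(2)] by (metis matrix_mul_assoc matrix_mul_rid)
    then have "\<rho> (diag3 t) = \<rho> P ** \<rho> (diag3 s) ** \<rho> (dagger P)"
      using that by (simp add: SU3_rep_mult[OF rep] SU3_mult SU3_dagger)
    then have "trace (\<rho> (diag3 t)) = trace (\<rho> (dagger P) ** \<rho> P ** \<rho> (diag3 s))"
      using trace_mul_sym[of "\<rho> P ** \<rho> (diag3 s)"] by (simp add: matrix_mul_assoc)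
    also have "\<rho> (dagger P) ** \<rho> P = mat 1"
      using that(2) by (simp add: SU3_rep_mult[OF rep, symmetric] SU3_dagger SU3_dagger_mult SU3_rep_one[OF rep])
    finally show ?thesis by simp
  qed
  have r1: "trace (\<rho> (diag3 (vector [t $ 2, t $ 1, t $ 3]))) = trace (\<rho> (diag3 t))"
    and r2: "trace (\<rho> (diag3 (vector [t $ 1, t $ 3, t $ 2]))) = trace (\<rho> (diag3 t))"
    if "diag3 t \<in> carrier SU3" for t
    using conj[OF refl_diag3(1) refl_SU3(1) that refl_diag3_SU3(1)[OF that]]
      conj[OF refl_diag3(2) refl_SU3(2) that refl_diag3_SU3(2)[OF that]] by simp_all
  define is_trace where "is_trace f \<longleftrightarrow> (\<forall>t. diag3 t \<in> carrier SU3 \<longrightarrow> ch f t = trace (\<rho> (diag3 t)))" for f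
  have step: "is_trace (\<lambda>w. weyl1 (f w))" "is_trace (\<lambda>w. weyl2 (f w))" if "is_trace f" for f
  proof -
    have "ch (\<lambda>w. weyl1 (f w)) t = trace (\<rho> (diag3 t))" "ch (\<lambda>w. weyl2 (f w)) t = trace (\<rho> (diag3 t))"
      if t: "diag3 t \<in> carrier SU3" for t
      using \<open>is_trace f\<close> refl_diag3_SU3[OF t] r1[OF t] r2[OF t]
      unfolding is_trace_def ch_def weight_char_refl[OF t, symmetric] by simp_all
    then show "is_trace (\<lambda>w. weyl1 (f w))" "is_trace (\<lambda>w. weyl2 (f w))"
      by (simp_all add: is_trace_def)
  qed
  have 0: "is_trace (\<lambda>w. w)"
    using tr by (simp add: is_trace_def ch_def)
  note 1 = step(1)[OF 0] and 2 = step(2)[OF 0]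
  note 12 = step(1)[OF 2] and 21 = step(2)[OF 1]
  note 121 = step(1)[OF 21]
  show thesis
  proof
    fix t assume t: "diag3 t \<in> carrier SU3"
    have "(\<Sum>j\<in>UNIV. weyl_sum (w j) t) = ch (\<lambda>w. w) t + ch weyl1 t + ch weyl2 t +
        ch (\<lambda>w. weyl1 (weyl2 w)) t + ch (\<lambda>w. weyl2 (weyl1 w)) t + ch (\<lambda>w. weyl1 (weyl2 (weyl1 w))) t"
      by (simp add: weyl_sum_def ch_def sum.distrib)
    also have "\<dots> = 6 * trace (\<rho> (diag3 t))"
      using 0 1 2 12 21 121 t by (simp add: is_trace_def)
    finally show "6 * trace (\<rho> (diag3 t)) = (\<Sum>j\<in>UNIV. weyl_sum (w j) t)" ..
  qed (rule w)
qed

text \<open>The dominant weights below (2, 2) in the root order; the other three labels are among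
  them.\<close>

definition small_dominant :: "(int \<times> int) set" where
  "small_dominant = {(0, 0), (1, 1), (3, 0), (0, 3), (2, 2)}"

lemma dominant_weight_le:
  assumes "d \<in> {(1, 1), (3, 0), (0, 3), (2, 2)}" "weight_le w d" "fst w \<ge> 0" "snd w \<ge> 0"
  shows "w \<in> small_dominant"
proof -
  obtain a b where w: "w = (a, b)" by (cases w)
  obtain k l :: nat where kl: "fst d - a = 2 * int k - int l" "snd d - b = - int k + 2 * int l"
    using assms(2) by (auto simp: weight_le_def w)
  \<comment> \<open>The combinations 2 a + b and a + 2 b invert the Cartan matrix up to the factor
    3. On d - w they give 3 k and 3 l; on d they are at most 6 and on w nonnegative.\<close>
  have "fst d \<le> 3" "snd d \<le> 3" "2 * fst d + snd d \<le> 6" "fst d + 2 * snd d \<le> 6"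
    using assms(1) by auto
  moreover have "2 * (fst d - a) + (snd d - b) = 3 * int k" "(fst d - a) + 2 * (snd d - b) = 3 * int l"
    using kl by simp_all
  ultimately have "k \<le> 2" "l \<le> 2"
    using assms(3,4) by (auto simp: w)
  then have "k \<in> {0, 1, 2}" "l \<in> {0, 1, 2}" by auto
  moreover have "a = fst d - 2 * int k + int l" "b = snd d + int k - 2 * int l"
    using kl by simp_all
  ultimately show ?thesis
    using assms(1,3,4) unfolding w by (elim insertE emptyE) (simp_all add: small_dominant_def)
qed

lemma dominant_weyl_image:
  "\<exists>u \<in> {w, weyl1 w, weyl2 w, weyl1 (weyl2 w), weyl2 (weyl1 w), weyl1 (weyl2 (weyl1 w))}.
    fst u \<ge> 0 \<and> snd u \<ge> 0"
  by (simp add: weyl1_def weyl2_def) linarith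

text \<open>Since t1 t2 t3 = 1, the second elementary symmetric function of the t_i is
  \<open>cnj p\<close>, whence \<open>cnj p ^ 2 = cnj p2 + 2 * p\<close>. The orbit sum of (3, 0) is
  twice the cubic power sum, and p p2 is this power sum plus the orbit sum of (1, 1). The relation
  replaces 2 p p2 by terms with two factors and two conjugates.\<close>

lemma weyl_sum_dominant:
  assumes t: "diag3 t \<in> carrier SU3"
  defines "p \<equiv> t $ 1 + t $ 2 + t $ 3" and "p2 \<equiv> t $ 1 ^ 2 + t $ 2 ^ 2 + t $ 3 ^ 2"
  shows "weyl_sum (0, 0) t = 6"
    and "weyl_sum (1, 1) t = p * cnj p - 3"
    and "weyl_sum (2, 2) t = p2 * cnj p2 - 3"
    and "weyl_sum (3, 0) t = p2 * cnj p ^ 2 - p2 * cnj p2 - 2 * (p * cnj p) + 6"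
    and "weyl_sum (0, 3) t = p ^ 2 * cnj p2 - p2 * cnj p2 - 2 * (p * cnj p) + 6"
proof -
  have prod: "t $ 1 * t $ 2 * t $ 3 = 1" and norm: "norm (t $ i) = 1" for i
    using t by (auto simp: diag3_SU3_iff)
  have cnj: "cnj (t $ i) = inverse (t $ i)" for i
    using norm[of i] by (simp add: inverse_eq_divide divide_conv_cnj)
  have nz: "t $ i \<noteq> 0" for i
    using norm[of i] by auto
  obtain x y where xy: "t $ 1 = x" "t $ 2 = y" "x \<noteq> 0" "y \<noteq> 0"
    using nz by blast
  have 3: "t $ 3 = inverse (x * y)"
    using prod xy by (simp add: field_simps)
  have cnj_xy: "cnj x = inverse x" "cnj y = inverse y"
    using cnj[of 1] cnj[of 2] by (simp_all add: xy)
  note defs = weyl_sum_def weyl1_def weyl2_def weight_char_def p_def p2_def xy(1,2) cnj_xy 3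
  \<comment> \<open>With the inverses as separate variables the claims are polynomial identities
    modulo x X = 1 and y Y = 1.\<close>
  define X Y where "X = inverse x" and "Y = inverse y"
  have e: "x powi n = (if n \<ge> 0 then x ^ nat n else X ^ nat (- n))"
    "(x * y) powi n = (if n \<ge> 0 then (x * y) ^ nat n else (X * Y) ^ nat (- n))" for n
    by (simp_all add: power_int_def X_def Y_def)
  have XY: "x * X = 1" "y * Y = 1"
    using xy(3,4) by (simp_all add: X_def Y_def)
  have cnj_p: "cnj p = X + Y + x * y" and p: "p = x + y + X * Y"
    by (simp_all add: defs X_def Y_def)
  have cnj_p2: "cnj p2 = X ^ 2 + Y ^ 2 + (x * y) ^ 2" and p2: "p2 = x ^ 2 + y ^ 2 + (X * Y) ^ 2"
    by (simp_all add: defs X_def Y_def)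
  note weyl_defs = weyl_sum_def weyl1_def weyl2_def weight_char_def xy(1,2) e
  have vals: "weyl_sum (1, 1) t = x * (x * y) + X * (x * y) ^ 2 + x ^ 2 * (X * Y) + X ^ 2 * (x * y) + x * (X * Y) ^ 2 + X * (X * Y)"
    "weyl_sum (2, 2) t = x ^ 2 * (x * y) ^ 2 + X ^ 2 * (x * y) ^ 4 + x ^ 4 * (X * Y) ^ 2 + X ^ 4 * (x * y) ^ 2 + x ^ 2 * (X * Y) ^ 4 + X ^ 2 * (X * Y) ^ 2"
    "weyl_sum (3, 0) t = 2 * x ^ 3 + 2 * X ^ 3 * (x * y) ^ 3 + 2 * (X * Y) ^ 3"
    "weyl_sum (0, 3) t = 2 * (x * y) ^ 3 + 2 * x ^ 3 * (X * Y) ^ 3 + 2 * X ^ 3"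
    by (simp_all add: weyl_defs X_def[symmetric] Y_def[symmetric] del: power_mult_distrib)
  show "weyl_sum (0, 0) t = 6"
    by (simp add: weyl_defs)
  show "weyl_sum (1, 1) t = p * cnj p - 3"
    unfolding vals cnj_p unfolding p using XY by algebra
  show "weyl_sum (2, 2) t = p2 * cnj p2 - 3"
    unfolding vals cnj_p2 unfolding p2 using XY by algebra
  show "weyl_sum (3, 0) t = p2 * cnj p ^ 2 - p2 * cnj p2 - 2 * (p * cnj p) + 6"
    unfolding vals cnj_p cnj_p2 unfolding p p2 using XY by algebra
  show "weyl_sum (0, 3) t = p ^ 2 * cnj p2 - p2 * cnj p2 - 2 * (p * cnj p) + 6"
    unfolding vals cnj_p cnj_p2 unfolding p p2 using XY by algebra
qed

context swap_design
begin

text \<open>Every weight has a dominant Weyl image in \<open>small_dominant\<close>, and each of the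
  five orbit sums extends to a class function with invariant mean. The multiplicities remain
  unknown.\<close>

lemma invariant_mean_trace:
  fixes \<rho> :: "complex^3^3 \<Rightarrow> complex^'n^'n"
  assumes d: "d \<in> {(1, 1), (3, 0), (0, 3), (2, 2)}" and rep: "SU3_rep \<rho>" and hw: "has_highest_weight \<rho> d"
  shows "invariant_mean (\<lambda>g. trace (\<rho> g))"
proof -
  obtain w :: "'n \<Rightarrow> int \<times> int" where w: "\<And>j. is_weight \<rho> (w j)"
    and tr: "\<And>t. diag3 t \<in> carrier SU3 \<Longrightarrow> 6 * trace (\<rho> (diag3 t)) = (\<Sum>j\<in>UNIV. weyl_sum (w j) t)"
    by (rule SU3_rep_trace_weyl_sum[OF rep]) blast
  have "\<exists>u\<in>small_dominant. \<forall>t. weyl_sum (w j) t = weyl_sum u t" for j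
  proof -
    obtain u where u: "u \<in> {w j, weyl1 (w j), weyl2 (w j), weyl1 (weyl2 (w j)), weyl2 (weyl1 (w j)),
        weyl1 (weyl2 (weyl1 (w j)))}" "fst u \<ge> 0" "snd u \<ge> 0"
      using dominant_weyl_image[of "w j"] by blast
    have "is_weight \<rho> u"
      using u(1) w[of j] by (elim insertE emptyE) (simp_all add: is_weight_weyl[OF rep])
    then have "weight_le u d"
      using hw unfolding has_highest_weight_def by blast
    then have "u \<in> small_dominant"
      using dominant_weight_le[OF d _ u(2,3)] by blast
    moreover have "weyl_sum u t = weyl_sum (w j) t" for t
      using u(1) by (elim insertE emptyE) (simp_all add: weyl_sum_weyl)
    ultimately show ?thesis by metis
  qed
  then obtain u where u: "\<And>j. u j \<in> small_dominant" "\<And>j t. weyl_sum (w j) t = weyl_sum (u j) t"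
    by metis
  \<comment> \<open>Extends the orbit sums from the torus to class functions on SU(3); the last
    branch is meant for (0, 3).\<close>
  define \<Phi> where "\<Phi> v g = (if v = (0, 0) then 6
    else if v = (1, 1) then trace g * cnj (trace g) - 3
    else if v = (2, 2) then trace (g ** g) * cnj (trace (g ** g)) - 3
    else if v = (3, 0) then trace (g ** g) * cnj (trace g) ^ 2 - trace (g ** g) * cnj (trace (g ** g))
      - 2 * (trace g * cnj (trace g)) + 6
    else trace g ^ 2 * cnj (trace (g ** g)) - trace (g ** g) * cnj (trace (g ** g))
      - 2 * (trace g * cnj (trace g)) + 6)" for v :: "int \<times> int" and g :: "complex^3^3"
  have \<Phi>_mean: "invariant_mean (\<Phi> v)" for v
    unfolding \<Phi>_def
    by (cases "v = (0, 0)"; cases "v = (1, 1)"; cases "v = (2, 2)"; cases "v = (3, 0)"; simp only: if_True if_False simp_thms)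
      (intro invariant_mean_add invariant_mean_diff invariant_mean_scale invariant_mean_const invariant_mean_class_functions)+
  have \<Phi>_torus: "\<Phi> v (diag3 t) = weyl_sum v t" if "diag3 t \<in> carrier SU3" "v \<in> small_dominant" for v t
  proof -
    have "trace (diag3 t) = t $ 1 + t $ 2 + t $ 3" "trace (diag3 t ** diag3 t) = t $ 1 ^ 2 + t $ 2 ^ 2 + t $ 3 ^ 2"
      by (simp_all add: diag3_mult trace_def sum_3 power2_eq_square)
    then show ?thesis
      using weyl_sum_dominant[OF that(1)] that(2) unfolding small_dominant_def
      by (elim insertE emptyE) (simp_all add: \<Phi>_def)
  qed
  have trace_eq: "(1 / 6) * (\<Sum>j\<in>UNIV. \<Phi> (u j) g) = trace (\<rho> g)" if g: "g \<in> carrier SU3" for g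
  proof -
    obtain U t where U: "U \<in> carrier SU3" and t: "diag3 t \<in> carrier SU3" and geq: "g = U ** diag3 t ** dagger U"
      by (rule SU3_diagonalization[OF g])
    have "g ** g = U ** (diag3 t ** diag3 t) ** dagger U"
    proof -
      have "g ** g = U ** diag3 t ** (dagger U ** U) ** diag3 t ** dagger U"
        unfolding geq by (simp only: matrix_mul_assoc)
      then show ?thesis
        by (simp add: SU3_dagger_mult[OF U] matrix_mul_assoc)
    qed
    then have "trace (g ** g) = trace (diag3 t ** diag3 t)" "trace g = trace (diag3 t)"
      by (simp_all add: trace_conj_SU3[OF U] geq)
    then have "\<Phi> v g = \<Phi> v (diag3 t)" for v
      by (simp only: \<Phi>_def)
    then have "(\<Sum>j\<in>UNIV. \<Phi> (u j) g) = (\<Sum>j\<in>UNIV. weyl_sum (w j) t)"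
      using \<Phi>_torus[OF t] u by simp
    also have "\<dots> = 6 * trace (\<rho> (diag3 t))"
      using tr[OF t] by simp
    also have "trace (\<rho> (diag3 t)) = trace (\<rho> g)"
    proof -
      have "\<rho> g = \<rho> U ** \<rho> (diag3 t) ** \<rho> (dagger U)"
        unfolding geq by (simp add: SU3_rep_mult[OF rep] U t SU3_mult SU3_dagger)
      then have "trace (\<rho> g) = trace ((\<rho> (dagger U) ** \<rho> U) ** \<rho> (diag3 t))"
        using trace_mul_sym[of "\<rho> U ** \<rho> (diag3 t)"] by (simp add: matrix_mul_assoc)
      also have "\<rho> (dagger U) ** \<rho> U = mat 1"
        using U by (simp add: SU3_rep_mult[OF rep, symmetric] SU3_dagger SU3_dagger_mult SU3_rep_one[OF rep])
      finally show ?thesis by simp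
    qed
    finally show ?thesis by simp
  qed
  have "invariant_mean (\<lambda>g. (1 / 6) * (\<Sum>j\<in>UNIV. \<Phi> (u j) g))"
    by (intro invariant_mean_scale invariant_mean_sum \<Phi>_mean)
  then show ?thesis
    by (rule invariant_mean_cong) (rule trace_eq)
qed

end

text \<open>The fixed vectors form a subrepresentation. It cannot be the whole space, on which the
  torus would act trivially, because \<open>d\<close> is a nontrivial weight.\<close>

lemma irrep_no_invariants:
  fixes \<rho> :: "complex^3^3 \<Rightarrow> complex^'n^'n"
  assumes d: "d \<in> {(1, 1), (3, 0), (0, 3), (2, 2)}" and irr: "SU3_irreducible \<rho>" and hw: "is_weight \<rho> d"
    and fixed: "\<And>g. g \<in> carrier SU3 \<Longrightarrow> \<rho> g *v v = v"
  shows "v = 0"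
proof -
  define W where "W = {v. \<forall>g\<in>carrier SU3. \<rho> g *v v = v}"
  have "vec.subspace W"
    by (auto simp: vec.subspace_def W_def matrix_vector_right_distrib matrix_vector_mult_smult)
  moreover have "\<forall>g\<in>carrier SU3. \<forall>w\<in>W. \<rho> g *v w \<in> W"
    by (simp add: W_def)
  ultimately have "W = {0} \<or> W = UNIV"
    using irr unfolding SU3_irreducible_def by blast
  moreover have "W \<noteq> UNIV"
  proof
    assume UNIV: "W = UNIV"
    obtain u where u: "u \<noteq> 0" "\<And>t. diag3 t \<in> carrier SU3 \<Longrightarrow> \<rho> (diag3 t) *v u = weight_char d t *s u"
      using hw unfolding is_weight_def by blast
    \<comment> \<open>At t = (z, 1, 1/z) the weight (a, b) takes the value z^(a+b). As a + b is 2, 3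
      or 4, an eighth root of unity shows that this is not 1.\<close>
    define z where "z = cis (pi / 4)"
    define t where "t = (vector [z, 1, inverse z] :: complex^3)"
    have t: "diag3 t \<in> carrier SU3"
      by (simp add: diag3_SU3_iff forall_3 t_def z_def norm_inverse cis_mult)
    have "u \<in> W" using UNIV by simp
    then have "weight_char d t *s u = 1 *s u"
      using u(2)[OF t] t by (simp add: W_def)
    then have "weight_char d t = 1"
      using u(1) by (simp only: vector_mul_rcancel) simp
    moreover have "weight_char d t = z powi (fst d + snd d)"
      by (simp add: weight_char_def t_def power_int_add z_def)
    ultimately have "z powi (fst d + snd d) = 1" by simp
    have "z ^ 2 = \<i>"
      by (simp add: z_def Complex.DeMoivre complex_eq_iff)
    then have "z ^ 4 = - 1"
      using power_mult[of z 2 2] by simp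
    have "z ^ 3 \<noteq> 1"
    proof
      assume "z ^ 3 = 1"
      then have "z ^ 2 * (z ^ 2 * z ^ 2) = 1"
        using power_mult[of z 3 2] by (simp flip: power_add)
      then show False
        using \<open>z ^ 2 = \<i>\<close> by (simp add: complex_eq_iff)
    qed
    have "fst d + snd d \<in> {2, 3, 4}"
      using d by auto
    with \<open>z powi (fst d + snd d) = 1\<close> \<open>z ^ 2 = \<i>\<close> \<open>z ^ 4 = - 1\<close> \<open>z ^ 3 \<noteq> 1\<close> show False
      by (auto simp: complex_eq_iff)
  qed
  ultimately show ?thesis
    using fixed by (auto simp: W_def)
qed

text \<open>The function \<open>tr (\<rho> g E)\<close> is constant, where \<open>E\<close> is the projection onto the vectors
  fixed by \<open>G\<close>. The constant is \<open>0\<close>, since the compact convex hull of all \<open>\<rho> g E\<close> contains an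
  \<open>SU3\<close>-fixed point, whose columns are \<open>SU3\<close>-fixed vectors.\<close>

lemma (in swap_design) inaccessible_irrep:
  fixes \<rho> :: "complex^3^3 \<Rightarrow> complex^'n^'n"
  assumes d: "d \<in> {(1, 1), (3, 0), (0, 3), (2, 2)}" and irrep: "irrep_with_dynkin_labels d \<rho>"
  shows "inaccessible_symmetry G \<rho>"
  unfolding inaccessible_symmetry_def
proof
  assume "\<exists>v. v \<noteq> 0 \<and> (\<forall>g\<in>G. \<rho> g *v v = v)"
  then obtain v where v: "v \<noteq> 0" "\<And>g. g \<in> G \<Longrightarrow> \<rho> g *v v = v"
    by blast
  define d' where "d' = (int (fst d), int (snd d))"
  have d': "d' \<in> {(1, 1), (3, 0), (0, 3), (2, 2)}"
    using d by (auto simp: d'_def)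
  have irr: "SU3_irreducible \<rho>" and hw: "has_highest_weight \<rho> d'"
    using irrep by (simp_all add: irrep_with_dynkin_labels_def d'_def)
  then have rep: "SU3_rep \<rho>" and weight: "is_weight \<rho> d'"
    by (simp_all add: SU3_irreducible_def has_highest_weight_def)
  define E where "E = (1 / real (card G)) *\<^sub>R (\<Sum>x\<in>G. \<rho> x)"
  have E_fixed: "\<rho> x ** E = E" if x: "x \<in> G" for x
  proof -
    have "\<rho> x ** (\<Sum>y\<in>G. \<rho> y) = (\<Sum>y\<in>G. \<rho> (x ** y))"
      unfolding matrix_mult_sum_right
      by (rule sum.cong[OF refl]) (simp add: SU3_rep_mult[OF rep] SU3 x)
    also have "\<dots> = (\<Sum>y\<in>G. \<rho> y)"
      by (rule sum.reindex_bij_betw[OF bij_betw_mult[OF x]])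
    finally show ?thesis
      by (simp add: E_def matrix_mult_scaleR_right)
  qed
  have "E ** E = (1 / real (card G)) *\<^sub>R (\<Sum>x\<in>G. \<rho> x ** E)"
    by (subst (1) E_def) (simp add: matrix_mult_scaleR_left matrix_mult_sum_left)
  also have "\<dots> = (1 / real (card G)) *\<^sub>R (of_nat (card G) *\<^sub>R E)"
    by (simp add: E_fixed scaleR_conv_of_real sum_constant_scaleR)
  finally have idem: "E ** E = E"
    using card_G_pos by simp
  have "E *v v = (1 / real (card G)) *\<^sub>R (\<Sum>x\<in>G. v)"
    by (simp add: E_def matrix_vector_mult_scaleR_left matrix_vector_mult_sum_left v(2))
  then have Ev: "E *v v = v"
    unfolding sum_constant_scaleR using card_G_pos by simp
  have const: "trace (\<rho> g ** E) = trace E" if g: "g \<in> carrier SU3" for g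
  proof -
    have "\<rho> g ** E = (1 / real (card G)) *\<^sub>R (\<Sum>x\<in>G. \<rho> (g ** x))"
      unfolding E_def matrix_mult_scaleR_right matrix_mult_sum_right
      by (intro arg_cong[where f = "(*\<^sub>R) _"] sum.cong refl) (simp add: SU3_rep_mult[OF rep] SU3 g)
    then show ?thesis
      using invariant_mean_trace[OF d' rep hw] g
      by (simp add: E_def trace_scaleR trace_sum invariant_mean_def)
  qed
  define S where "S = (\<lambda>g. \<rho> g ** E) ` carrier SU3"
  have cont: "continuous_on (carrier SU3) \<rho>"
    using rep by (simp add: SU3_rep_def)
  have "compact S"
    unfolding S_def by (intro compact_continuous_image compact_SU3 continuous_intros cont)
  then have C: "compact (convex hull S)" "convex (convex hull S)" "convex hull S \<noteq> {}"
    using SU3_one by (auto simp: compact_convex_hull S_def)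
  have stable: "a ** x \<in> convex hull S" if a: "a \<in> \<rho> ` carrier SU3" and x: "x \<in> convex hull S" for a x
  proof -
    have "linear (\<lambda>x :: complex^'n^'n. a ** x)"
      by (rule bounded_linear.linear[OF bounded_bilinear.bounded_linear_right[OF bounded_bilinear_matrix_matrix_mult]])
    then have "(\<lambda>x. a ** x) ` (convex hull S) = convex hull ((\<lambda>x. a ** x) ` S)"
      by (rule convex_hull_linear_image)
    moreover have "(\<lambda>x. a ** x) ` S \<subseteq> S"
      using a by (auto simp: S_def matrix_mul_assoc SU3_rep_mult[OF rep, symmetric] intro!: imageI SU3_mult)
    ultimately show ?thesis
      using x hull_mono by blast
  qed
  have compact: "compact (\<rho> ` carrier SU3)"
    by (intro compact_continuous_image compact_SU3 cont)
  obtain x where x: "x \<in> convex hull S" "\<And>a. a \<in> \<rho> ` carrier SU3 \<Longrightarrow> a ** x = x"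
  proof (rule compact_group_fixed_point[OF compact _ _ _ C stable])
    show "\<rho> ` carrier SU3 \<noteq> {}" using SU3_one by blast
    show "a ** b \<in> \<rho> ` carrier SU3" if "a \<in> \<rho> ` carrier SU3" "b \<in> \<rho> ` carrier SU3" for a b
      using that by (auto simp: SU3_rep_mult[OF rep, symmetric] intro!: imageI SU3_mult)
    show "invertible a" if "a \<in> \<rho> ` carrier SU3" for a
      using that SU3_rep_invertible[OF rep] by blast
  qed blast+
  have "x *v axis j 1 = 0" for j
  proof (rule irrep_no_invariants[OF d' irr weight])
    show "\<rho> g *v (x *v axis j 1) = x *v axis j 1" if "g \<in> carrier SU3" for g
      using x(2)[of "\<rho> g"] that by (simp add: matrix_vector_mul_assoc)
  qed
  then have "x = 0"
    by (simp add: vec_eq_iff matrix_vector_mult_def axis_def if_distrib[of "(*) _"] cong: if_cong)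
  \<comment> \<open>The trace is affine, so it is constant on the hull and can be read off at the
    fixed point, which is 0.\<close>
  moreover have "convex hull S \<subseteq> {X. trace X = trace E}"
  proof (rule hull_minimal)
    show "S \<subseteq> {X. trace X = trace E}"
      by (auto simp: S_def const)
    show "convex {X :: complex^'n^'n. trace X = trace E}"
      unfolding convex_def
    proof clarify
      fix X Y :: "complex^'n^'n" and a b :: real
      assume XY: "trace X = trace E" "trace Y = trace E" and ab: "a + b = 1"
      have "trace (a *\<^sub>R X + b *\<^sub>R Y) = (a + b) *\<^sub>R trace E"
        by (simp only: trace_add trace_scaleR XY scaleR_add_left)
      then show "trace (a *\<^sub>R X + b *\<^sub>R Y) = trace E"
        by (simp add: ab)
    qed
  qed
  ultimately have "trace (0 :: complex^'n^'n) = trace E"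
    using x(1) by blast
  then have "trace E = 0"
    by (simp add: trace_def)
  then have "E = 0"
    by (rule idempotent_trace_zero[OF idem])
  then show False
    using Ev v(1) by simp
qed

theorem mainTheorem5:
  fixes \<G> :: "(complex^3^3) set"
  assumes "\<G> = Sigma168 \<or> \<G> = Sigma72x3"
  shows "(subgroup \<G> SU3 \<and> finite \<G>) \<and>
    (\<forall>d \<in> {(1, 1), (3, 0), (0, 3), (2, 2)}. \<forall>\<rho> :: complex^3^3 \<Rightarrow> complex^('n::finite)^'n.
        irrep_with_dynkin_labels d \<rho> \<longrightarrow> inaccessible_symmetry \<G> \<rho>) \<and>
    (\<forall>(i :: 'q::finite) (n :: real^8).
        twirl \<G> (\<Sum>a\<in>UNIV. n $ a *\<^sub>R on_qutrit i (gell_mann a)) = 0) \<and>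
    (\<forall>(i :: 'q) (j :: 'q) (M :: real^8^8). i \<noteq> j \<longrightarrow> trace M = 0 \<longrightarrow>
        twirl \<G> (\<Sum>a\<in>UNIV. \<Sum>b\<in>UNIV.
          M $ a $ b *\<^sub>R (on_qutrit i (gell_mann a) ** on_qutrit j (gell_mann b))) = 0)"
proof -
  interpret swap_design \<G>
    by (rule swap_design_Sigma[OF assms])
  show ?thesis
    using subgroup finite_G inaccessible_irrep twirl_one_body twirl_two_body by blast
qed

end
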